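(* Let $X$ be an upwards skip-free Lévy chain on $\mathbb{Z}_h$. For each $q\ge0$, $W^{(q)}:[0,\infty)\to[0,\infty)$ is the unique right-continuous and piecewise continuous function of exponential order with Laplace transform $$\widehat{W^{(q)}}(\beta)=\int_0^\infty e^{-\beta x}W^{(q)}(x)\,dx=\frac{e^{\beta h}-1}{\beta h(\psi(\beta)-q)}\qquad(\beta>\Phi(q)).$$ Moreover, for all $y\in\mathbb{Z}_h^+$ and $x\ge0$: $$\mathsf{E}\left[e^{-qT_y}\mathbf{1}_{\{\underline{X}_{T_y}\ge-x\}}\right]=\frac{W^{(q)}(x)}{W^{(q)}(x+y)}.$$
   Context: Fix $h>0$; $\mathbb{Z}_h:=\{hk:k\in\mathbb{Z}\}$, $\mathbb{Z}_h^+:=\mathbb{Z}_h\cap[0,\infty)$. $X$ is an upwards skip-free Lévy chain: a Lévy process (càdlàg paths, $X_0=0$ a.s.) that is compound Poisson (finite Lévy measure $\lambda$, no drift, no Gaussian part) with $\lambda$ supported in $\mathbb{Z}_h$ and with $\lambda|_{(0,\infty)}$ having support exactly $\{h\}$ (so $\lambda(\{h\})>0$). $\psi(\beta)=\int_{\mathbb{R}}(e^{\beta x}-1)\lambda(dx)$, $\beta\ge0$, is the Laplace exponent, $\mathsf{E}[e^{\beta X_t}]=e^{t\psi(\beta)}$; it is strictly convex and continuous on $[0,\infty)$ and tends to $+\infty$; $\Phi(0)$ is the largest root of $\psi|_{[0,\infty)}$, and $\Phi:[0,\infty)\to[\Phi(0),\infty)$ is the inverse of the increasing bijection $\psi:[\Phi(0),\infty)\to[0,\infty)$.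 $T_x:=\inf\{t\ge0:X_t\ge x\}$ ($\inf\emptyset=+\infty$), $\underline{X}_t:=\inf\{X_s:s\in[0,t]\}$, $\underline{X}_\infty:=\inf\{X_s:s\ge0\}$. Scale functions: with $D_1:=-\underline{X}_{T_h}$, the scale function of $X$ is $W(x)=c/\prod_{r=1}^{\lfloor x/h\rfloor}\mathsf{P}(D_1\le(r-1)h)$, $x\ge0$, where $c>0$ is chosen so that $\int_0^\infty e^{-\beta x}W(x)\,dx=\frac{e^{\beta h}-1}{\beta h\psi(\beta)}$ for $\beta>\Phi(0)$. For $b\ge0$, $W_b$ denotes the scale function (defined in the same way, with the same normalization relative to its own Laplace exponent) of the upwards skip-free Lévy chain with Lévy measure $e^{bx}\lambda(dx)$, whose Laplace exponent is $\psi_b=\psi(\cdot+b)-\psi(b)$ (this is the law of $X$ under the exponential change of measure with density $\exp\{bX_t-\psi(b)t\}$ on $\mathcal{F}_t$). For $q\ge0$, $W^{(q)}(x):=e^{\Phi(q)\lfloor1+x/h\rfloor h}W_{\Phi(q)}(x)$, $x\ge0$; in particular $W^{(0)}=W$. A function $f:[0,\infty)\to[0,\infty)$ is of exponential order if there are $\alpha,A\ge0$ with $f(x)\le Ae^{\alpha x}$ for all $x\ge0$. *)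

theory Defs
  imports "HOL-Probability.Probability"
begin

section \<open>Upwards skip-free Levy chains\<close>

text \<open>Processes are indexed by real times; only times \<open>t \<ge> 0\<close> are relevant.\<close>

definition cadlag :: "(real \<Rightarrow> real) \<Rightarrow> bool" where
  "cadlag f \<longleftrightarrow>
     (\<forall>t\<ge>0. continuous (at_right t) f) \<and> (\<forall>t>0. \<exists>l. (f \<longlongrightarrow> l) (at_left t))"

definition levy_process :: "'a measure \<Rightarrow> (real \<Rightarrow> 'a \<Rightarrow> real) \<Rightarrow> bool" where
  "levy_process M X \<longleftrightarrow>
     prob_space M \<and>
     (\<forall>t\<ge>0. X t \<in> borel_measurable M) \<and>
     (\<forall>\<omega>\<in>space M. cadlag (\<lambda>t. X t \<omega>)) \<and>
     (AE \<omega> in M. X 0 \<omega> = 0) \<and>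
     (\<forall>(n::nat) (t :: nat \<Rightarrow> real). 0 \<le> t 0 \<and> (\<forall>i<n. t i \<le> t (Suc i)) \<longrightarrow>
        prob_space.indep_vars M (\<lambda>_. borel) (\<lambda>i \<omega>. X (t (Suc i)) \<omega> - X (t i) \<omega>) {..<n}) \<and>
     (\<forall>s\<ge>0. \<forall>t\<ge>0. distr M borel (\<lambda>\<omega>. X (s + t) \<omega> - X s \<omega>) = distr M borel (X t))"

text \<open>A Levy process without drift and without Gaussian part, whose Levy measure \<open>\<nu>\<close> is finite;
  this is expressed by the Levy-Khintchine formula.\<close>

definition compound_poisson :: "real measure \<Rightarrow> 'a measure \<Rightarrow> (real \<Rightarrow> 'a \<Rightarrow> real) \<Rightarrow> bool" where
  "compound_poisson \<nu> M X \<longleftrightarrow>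
     levy_process M X \<and> sets \<nu> = sets borel \<and> finite_measure \<nu> \<and> emeasure \<nu> {0} = 0 \<and>
     (\<forall>t\<ge>0. \<forall>\<theta>. char (distr M borel (X t)) \<theta> =
        exp (complex_of_real t * (CLINT x|\<nu>. iexp (\<theta> * x) - 1)))"

text \<open>The support of the restriction of \<open>\<mu>\<close> to the subspace \<open>A\<close>.\<close>

definition supp_on :: "'a::topological_space set \<Rightarrow> 'a measure \<Rightarrow> 'a set" where
  "supp_on A \<mu> = {x\<in>A. \<forall>U. open U \<and> x \<in> U \<longrightarrow> emeasure \<mu> (U \<inter> A) > 0}"

definition Zh :: "real \<Rightarrow> real set" where
  "Zh h = range (\<lambda>k::int. h * of_int k)"

definition skipfree_chain ::
    "real \<Rightarrow> real measure \<Rightarrow> 'a measure \<Rightarrow> (real \<Rightarrow> 'a \<Rightarrow> real) \<Rightarrow> bool" where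
  "skipfree_chain h \<nu> M X \<longleftrightarrow>
     compound_poisson \<nu> M X \<and> supp_on UNIV \<nu> \<subseteq> Zh h \<and> supp_on {0<..} \<nu> = {h}"

section \<open>Laplace exponent and its inverse\<close>

definition psi :: "real measure \<Rightarrow> real \<Rightarrow> real" where
  "psi \<nu> \<beta> = (LINT x|\<nu>. exp (\<beta> * x) - 1)"

definition Phi0 :: "real measure \<Rightarrow> real" where
  "Phi0 \<nu> = (GREATEST \<beta>. 0 \<le> \<beta> \<and> psi \<nu> \<beta> = 0)"

definition Phi :: "real measure \<Rightarrow> real \<Rightarrow> real" where
  "Phi \<nu> q = the_inv_into {Phi0 \<nu>..} (psi \<nu>) q"

section \<open>First passage times and running infimum\<close>

text \<open>Both live in the extended reals: the passage time may be \<open>\<infinity>\<close>, and the infimum of a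
  path over all times may be \<open>-\<infinity>\<close>. For \<open>t = \<infinity>\<close>, \<open>run_inf\<close> is the overall infimum.\<close>

definition passage :: "(real \<Rightarrow> 'a \<Rightarrow> real) \<Rightarrow> real \<Rightarrow> 'a \<Rightarrow> ereal" where
  "passage X x \<omega> = Inf (ereal ` {t. 0 \<le> t \<and> x \<le> X t \<omega>})"

definition run_inf :: "(real \<Rightarrow> 'a \<Rightarrow> real) \<Rightarrow> ereal \<Rightarrow> 'a \<Rightarrow> ereal" where
  "run_inf X t \<omega> = Inf ((\<lambda>s. ereal (X s \<omega>)) ` {s. 0 \<le> s \<and> ereal s \<le> t})"

text \<open>The discount factor \<open>e\<^bsup>-qT\<^esup>\<close>, with the convention \<open>0 \<cdot> \<infinity> = 0\<close> in the exponent. (Off a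
  null set the running infimum is \<open>-\<infinity>\<close> when the passage time is infinite, so the value at
  \<open>q = 0\<close>, \<open>T = \<infinity>\<close> is immaterial for the fluctuation identity.)\<close>

definition discount :: "real \<Rightarrow> ereal \<Rightarrow> real" where
  "discount q T =
     (if T = \<infinity> then (if q = 0 then 1 else 0) else exp (- q * real_of_ereal T))"

section \<open>Scale functions\<close>

text \<open>Probabilities and expectations involving passage times are taken under the completion of
  the given probability measure, because these variables are in general measurable only with
  respect to the completion: on a null set the paths need not take values in the lattice.\<close>

definition D1 :: "real \<Rightarrow> (real \<Rightarrow> 'a \<Rightarrow> real) \<Rightarrow> 'a \<Rightarrow> ereal" where
  "D1 h X \<omega> = - run_inf X (passage X h \<omega>) \<omega>"

definition scale_denom ::
    "real \<Rightarrow> 'a measure \<Rightarrow> (real \<Rightarrow> 'a \<Rightarrow> real) \<Rightarrow> real \<Rightarrow> real" where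
  "scale_denom h M X x =
     (\<Prod>r = 1..nat \<lfloor>x / h\<rfloor>.
        measure (completion M) {\<omega> \<in> space M. D1 h X \<omega> \<le> ereal ((real r - 1) * h)})"

definition has_laplace :: "(real \<Rightarrow> real) \<Rightarrow> real \<Rightarrow> real \<Rightarrow> bool" where
  "has_laplace f \<beta> v \<longleftrightarrow>
     set_integrable lborel {0..} (\<lambda>x. exp (- \<beta> * x) * f x) \<and>
     (LINT x:{0..}|lborel. exp (- \<beta> * x) * f x) = v"

definition scale_const ::
    "real \<Rightarrow> real measure \<Rightarrow> 'a measure \<Rightarrow> (real \<Rightarrow> 'a \<Rightarrow> real) \<Rightarrow> real" where
  "scale_const h \<nu> M X = (THE c. c > 0 \<and>
     (\<forall>\<beta>>Phi \<nu> 0. has_laplace (\<lambda>x. c / scale_denom h M X x) \<beta>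
        ((exp (\<beta> * h) - 1) / (\<beta> * h * psi \<nu> \<beta>))))"

definition scale_fun ::
    "real \<Rightarrow> real measure \<Rightarrow> 'a measure \<Rightarrow> (real \<Rightarrow> 'a \<Rightarrow> real) \<Rightarrow> real \<Rightarrow> real" where
  "scale_fun h \<nu> M X x = scale_const h \<nu> M X / scale_denom h M X x"

text \<open>The Levy measure \<open>e\<^bsup>bx\<^esup> \<nu>(dx)\<close>.\<close>

definition tilt :: "real \<Rightarrow> real measure \<Rightarrow> real measure" where
  "tilt b \<nu> = density \<nu> (\<lambda>x. ennreal (exp (b * x)))"

text \<open>The upwards skip-free Levy chain with a given Levy measure is realised as the coordinate
  process on a space of paths. The Levy measure determines the law of the chain, so the scale
  function does not depend on the choice.\<close>

definition coord :: "real \<Rightarrow> (real \<Rightarrow> real) \<Rightarrow> real" where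
  "coord t \<omega> = \<omega> t"

definition chain_law :: "real \<Rightarrow> real measure \<Rightarrow> (real \<Rightarrow> real) measure" where
  "chain_law h \<nu> = (SOME P. skipfree_chain h \<nu> P coord)"

definition W_tilt :: "real \<Rightarrow> real measure \<Rightarrow> real \<Rightarrow> real \<Rightarrow> real" where
  "W_tilt h \<nu> b x = scale_fun h (tilt b \<nu>) (chain_law h (tilt b \<nu>)) coord x"

definition Wq :: "real \<Rightarrow> real measure \<Rightarrow> real \<Rightarrow> real \<Rightarrow> real" where
  "Wq h \<nu> q x = exp (Phi \<nu> q * of_int \<lfloor>1 + x / h\<rfloor> * h) * W_tilt h \<nu> (Phi \<nu> q) x"

section \<open>Function class for the uniqueness assertion\<close>

text \<open>Functions on \<open>[0,\<infinity>)\<close> are total functions on the reals of which only the values on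
  \<open>[0,\<infinity>)\<close> matter. Piecewise continuity: finitely many discontinuities in every bounded interval,
  each of them with finite one-sided limits.\<close>

definition right_continuous :: "(real \<Rightarrow> real) \<Rightarrow> bool" where
  "right_continuous f \<longleftrightarrow> (\<forall>x\<ge>0. continuous (at_right x) f)"

definition piecewise_continuous :: "(real \<Rightarrow> real) \<Rightarrow> bool" where
  "piecewise_continuous f \<longleftrightarrow>
     (\<forall>b\<ge>0. finite {x \<in> {0..b}. \<not> continuous (at x within {0..}) f}) \<and>
     (\<forall>x\<ge>0. \<exists>l. (f \<longlongrightarrow> l) (at_right x)) \<and>
     (\<forall>x>0. \<exists>l. (f \<longlongrightarrow> l) (at_left x))"

definition exponential_order :: "(real \<Rightarrow> real) \<Rightarrow> bool" where
  "exponential_order f \<longleftrightarrow> (\<exists>\<alpha>\<ge>0. \<exists>A\<ge>0. \<forall>x\<ge>0. f x \<le> A * exp (\<alpha> * x))"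

definition admissible :: "(real \<Rightarrow> real) \<Rightarrow> bool" where
  "admissible f \<longleftrightarrow>
     (\<forall>x\<ge>0. 0 \<le> f x) \<and> right_continuous f \<and> piecewise_continuous f \<and> exponential_order f"

definition scale_transform :: "real \<Rightarrow> real measure \<Rightarrow> real \<Rightarrow> (real \<Rightarrow> real) \<Rightarrow> bool" where
  "scale_transform h \<nu> q f \<longleftrightarrow>
     (\<forall>\<beta>>Phi \<nu> q. has_laplace f \<beta> ((exp (\<beta> * h) - 1) / (\<beta> * h * (psi \<nu> \<beta> - q))))"

end

theory Submission
  imports Defs
begin

text \<open>
  The functions \<open>W\<^sup>(\<^sup>q\<^sup>)\<close> are constant on the cells of the lattice, and their values
  \<open>w\<^sub>n\<close> there solve \<open>L w = q w\<close>, where \<open>L\<close> is the generator of the chain; as upward jumps have size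
  \<open>h\<close>, this is a recursion for \<open>w\<close>, and its generating function is the stated Laplace transform.
  It converges for \<open>\<beta> > \<Phi>(q)\<close> because after tilting by \<open>\<Phi>(q)\<close> the chain does not
  drift to \<open>-\<infinity>\<close>, so that the increments of \<open>w\<close> are bounded. Since \<open>L w = q w\<close>, the discounted
  value of \<open>w\<close> along a time grid of width \<open>\<delta>\<close>, stopped at the exit from \<open>[-x, y)\<close>, is a
  martingale up to an error \<open>O(\<delta>\<^sup>2)\<close> per step; letting \<open>\<delta>\<close> tend to 0 gives the fluctuation identity
  without the strong Markov property. For \<open>q = 0\<close> and \<open>y = h\<close> it evaluates the products that define
  the scale functions. The tilted chain is built from independent tilted copies of the chain
  on unit time intervals.
\<close>

section \<open>Compound Poisson laws on the integers\<close>

text \<open>\<open>Wq\<close> is defined through \<open>chain_law\<close>, a choice among measures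
  on path space, and says something only once a chain with the tilted Levy measure is known to
  exist; this is why such a chain has to be built. The density
  \<open>exp (b X\<^sub>t - t \<psi>(b))\<close> changes with \<open>t\<close> and gives no single
  density for all times, hence the restriction to unit intervals and the gluing. Once a chain
  exists, its scale function depends on the Levy measure alone. The exit identity is proved for
  every solution \<open>w\<close> of the recursion, because it serves twice: with
  \<open>q = 0\<close> for the tilted chain, where it evaluates the defining products, and with the
  given \<open>q\<close> for the original chain, where it is the claim. The grid has width
  \<open>2^(-N)\<close> and horizon \<open>N\<close>: its \<open>N 2^N\<close> steps with an error
  of order \<open>4^(-N)\<close> each leave a total of order \<open>N 2^(-N)\<close>, which vanishes
  while the horizon grows past every exit time.\<close>

lemma integral_bind_pmf_real:
  fixes f :: "'b \<Rightarrow> real"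
  assumes "\<And>x. \<bar>f x\<bar> \<le> B"
  shows "(LINT x|bind_pmf p k. f x) = (LINT y|p. LINT x|k y. f x)"
  unfolding measure_pmf_bind
  by (rule integral_bind[where K="count_space UNIV" and B=B and B'=1])
     (use assms measurable_measure_pmf[of k] in \<open>auto intro!: measure_pmf.finite_measure_axioms simp: measure_pmf.emeasure_space_le_1\<close>)

lemma integral_bind_pmf_complex:
  fixes f :: "'b \<Rightarrow> complex"
  assumes B: "\<And>x. cmod (f x) \<le> B"
  shows "(LINT x|bind_pmf p k. f x) = (LINT y|p. LINT x|k y. f x)"
proof -
  have int: "integrable (measure_pmf q) f" for q
    by (rule measure_pmf.integrable_const_bound[where B=B]) (use B in auto)
  have int2: "integrable (measure_pmf p) (\<lambda>y. LINT x|k y. f x)"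
  proof (rule measure_pmf.integrable_const_bound[where B=B])
    show "AE y in p. cmod (LINT x|k y. f x) \<le> B"
    proof (rule AE_pmfI)
      fix y
      have "cmod (LINT x|k y. f x) \<le> (LINT x|k y. cmod (f x))"
        by (rule integral_norm_bound)
      also have "\<dots> \<le> (LINT x|k y. B)"
        by (intro integral_mono integrable_norm int) (use B in auto)
      finally show "cmod (LINT x|k y. f x) \<le> B" by simp
    qed
  qed auto
  show ?thesis
  proof (rule complex_eqI)
    have "Re (LINT x|bind_pmf p k. f x) = (LINT x|bind_pmf p k. Re (f x))"
      using int by (simp add: integral_Re)
    also have "\<dots> = (LINT y|p. LINT x|k y. Re (f x))"
      by (rule integral_bind_pmf_real) (use B abs_Re_le_cmod order_trans in blast)
    also have "\<dots> = Re (LINT y|p. LINT x|k y. f x)"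
      using int int2 by (simp add: integral_Re)
    finally show "Re (LINT x|bind_pmf p k. f x) = Re (LINT y|p. LINT x|k y. f x)" .
    have "Im (LINT x|bind_pmf p k. f x) = (LINT x|bind_pmf p k. Im (f x))"
      using int by (simp add: integral_Im)
    also have "\<dots> = (LINT y|p. LINT x|k y. Im (f x))"
      by (rule integral_bind_pmf_real) (use B abs_Im_le_cmod order_trans in blast)
    also have "\<dots> = Im (LINT y|p. LINT x|k y. f x)"
      using int int2 by (simp add: integral_Im)
    finally show "Im (LINT x|bind_pmf p k. f x) = Im (LINT y|p. LINT x|k y. f x)" .
  qed
qed

lemma sums_integral_nat_pmf:
  fixes f :: "nat \<Rightarrow> 'b::{banach, second_countable_topology}"
  assumes int: "integrable (measure_pmf p) f"
  shows "(\<lambda>n. pmf p n *\<^sub>R f n) sums (LINT n|p. f n)"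
proof -
  have "integrable (count_space UNIV) (\<lambda>n. pmf p n *\<^sub>R f n)"
    using int unfolding measure_pmf_eq_density by (subst (asm) integrable_density) auto
  from sums_integral_count_space_nat[OF this] show ?thesis
    unfolding measure_pmf_eq_density by (subst integral_density) auto
qed

primrec walk_pmf :: "int pmf \<Rightarrow> nat \<Rightarrow> int pmf" where
  "walk_pmf J 0 = return_pmf 0"
| "walk_pmf J (Suc n) = bind_pmf (walk_pmf J n) (\<lambda>s. map_pmf ((+) s) J)"

text \<open>Rate 0 occurs at time 0 and is set by hand, as the Poisson law is used with positive
  rates only.\<close>

definition cpoisson_pmf :: "real \<Rightarrow> int pmf \<Rightarrow> int pmf" where
  "cpoisson_pmf a J =
     (if a > 0 then bind_pmf (poisson_pmf a) (walk_pmf J) else return_pmf 0)"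

lemma integral_walk_pmf:
  fixes f :: "int \<Rightarrow> complex"
  assumes f0: "f 0 = 1" and f_add: "\<And>x y. f (x + y) = f x * f y" and f1: "\<And>x. cmod (f x) \<le> 1"
  shows "(LINT x|walk_pmf J n. f x) = (LINT x|J. f x) ^ n"
  by (induction n) (simp_all add: f0 f_add f1 integral_bind_pmf_complex[where B=1] mult.commute)

text \<open>For a character \<open>f\<close> the mean over an \<open>n\<close>-step walk is a power
  \<open>z ^ n\<close>, and the Poisson weights sum these powers to an exponential. With
  \<open>f k = exp (i \<theta> h k)\<close> this becomes the Levy-Khintchine formula.\<close>

lemma integral_cpoisson_pmf:
  fixes f :: "int \<Rightarrow> complex"
  assumes f0: "f 0 = 1" and f_add: "\<And>x y. f (x + y) = f x * f y" and f1: "\<And>x. cmod (f x) \<le> 1"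
    and a: "a \<ge> 0"
  shows "(LINT x|cpoisson_pmf a J. f x) = exp (complex_of_real a * ((LINT x|J. f x) - 1))"
proof (cases "a = 0")
  case True
  then show ?thesis by (simp add: cpoisson_pmf_def f0)
next
  case False
  with a have a: "a > 0" by simp
  define z where "z = (LINT x|J. f x)"
  have "integrable J f"
    by (rule measure_pmf.integrable_const_bound[where B=1]) (use f1 in auto)
  then have "cmod z \<le> (LINT x|J. cmod (f x))"
    unfolding z_def by (intro integral_norm_bound)
  also have "\<dots> \<le> (LINT x|J. 1)"
    by (intro integral_mono integrable_norm) (use f1 \<open>integrable J f\<close> in auto)
  finally have z1: "cmod z \<le> 1" by simp
  have "(LINT x|cpoisson_pmf a J. f x) = (LINT n|poisson_pmf a. z ^ n)"
    using a by (simp add: cpoisson_pmf_def integral_bind_pmf_complex[OF f1]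
        integral_walk_pmf[OF f0 f_add f1] z_def)
  moreover have "integrable (poisson_pmf a) (\<lambda>n. z ^ n)"
    by (rule measure_pmf.integrable_const_bound[where B=1])
       (use z1 in \<open>auto simp: norm_power power_le_one\<close>)
  from sums_integral_nat_pmf[OF this]
  have "(\<lambda>n. pmf (poisson_pmf a) n *\<^sub>R z ^ n) sums (LINT n|poisson_pmf a. z ^ n)" .
  moreover have "(\<lambda>n. pmf (poisson_pmf a) n *\<^sub>R z ^ n) sums (exp (-complex_of_real a) * exp (complex_of_real a * z))"
  proof -
    have "(\<lambda>n. exp (-complex_of_real a) * ((complex_of_real a * z) ^ n /\<^sub>R fact n)) sums (exp (-complex_of_real a) * exp (complex_of_real a * z))"
      by (intro sums_mult exp_converges)
    also have "(\<lambda>n. exp (-complex_of_real a) * ((complex_of_real a * z) ^ n /\<^sub>R fact n)) = (\<lambda>n. pmf (poisson_pmf a) n *\<^sub>R z ^ n)"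
      using a by (auto simp: scaleR_conv_of_real field_simps power_mult_distrib exp_of_real[symmetric])
    finally show ?thesis .
  qed
  ultimately have "(LINT x|cpoisson_pmf a J. f x) = exp (-complex_of_real a) * exp (complex_of_real a * z)"
    using sums_unique2 by metis
  also have "\<dots> = exp (complex_of_real a * (z - 1))"
    by (simp add: exp_add[symmetric] algebra_simps)
  finally show ?thesis unfolding z_def .
qed

text \<open>The difference \<open>1 - exp (- a) * (1 + a)\<close> is the probability of two or more
  jumps when their number is Poisson with parameter \<open>a\<close>.\<close>

lemma exp_quadratic_bound:
  fixes a :: real
  assumes "a \<ge> 0"
  shows "\<bar>exp (- a) * (1 + a) - 1\<bar> \<le> a\<^sup>2"
proof -
  have "exp (-a) * (1 + a) \<le> exp (-a) * exp a"
    by (intro mult_left_mono) auto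
  then have 1: "exp (-a) * (1 + a) \<le> 1" by (simp add: exp_minus field_simps)
  have "(1 - a) * (1 + a) \<le> exp (-a) * (1 + a)"
    by (intro mult_right_mono) (use assms exp_ge_add_one_self[of "-a"] in auto)
  then have "1 - a\<^sup>2 \<le> exp (-a) * (1 + a)" by (simp add: power2_eq_square algebra_simps)
  with 1 show ?thesis by auto
qed

text \<open>The main term keeps the exact weights of zero and one jump; what remains lives on the
  event of two or more jumps, of probability at most \<open>a\<^sup>2\<close>.\<close>

lemma cpoisson_pmf_first_order:
  fixes g :: "int \<Rightarrow> real"
  assumes g: "\<And>x. \<bar>g x\<bar> \<le> B" and a: "a > 0"
  shows "\<bar>(LINT x|cpoisson_pmf a J. g x) - exp (-a) * (g 0 + a * (LINT x|J. g x))\<bar> \<le> B * a\<^sup>2"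
proof -
  have "0 \<le> \<bar>g 0\<bar>" by simp
  also have "\<dots> \<le> B" by (rule g)
  finally have B: "B \<ge> 0" .
  define F where "F n = (LINT x|walk_pmf J n. g x)" for n
  have intg: "integrable (measure_pmf q) g" for q
    by (rule measure_pmf.integrable_const_bound[where B=B]) (use g in auto)
  have F: "\<bar>F n\<bar> \<le> B" for n
  proof -
    have "\<bar>F n\<bar> \<le> (LINT x|walk_pmf J n. \<bar>g x\<bar>)"
      unfolding F_def by (rule integral_abs_bound)
    also have "\<dots> \<le> (LINT x|walk_pmf J n. B)"
      by (intro integral_mono integrable_abs intg) (use g in auto)
    finally show ?thesis by simp
  qed
  have F0: "F 0 = g 0" by (simp add: F_def)
  have "walk_pmf J 1 = J" by (simp add: bind_return_pmf map_pmf_idI)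
  then have F1: "F 1 = (LINT x|J. g x)" by (simp add: F_def)
  let ?P = "poisson_pmf a"
  have int: "integrable (measure_pmf ?P) h" if "\<And>n. \<bar>h n\<bar> \<le> B" for h :: "nat \<Rightarrow> real"
    by (rule measure_pmf.integrable_const_bound[where B=B]) (use that in auto)
  have "(LINT x|cpoisson_pmf a J. g x) = (LINT n|?P. F n)"
    using a by (simp add: cpoisson_pmf_def integral_bind_pmf_real[OF g] F_def)
  also have "\<dots> = (LINT n|?P. F n * indicator {0,1} n + F n * indicator (-{0,1}) n)"
    by (rule Bochner_Integration.integral_cong) (auto simp: indicator_def)
  also have "\<dots> = (LINT n|?P. F n * indicator {0,1} n) + (LINT n|?P. F n * indicator (-{0,1}) n)"
    by (rule Bochner_Integration.integral_add; rule int) (use B F in \<open>auto simp: indicator_def\<close>)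
  also have "(LINT n|?P. F n * indicator {0,1} n) = (\<Sum>n\<in>{0,1}. F n * indicator {0,1} n * pmf ?P n)"
    by (rule integral_measure_pmf_real) (auto simp: indicator_def split: if_splits)
  also have "\<dots> = exp (-a) * (g 0 + a * (LINT x|J. g x))"
    using a F0 F1 by (simp add: algebra_simps)
  finally have "(LINT x|cpoisson_pmf a J. g x) - exp (-a) * (g 0 + a * (LINT x|J. g x))
      = (LINT n|?P. F n * indicator (-{0,1}) n)" by simp
  also have "\<bar>\<dots>\<bar> \<le> (LINT n|?P. \<bar>F n * indicator (-{0,1}) n\<bar>)"
    by (rule integral_abs_bound)
  also have "\<dots> \<le> (LINT n|?P. B * indicator (-{0,1}) n)"
    by (intro integral_mono int) (use B F in \<open>auto simp: indicator_def\<close>)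
  also have "\<dots> = B * measure ?P (-{0,1})" by simp
  also have "measure ?P (-{0,1}) = 1 - measure ?P {0,1}"
    using measure_pmf.prob_compl[of "{0,1}" ?P] by (simp add: Compl_eq_Diff_UNIV)
  also have "measure ?P {0,1} = exp (-a) * (1 + a)"
    using a by (simp add: measure_measure_pmf_finite algebra_simps)
  also have "B * (1 - exp (-a) * (1 + a)) \<le> B * a\<^sup>2"
    using exp_quadratic_bound[of a] a B by (intro mult_left_mono) auto
  finally show ?thesis .
qed

text \<open>Repeated jumps by 1 reach any height. This later shows that an increment over a unit of
  time exceeds any given bound with positive probability.\<close>

lemma set_cpoisson_pmf:
  assumes "1 \<in> set_pmf J" "a > 0"
  shows "int n \<in> set_pmf (cpoisson_pmf a J)"
proof -
  have "int n \<in> set_pmf (walk_pmf J n)"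
  proof (induction n)
    case (Suc n)
    then show ?case using assms(1) by (force simp: add.commute)
  qed simp
  then show ?thesis using assms(2) by (auto simp: cpoisson_pmf_def)
qed

lemma measure_pmf_eq_density_of:
  assumes "\<And>k. pmf p' k = pmf p k * f k" "\<And>k. f k \<ge> 0"
  shows "measure_pmf p' = density (measure_pmf p) (\<lambda>k. ennreal (f k))"
  unfolding measure_pmf_eq_density
  by (subst density_density_eq) (auto simp: assms ennreal_mult)

text \<open>The exponential weight is multiplicative along the steps of the walk, so tilting
  commutes with convolution. As \<open>J'\<close> is a probability law, \<open>m\<close> is
  necessarily the exponential moment of \<open>J\<close>.\<close>

lemma pmf_walk_tilt:
  assumes J': "\<And>k. pmf J' k = pmf J k * (exp (\<theta> * of_int k) / m)" and m: "m > 0"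
  shows "pmf (walk_pmf J' n) k = pmf (walk_pmf J n) k * (exp (\<theta> * of_int k) / m ^ n)"
proof (induction n arbitrary: k)
  case 0
  then show ?case by (simp add: indicator_def)
next
  case (Suc n)
  have shift: "pmf (map_pmf ((+) s) q) k = pmf q (k - s)" for s :: int and q
    using pmf_map_inj'[of "(+) s" q "k - s"] by simp
  have "measure_pmf (walk_pmf J' n) =
      density (walk_pmf J n) (\<lambda>s. ennreal (exp (\<theta> * of_int s) / m ^ n))"
    by (rule measure_pmf_eq_density_of) (use Suc m in auto)
  then have "pmf (walk_pmf J' (Suc n)) k =
      (LINT s|density (walk_pmf J n) (\<lambda>s. ennreal (exp (\<theta> * of_int s) / m ^ n)). pmf J' (k - s))"
    by (simp add: pmf_bind shift)
  also have "\<dots> = (LINT s|walk_pmf J n. exp (\<theta> * of_int s) / m ^ n * pmf J' (k - s))"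
    using m by (subst integral_density) auto
  also have "\<dots> = (LINT s|walk_pmf J n. pmf J (k - s) * (exp (\<theta> * of_int k) / m ^ Suc n))"
    by (rule Bochner_Integration.integral_cong)
       (use m in \<open>auto simp: J' field_simps exp_add[symmetric]\<close>)
  also have "\<dots> = pmf (walk_pmf J (Suc n)) k * (exp (\<theta> * of_int k) / m ^ Suc n)"
    by (simp add: pmf_bind shift)
  finally show ?case .
qed

text \<open>The factor \<open>m ^ n\<close> in the Poisson weight of the new rate
  \<open>a * m\<close> cancels the normalisation of the \<open>n\<close>-step walk; only
  \<open>exp (- a * (m - 1))\<close>, the same for every \<open>n\<close>, is left.\<close>

lemma pmf_cpoisson_tilt:
  assumes J': "\<And>k. pmf J' k = pmf J k * (exp (\<theta> * of_int k) / m)" and m: "m > 0" and a: "a \<ge> 0"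
  shows "pmf (cpoisson_pmf (a * m) J') k =
    pmf (cpoisson_pmf a J) k * exp (\<theta> * of_int k - a * (m - 1))"
proof (cases "a = 0")
  case True
  then show ?thesis by (simp add: cpoisson_pmf_def indicator_def)
next
  case False
  with a have a: "a > 0" by simp
  have s: "(\<lambda>n. pmf (poisson_pmf r) n *\<^sub>R pmf (walk_pmf q n) k) sums pmf (cpoisson_pmf r q) k"
    if "r > 0" for r q
  proof -
    have "integrable (poisson_pmf r) (\<lambda>n. pmf (walk_pmf q n) k)"
      by (rule measure_pmf.integrable_const_bound[where B=1]) (auto simp: pmf_le_1)
    from sums_integral_nat_pmf[OF this] show ?thesis
      using that by (simp add: cpoisson_pmf_def pmf_bind)
  qed
  have "(\<lambda>n. pmf (poisson_pmf a) n *\<^sub>R pmf (walk_pmf J n) k * exp (\<theta> * of_int k - a * (m - 1)))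
      sums (pmf (cpoisson_pmf a J) k * exp (\<theta> * of_int k - a * (m - 1)))"
    by (intro sums_mult2 s a)
  also have "(\<lambda>n. pmf (poisson_pmf a) n *\<^sub>R pmf (walk_pmf J n) k * exp (\<theta> * of_int k - a * (m - 1))) =
    (\<lambda>n. pmf (poisson_pmf (a * m)) n *\<^sub>R pmf (walk_pmf J' n) k)"
    using m a by (auto simp: pmf_walk_tilt[OF J' m] fun_eq_iff field_simps exp_diff exp_add exp_minus power_mult_distrib)
  finally show ?thesis
    using s[of "a * m" J'] m a sums_unique2 by fastforce
qed

section \<open>The Laplace exponent of an upwards skip-free jump measure\<close>

text \<open>The assumptions concern the measure only, so that the tilted measure is an instance
  before any chain belonging to it has been constructed.\<close>

locale skipfree_measure =
  fixes h :: real and \<nu> :: "real measure"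
  assumes h_pos: "h > 0"
    and sets_nu [measurable_cong, simp]: "sets \<nu> = sets borel"
    and finite_nu: "finite_measure \<nu>"
    and nu_zero: "emeasure \<nu> {0} = 0"
    and supp_nu: "supp_on UNIV \<nu> \<subseteq> Zh h"
    and supp_nu_pos: "supp_on {0<..} \<nu> = {h}"
begin

sublocale finite_measure \<nu> by (rule finite_nu)

lemma space_nu [simp]: "space \<nu> = UNIV"
  using sets_eq_imp_space_eq[OF sets_nu] by simp

text \<open>Points outside a support have null neighbourhoods; by Lindelof's theorem countably many
  of these cover all such points, so together they are null.\<close>

lemma AE_not_in_null_cover:
  fixes B :: "real set"
  assumes "A \<in> sets borel" and "\<And>x. x \<in> B \<Longrightarrow> \<exists>U. open U \<and> x \<in> U \<and> emeasure \<nu> (U \<inter> A) = 0"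
  shows "AE x in \<nu>. x \<in> A \<longrightarrow> x \<notin> B"
proof -
  define F where "F = {U. open U \<and> emeasure \<nu> (U \<inter> A) = 0}"
  obtain F' where F': "F' \<subseteq> F" "countable F'" "\<Union>F' = \<Union>F"
    using Lindelof[of F] unfolding F_def by auto
  have "AE x in \<nu>. \<forall>U\<in>F'. x \<notin> U \<inter> A"
  proof (rule AE_ball_countable'[OF _ F'(2)])
    fix U assume "U \<in> F'"
    then have U: "open U" "emeasure \<nu> (U \<inter> A) = 0" using F'(1) by (auto simp: F_def)
    then have "U \<inter> A \<in> null_sets \<nu>" using assms(1) by auto
    then show "AE x in \<nu>. x \<notin> U \<inter> A" by (rule AE_not_in)
  qed
  then show ?thesis
  proof eventually_elim
    case (elim x)
    have False if "x \<in> A" "x \<in> B"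
    proof -
      from assms(2)[OF that(2)] have "x \<in> \<Union>F" unfolding F_def by blast
      with F'(3) have "x \<in> \<Union>F'" by simp
      with elim that show False by blast
    qed
    then show ?case by blast
  qed
qed

text \<open>The support on the positive half-line excludes lattice points above \<open>h\<close>, so
  the atoms can be counted downwards from \<open>h\<close> by a natural number. The index 1 is the
  point 0, which carries no mass.\<close>

lemma AE_nu_lattice: "AE x in \<nu>. \<exists>j::nat. x = h * (1 - real j)"
proof -
  have "AE x in \<nu>. x \<in> UNIV \<longrightarrow> x \<notin> - Zh h"
  proof (rule AE_not_in_null_cover)
    fix x assume "x \<in> - Zh h"
    then have "x \<notin> supp_on UNIV \<nu>" using supp_nu by blast
    then show "\<exists>U. open U \<and> x \<in> U \<and> emeasure \<nu> (U \<inter> UNIV) = 0"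
      by (auto simp: supp_on_def zero_less_iff_neq_zero)
  qed simp
  moreover have "AE x in \<nu>. x \<in> {0<..} \<longrightarrow> x \<notin> {0<..} - {h}"
  proof (rule AE_not_in_null_cover)
    fix x assume "x \<in> {0<..} - {h}"
    then have "x \<notin> supp_on {0<..} \<nu>" "x \<in> {0<..}" using supp_nu_pos by auto
    then show "\<exists>U. open U \<and> x \<in> U \<and> emeasure \<nu> (U \<inter> {0<..}) = 0"
      by (auto simp: supp_on_def zero_less_iff_neq_zero)
  qed simp
  ultimately show ?thesis
  proof eventually_elim
    case (elim x)
    then obtain k where k: "x = h * of_int k" by (auto simp: Zh_def)
    have "k \<le> 1"
    proof (rule ccontr)
      assume "\<not> k \<le> 1"
      then have "x > 0" "x \<noteq> h" using k h_pos by auto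
      with elim show False by auto
    qed
    then show ?case using k by (intro exI[of _ "nat (1 - k)"]) auto
  qed
qed

lemma nu_h_pos: "measure \<nu> {h} > 0"
proof -
  have "h \<in> supp_on {0<..} \<nu>" using supp_nu_pos by simp
  then have "open U \<Longrightarrow> h \<in> U \<Longrightarrow> emeasure \<nu> (U \<inter> {0<..}) > 0" for U
    by (auto simp: supp_on_def)
  \<comment> \<open>Membership in the support only gives mass to neighbourhoods of \<open>h\<close>;
    among the points \<open>h * (1 - j)\<close> this one contains \<open>h\<close> alone.\<close>
  from this[of "{h/2<..}"] have "emeasure \<nu> ({h/2<..} \<inter> {0<..}) > 0"
    using h_pos by simp
  also have "emeasure \<nu> ({h/2<..} \<inter> {0<..}) \<le> emeasure \<nu> {h}"
  proof (rule emeasure_mono_AE)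
    show "AE x in \<nu>. x \<in> {h / 2<..} \<inter> {0<..} \<longrightarrow> x \<in> {h}"
      using AE_nu_lattice
    proof eventually_elim
      case (elim x)
      then obtain j :: nat where j: "x = h * (1 - real j)" by blast
      show ?case
      proof
        assume "x \<in> {h / 2<..} \<inter> {0<..}"
        then have "h * real j < h * 1" using j h_pos by (auto simp: algebra_simps)
        then have "j = 0" using h_pos by simp
        with j show "x \<in> {h}" by simp
      qed
    qed
  qed simp
  finally show ?thesis by (simp add: emeasure_eq_measure)
qed

section \<open>The jump law on the lattice\<close>

definition mass :: real where "mass = measure \<nu> UNIV"

lemma mass_pos: "mass > 0"
  using nu_h_pos finite_measure_mono[of "{h}" UNIV] by (simp add: mass_def)

definition jump_pmf :: "int pmf" where
  "jump_pmf = embed_pmf (\<lambda>k. measure \<nu> {h * of_int k} / mass)"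

lemma emeasure_nu_sum:
  assumes A: "A \<in> sets borel"
  shows "emeasure \<nu> A = (\<integral>\<^sup>+k. ennreal (measure \<nu> {h * of_int k}) * indicator A (h * of_int k) \<partial>count_space (UNIV :: int set))"
    (is "_ = ?R")
proof -
  have "emeasure \<nu> A = emeasure \<nu> (\<Union>k::int. A \<inter> {h * of_int k})"
  proof (rule emeasure_eq_AE)
    show "AE x in \<nu>. x \<in> A \<longleftrightarrow> x \<in> (\<Union>k::int. A \<inter> {h * of_int k})"
      using AE_nu_lattice
    proof eventually_elim
      case (elim x)
      then obtain j :: nat where "x = h * (1 - real j)" by blast
      then have "x = h * of_int (1 - int j)" by simp
      then show ?case by blast
    qed
  qed (use A in auto)
  also have "\<dots> = (\<integral>\<^sup>+k. emeasure \<nu> (A \<inter> {h * of_int k}) \<partial>count_space (UNIV :: int set))"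
    by (rule emeasure_UN_countable) (use A h_pos in \<open>auto simp: disjoint_family_on_def\<close>)
  also have "\<dots> = ?R"
    by (rule nn_integral_cong) (auto simp: indicator_def emeasure_eq_measure)
  finally show ?thesis .
qed

lemma pmf_jump [simp]: "pmf jump_pmf k = measure \<nu> {h * of_int k} / mass"
  unfolding jump_pmf_def
proof (rule pmf_embed_pmf)
  have "(\<integral>\<^sup>+ k. ennreal (measure \<nu> {h * of_int k} / mass) \<partial>count_space UNIV) =
      (\<integral>\<^sup>+ k. ennreal (1 / mass) * (ennreal (measure \<nu> {h * of_int k}) * indicator UNIV (h * of_int k)) \<partial>count_space UNIV)"
    using mass_pos by (intro nn_integral_cong) (simp add: ennreal_mult[symmetric])
  also have "\<dots> = ennreal (1 / mass) * emeasure \<nu> UNIV"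
    by (subst nn_integral_cmult) (simp_all add: emeasure_nu_sum)
  also have "\<dots> = 1"
    using mass_pos by (simp add: emeasure_eq_measure mass_def[symmetric] ennreal_mult[symmetric])
  finally show "(\<integral>\<^sup>+ k. ennreal (measure \<nu> {h * of_int k} / mass) \<partial>count_space UNIV) = 1" .
qed (use mass_pos in auto)

lemma nu_eq_distr_jump: "\<nu> = density (distr jump_pmf borel (\<lambda>k. h * of_int k)) (\<lambda>_. ennreal mass)"
proof (rule measure_eqI)
  fix A assume "A \<in> sets \<nu>"
  then have A[measurable]: "A \<in> sets borel" by simp
  have "emeasure (density (distr jump_pmf borel (\<lambda>k. h * of_int k)) (\<lambda>_. ennreal mass)) A =
      ennreal mass * (\<integral>\<^sup>+ x. indicator A x \<partial>distr jump_pmf borel (\<lambda>k. h * of_int k))"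
    by (simp add: emeasure_density_const)
  also have "\<dots> = ennreal mass * (\<integral>\<^sup>+ k. indicator A (h * of_int k) \<partial>jump_pmf)"
    by (subst nn_integral_distr) auto
  also have "\<dots> = ennreal mass * (\<integral>\<^sup>+ k. ennreal (pmf jump_pmf k) * indicator A (h * of_int k) \<partial>count_space UNIV)"
    by (subst nn_integral_measure_pmf) simp
  also have "\<dots> = (\<integral>\<^sup>+ k. ennreal mass * (ennreal (pmf jump_pmf k) * indicator A (h * of_int k)) \<partial>count_space UNIV)"
    by (subst nn_integral_cmult) simp_all
  also have "\<dots> = (\<integral>\<^sup>+k. ennreal (measure \<nu> {h * of_int k}) * indicator A (h * of_int k) \<partial>count_space UNIV)"
    using mass_pos by (intro nn_integral_cong) (simp add: mult.assoc[symmetric] ennreal_mult[symmetric])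
  also have "\<dots> = emeasure \<nu> A" using emeasure_nu_sum[OF A] by simp
  finally show "emeasure \<nu> A = emeasure (density (distr jump_pmf borel (\<lambda>k. h * of_int k)) (\<lambda>_. ennreal mass)) A" by simp
qed simp

lemma integral_nu:
  fixes f :: "real \<Rightarrow> 'b::{banach, second_countable_topology}"
  assumes [measurable]: "f \<in> borel_measurable borel"
  shows "(LINT x|\<nu>. f x) = mass *\<^sub>R (LINT k|jump_pmf. f (h * of_int k))"
  using mass_pos by (subst nu_eq_distr_jump) (simp add: integral_density integral_distr)

lemma jump_support:
  assumes "k \<in> set_pmf jump_pmf"
  shows "k \<le> 1" "k \<noteq> 0"
proof -
  have pos: "measure \<nu> {h * of_int k} > 0"
    using assms mass_pos by (auto simp: set_pmf_iff zero_less_measure_iff)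
  then show "k \<noteq> 0" using nu_zero by (auto simp: measure_def)
  show "k \<le> 1"
  proof (rule ccontr)
    assume k: "\<not> k \<le> 1"
    have "AE x in \<nu>. x \<notin> {h * of_int k}"
      using AE_nu_lattice
    proof eventually_elim
      case (elim x)
      then obtain j :: nat where "x = h * (1 - real j)" by blast
      moreover have "1 - real j < real_of_int k" using k by linarith
      ultimately show ?case using h_pos by simp
    qed
    then have "emeasure \<nu> {h * of_int k} = 0"
      by (subst (asm) AE_iff_measurable[of "{h * of_int k}"]) auto
    with pos show False by (simp add: measure_def)
  qed
qed

lemma one_in_jump: "1 \<in> set_pmf jump_pmf"
  using nu_h_pos mass_pos by (simp add: set_pmf_iff)

text \<open>With this index \<open>coef 0\<close> is the rate of the only upward jump,
  \<open>coef 1 = 0\<close>, and \<open>coef (Suc k)\<close> is the rate of moving down by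
  \<open>k\<close> lattice steps.\<close>

definition coef :: "nat \<Rightarrow> real" where "coef j = measure \<nu> {h * (1 - real j)}"

lemma coef_nonneg [simp]: "coef j \<ge> 0" by (simp add: coef_def)
lemma coef_0_pos: "coef 0 > 0" using nu_h_pos by (simp add: coef_def)

lemma pmf_jump_coef: "pmf jump_pmf (1 - int j) = coef j / mass"
  by (simp add: coef_def)

lemma sums_integral_jump:
  fixes f :: "int \<Rightarrow> real"
  assumes "integrable (measure_pmf jump_pmf) f"
  shows "(\<lambda>j. coef j * f (1 - int j)) sums (mass * (LINT k|jump_pmf. f k))"
proof -
  define Jn where "Jn = map_pmf (\<lambda>k. nat (1 - k)) jump_pmf"
  have J: "jump_pmf = map_pmf (\<lambda>j. 1 - int j) Jn"
    unfolding Jn_def by (subst map_pmf_comp, rule map_pmf_idI[symmetric]) (use jump_support in force)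
  have pmf: "pmf Jn j = coef j / mass" for j
    using pmf_map_inj'[of "\<lambda>j. 1 - int j" Jn j] pmf_jump_coef[of j] by (simp add: J[symmetric] inj_def)
  have "integrable (measure_pmf Jn) (\<lambda>j. f (1 - int j))"
    using assms by (subst (asm) J) (simp add: map_pmf_rep_eq integrable_distr_eq)
  from sums_mult[OF sums_integral_nat_pmf[OF this], of mass]
  have "(\<lambda>j. coef j * f (1 - int j)) sums (mass * (LINT j|Jn. f (1 - int j)))"
    using mass_pos by (simp add: pmf)
  then show ?thesis by (subst J) simp
qed

section \<open>Convexity, continuity and growth of the Laplace exponent; its inverse\<close>

lemma integrable_jump_exp:
  assumes "\<beta> \<ge> 0" shows "integrable (measure_pmf jump_pmf) (\<lambda>k. exp (\<beta> * (h * of_int k)))"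
proof (rule measure_pmf.integrable_const_bound[where B="exp (\<beta> * h)"])
  show "AE k in jump_pmf. norm (exp (\<beta> * (h * of_int k))) \<le> exp (\<beta> * h)"
  proof (rule AE_pmfI)
    fix k assume "k \<in> set_pmf jump_pmf"
    then have "real_of_int k \<le> 1" using jump_support by simp
    then have "\<beta> * (h * of_int k) \<le> \<beta> * (h * 1)"
      using assms h_pos by (intro mult_left_mono) auto
    then show "norm (exp (\<beta> * (h * of_int k))) \<le> exp (\<beta> * h)" by simp
  qed
qed simp

lemma psi_jump:
  assumes "\<beta> \<ge> 0"
  shows "psi \<nu> \<beta> = mass * ((LINT k|jump_pmf. exp (\<beta> * (h * of_int k))) - 1)"
  using integrable_jump_exp[OF assms] by (simp add: psi_def integral_nu)

lemma psi_sums: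
  assumes "\<beta> \<ge> 0"
  shows "(\<lambda>j. coef j * exp (\<beta> * h * (1 - real j))) sums (psi \<nu> \<beta> + mass)"
  using sums_integral_jump[OF integrable_jump_exp[OF assms]] psi_jump[OF assms]
  by (simp add: algebra_simps)

lemma psi_0 [simp]: "psi \<nu> 0 = 0" by (simp add: psi_def)

lemma psi_convex:
  assumes "s \<ge> 0" "t \<ge> 0" "0 \<le> u" "u \<le> 1"
  shows "psi \<nu> ((1 - u) * s + u * t) \<le> (1 - u) * psi \<nu> s + u * psi \<nu> t"
proof -
  have st: "0 \<le> (1 - u) * s + u * t" using assms by simp
  let ?e = "\<lambda>\<beta> k. exp (\<beta> * (h * of_int k))"
  have "(LINT k|jump_pmf. ?e ((1 - u) * s + u * t) k) \<le> (LINT k|jump_pmf. (1 - u) * ?e s k + u * ?e t k)"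
  proof (rule integral_mono)
    show "integrable jump_pmf (?e ((1 - u) * s + u * t))"
      by (rule integrable_jump_exp[OF st])
    show "integrable jump_pmf (\<lambda>k. (1 - u) * ?e s k + u * ?e t k)"
      using assms by (intro Bochner_Integration.integrable_add integrable_mult_right integrable_jump_exp) auto
  next
    fix k :: int
    have "exp ((1 - u) *\<^sub>R (s * (h * k)) + u *\<^sub>R (t * (h * k))) \<le> (1 - u) * ?e s k + u * ?e t k"
      by (rule convex_onD[OF exp_convex]) (use assms in auto)
    then show "?e ((1 - u) * s + u * t) k \<le> (1 - u) * ?e s k + u * ?e t k"
      by (simp add: algebra_simps)
  qed
  also have "\<dots> = (1 - u) * (LINT k|jump_pmf. ?e s k) + u * (LINT k|jump_pmf. ?e t k)"
    using assms by (simp add: integrable_jump_exp)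
  finally have "mass * (LINT k|jump_pmf. ?e ((1 - u) * s + u * t) k) \<le>
     mass * ((1 - u) * (LINT k|jump_pmf. ?e s k) + u * (LINT k|jump_pmf. ?e t k))"
    using mass_pos by (intro mult_left_mono) auto
  then show ?thesis using assms st by (simp add: psi_jump algebra_simps)
qed

lemma psi_continuous: "continuous_on {0..} (psi \<nu>)"
  unfolding continuous_on_sequentially
proof (intro allI ballI impI, elim conjE)
  fix x :: "nat \<Rightarrow> real" and a assume a: "a \<in> {0..}" and x: "\<forall>n. x n \<in> {0..}" and lim: "x \<longlonglongrightarrow> a"
  obtain R where R: "\<And>n. norm (x n) \<le> R" using lim by (meson BseqE convergentI convergent_imp_Bseq)
  have "(\<lambda>n. LINT k|jump_pmf. exp (x n * (h * of_int k))) \<longlonglongrightarrow> (LINT k|jump_pmf. exp (a * (h * of_int k)))"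
  proof (rule integral_dominated_convergence[where w="\<lambda>_. exp (R * h)" and s="\<lambda>n k. exp (x n * (h * of_int k))" and f="\<lambda>k. exp (a * (h * of_int k))"])
    show "AE k in jump_pmf. (\<lambda>n. exp (x n * (h * of_int k))) \<longlonglongrightarrow> exp (a * (h * of_int k))"
      by (intro AE_pmfI tendsto_intros lim)
    show "AE k in jump_pmf. norm (exp (x n * (h * of_int k))) \<le> exp (R * h)" for n
    proof (rule AE_pmfI)
      fix k assume "k \<in> set_pmf jump_pmf"
      then have "real_of_int k \<le> 1" using jump_support by simp
      then have "x n * (h * of_int k) \<le> x n * (h * 1)"
        using x h_pos by (intro mult_left_mono) auto
      also have "\<dots> \<le> R * h" using R[of n] x h_pos by auto
      finally show "norm (exp (x n * (h * of_int k))) \<le> exp (R * h)" by simp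
    qed
  qed auto
  then have "(\<lambda>n. mass * ((LINT k|jump_pmf. exp (x n * (h * of_int k))) - 1)) \<longlonglongrightarrow>
     mass * ((LINT k|jump_pmf. exp (a * (h * of_int k))) - 1)"
    by (intro tendsto_intros)
  then show "(psi \<nu> \<circ> x) \<longlonglongrightarrow> psi \<nu> a"
    using x a by (simp add: psi_jump o_def)
qed

text \<open>Of the series only the term of the upward jump is kept. The bound gives both the growth
  of \<open>psi\<close> to infinity and an upper bound for its roots.\<close>

lemma psi_lower:
  assumes "\<beta> \<ge> 0" shows "coef 0 * (1 + \<beta> * h) - mass \<le> psi \<nu> \<beta>"
proof -
  have "coef 0 * (1 + \<beta> * h) \<le> coef 0 * exp (\<beta> * h * (1 - real 0))"
    by (intro mult_left_mono) auto
  also have "\<dots> \<le> psi \<nu> \<beta> + mass"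
    using sum_le_suminf[OF sums_summable[OF psi_sums[OF assms]], of "{0}"] sums_unique[OF psi_sums[OF assms]]
    by simp
  finally show ?thesis by simp
qed

lemma psi_ge_beyond:
  obtains \<beta> where "\<beta> \<ge> r" "\<beta> \<ge> 0" "psi \<nu> \<beta> \<ge> q"
proof -
  define \<beta> where "\<beta> = max (max 0 r) ((q + mass) / (coef 0 * h))"
  have b: "\<beta> \<ge> r" "\<beta> \<ge> 0" "\<beta> \<ge> (q + mass) / (coef 0 * h)" by (auto simp: \<beta>_def)
  then have "q + mass \<le> \<beta> * (coef 0 * h)"
    using coef_0_pos h_pos by (simp add: pos_divide_le_eq)
  then have "q \<le> coef 0 * (1 + \<beta> * h) - mass" using coef_0_pos by (simp add: algebra_simps)
  with psi_lower[OF b(2)] b that show thesis by force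
qed

text \<open>\<open>GREATEST\<close> denotes an actual root because the set of roots is closed,
  contains 0 and is bounded by \<open>psi_lower\<close>.\<close>

lemma Phi0_root: "0 \<le> Phi0 \<nu>" "psi \<nu> (Phi0 \<nu>) = 0"
  and Phi0_greatest: "0 \<le> \<beta> \<Longrightarrow> psi \<nu> \<beta> = 0 \<Longrightarrow> \<beta> \<le> Phi0 \<nu>"
proof -
  define Z where "Z = {\<beta>. 0 \<le> \<beta> \<and> psi \<nu> \<beta> = 0}"
  have Z: "Z = {0..} \<inter> psi \<nu> -` {0}" by (auto simp: Z_def)
  have "closed Z"
    unfolding Z by (intro continuous_closed_preimage psi_continuous) auto
  moreover have bdd: "bdd_above Z"
  proof (rule bdd_aboveI)
    fix \<beta> assume "\<beta> \<in> Z"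
    then have b: "\<beta> \<ge> 0" "psi \<nu> \<beta> = 0" by (auto simp: Z_def)
    then have "coef 0 * (1 + \<beta> * h) \<le> mass" using psi_lower[of \<beta>] by simp
    then have "\<beta> * (coef 0 * h) \<le> mass" using coef_0_pos by (simp add: algebra_simps)
    then show "\<beta> \<le> mass / (coef 0 * h)" using coef_0_pos h_pos by (simp add: pos_le_divide_eq)
  qed
  moreover have ne: "Z \<noteq> {}" using psi_0 unfolding Z_def by (auto intro!: exI[of _ 0])
  ultimately have SupZ: "Sup Z \<in> Z" by (intro closed_contains_Sup)
  have up: "y \<le> Sup Z" if "y \<in> Z" for y using that bdd by (rule cSup_upper)
  have "Phi0 \<nu> = Sup Z" unfolding Phi0_def
    by (rule Greatest_equality) (use SupZ up in \<open>auto simp: Z_def\<close>)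
  with SupZ up show "0 \<le> Phi0 \<nu>" "psi \<nu> (Phi0 \<nu>) = 0" "0 \<le> \<beta> \<Longrightarrow> psi \<nu> \<beta> = 0 \<Longrightarrow> \<beta> \<le> Phi0 \<nu>"
    by (auto simp: Z_def)
qed

lemma psi_pos:
  assumes "\<beta> > Phi0 \<nu>" shows "psi \<nu> \<beta> > 0"
proof (rule ccontr)
  assume neg: "\<not> psi \<nu> \<beta> > 0"
  obtain b where b: "b \<ge> \<beta>" "psi \<nu> b \<ge> 1" using psi_ge_beyond by metis
  have "continuous_on {\<beta>..b} (psi \<nu>)"
    by (rule continuous_on_subset[OF psi_continuous]) (use assms Phi0_root in auto)
  then obtain z where "\<beta> \<le> z" "z \<le> b" "psi \<nu> z = 0"
    using IVT'[of "psi \<nu>" \<beta> 0 b] neg b by auto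
  then show False using Phi0_greatest[of z] Phi0_root assms by auto
qed

lemma psi_strict_mono:
  assumes "Phi0 \<nu> \<le> s" "s < t" shows "psi \<nu> s < psi \<nu> t"
proof -
  define p where "p = Phi0 \<nu>"
  \<comment> \<open>The point \<open>s\<close> divides the segment from the root \<open>p\<close> to
    \<open>t\<close> in the ratio \<open>u\<close>; convexity then compares
    \<open>psi \<nu> s\<close> with \<open>u\<close> times the positive value at
    \<open>t\<close>.\<close>
  define u where "u = (s - p) / (t - p)"
  have u: "0 \<le> u" "u < 1" using assms unfolding u_def p_def by auto
  have "u * (t - p) = s - p" using assms unfolding u_def p_def by simp
  then have s: "s = (1 - u) * p + u * t" by (simp add: algebra_simps)
  have "psi \<nu> s \<le> (1 - u) * psi \<nu> p + u * psi \<nu> t"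
    unfolding s by (rule psi_convex) (use u assms Phi0_root p_def in auto)
  also have "\<dots> = u * psi \<nu> t" using Phi0_root by (simp add: p_def)
  also have "\<dots> < 1 * psi \<nu> t"
    using psi_pos[of t] u assms by (intro mult_strict_right_mono) auto
  finally show ?thesis by simp
qed

lemma Phi_props:
  assumes "q \<ge> 0"
  shows Phi_ge: "Phi0 \<nu> \<le> Phi \<nu> q" and psi_Phi: "psi \<nu> (Phi \<nu> q) = q"
proof -
  obtain b where b: "b \<ge> Phi0 \<nu>" "psi \<nu> b \<ge> q" using psi_ge_beyond by metis
  have "continuous_on {Phi0 \<nu>..b} (psi \<nu>)"
    by (rule continuous_on_subset[OF psi_continuous]) (use Phi0_root in auto)
  then obtain z where z: "Phi0 \<nu> \<le> z" "psi \<nu> z = q"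
    using IVT'[of "psi \<nu>" "Phi0 \<nu>" q b] b assms Phi0_root by auto
  have inj: "inj_on (psi \<nu>) {Phi0 \<nu>..}"
    by (rule linorder_inj_onI') (use psi_strict_mono in force)
  have "Phi \<nu> q = z" unfolding Phi_def
    using the_inv_into_f_f[OF inj, of z] z by auto
  with z show "Phi0 \<nu> \<le> Phi \<nu> q" "psi \<nu> (Phi \<nu> q) = q" by auto
qed

lemma Phi_nonneg: "q \<ge> 0 \<Longrightarrow> Phi \<nu> q \<ge> 0"
  using Phi_ge Phi0_root by force

lemma psi_gt: "q \<ge> 0 \<Longrightarrow> \<beta> > Phi \<nu> q \<Longrightarrow> psi \<nu> \<beta> > q"
  using psi_strict_mono[OF Phi_ge] psi_Phi by metis

section \<open>Marginal laws and exponential tilting\<close>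

text \<open>An explicit candidate for the law of \<open>X t\<close>; \<open>eq_marginalI\<close>
  identifies the two by Levy's uniqueness theorem.\<close>

definition marginal :: "real \<Rightarrow> real measure" where
  "marginal t = distr (cpoisson_pmf (mass * t) jump_pmf) borel (\<lambda>k. h * of_int k)"

lemma real_distribution_marginal: "real_distribution (marginal t)"
  unfolding real_distribution_def real_distribution_axioms_def marginal_def
  by (auto intro!: measure_pmf.prob_space_distr)

lemma char_marginal:
  assumes "t \<ge> 0"
  shows "char (marginal t) \<theta> = exp (complex_of_real t * (CLINT x|\<nu>. iexp (\<theta> * x) - 1))"
proof -
  let ?f = "\<lambda>k::int. iexp (\<theta> * (h * of_int k))"
  have int: "integrable (measure_pmf jump_pmf) ?f"
    by (rule measure_pmf.integrable_const_bound[where B=1]) auto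
  have "char (marginal t) \<theta> = (LINT k|cpoisson_pmf (mass * t) jump_pmf. ?f k)"
    by (simp add: char_def marginal_def integral_distr)
  also have "\<dots> = exp (complex_of_real (mass * t) * ((LINT k|jump_pmf. ?f k) - 1))"
    by (rule integral_cpoisson_pmf)
       (use assms mass_pos in \<open>auto simp: exp_add[symmetric] algebra_simps\<close>)
  also have "complex_of_real (mass * t) * ((LINT k|jump_pmf. ?f k) - 1) =
      complex_of_real t * (CLINT x|\<nu>. iexp (\<theta> * x) - 1)"
    using int by (simp add: integral_nu scaleR_conv_of_real)
  finally show ?thesis .
qed

lemma eq_marginalI:
  assumes "t \<ge> 0" "real_distribution D"
    and "\<And>\<theta>. char D \<theta> = exp (complex_of_real t * (CLINT x|\<nu>. iexp (\<theta> * x) - 1))"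
  shows "D = marginal t"
  by (rule Levy_uniqueness) (use assms real_distribution_marginal char_marginal in \<open>auto simp: fun_eq_iff\<close>)

section \<open>Exponential tilting of the Levy measure\<close>

lemma emeasure_tilt_eq_0_iff:
  assumes "A \<in> sets borel"
  shows "emeasure (tilt b \<nu>) A = 0 \<longleftrightarrow> emeasure \<nu> A = 0"
proof -
  have "emeasure (tilt b \<nu>) A = 0 \<longleftrightarrow> (AE x in \<nu>. ennreal (exp (b * x)) * indicator A x = 0)"
    unfolding tilt_def using assms by (simp add: emeasure_density nn_integral_0_iff_AE)
  also have "\<dots> \<longleftrightarrow> (AE x in \<nu>. x \<notin> A)"
    by (intro AE_cong) (auto simp: indicator_def)
  also have "\<dots> \<longleftrightarrow> emeasure \<nu> A = 0"
    using assms by (subst AE_iff_measurable[of A]) auto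
  finally show ?thesis .
qed

lemma integrable_exp_nu:
  assumes "b \<ge> 0" shows "integrable \<nu> (\<lambda>x. exp (b * x))"
proof (rule integrable_const_bound[where B="exp (b * h)"])
  show "AE x in \<nu>. norm (exp (b * x)) \<le> exp (b * h)"
    using AE_nu_lattice
  proof eventually_elim
    case (elim x)
    then obtain j :: nat where "x = h * (1 - real j)" by blast
    moreover have "0 \<le> h * real j" using h_pos by simp
    ultimately have "x \<le> h" by (simp add: algebra_simps)
    then show ?case using assms by (simp add: mult_left_mono)
  qed
qed auto

text \<open>The tilted mass is finite because jumps are at most \<open>h\<close>, and the density is
  positive, so null sets and therefore supports are unchanged.\<close>

lemma skipfree_measure_tilt:
  assumes "b \<ge> 0" shows "skipfree_measure h (tilt b \<nu>)"
proof (rule skipfree_measure.intro)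
  show "sets (tilt b \<nu>) = sets borel" by (simp add: tilt_def)
  have "emeasure (tilt b \<nu>) UNIV = (\<integral>\<^sup>+x. ennreal (exp (b * x)) \<partial>\<nu>)"
    unfolding tilt_def by (subst emeasure_density) auto
  also have "\<dots> < \<infinity>"
    using integrable_exp_nu[OF assms] by (simp add: integrable_iff_bounded)
  finally show "finite_measure (tilt b \<nu>)"
    by (intro finite_measureI) (simp add: tilt_def)
  show "emeasure (tilt b \<nu>) {0} = 0" using nu_zero by (simp add: emeasure_tilt_eq_0_iff)
  have "supp_on A (tilt b \<nu>) = supp_on A \<nu>" if "A \<in> sets borel" for A
    unfolding supp_on_def zero_less_iff_neq_zero
    using that by (intro Collect_cong conj_cong refl all_cong) (simp add: emeasure_tilt_eq_0_iff)
  then show "supp_on UNIV (tilt b \<nu>) \<subseteq> Zh h" "supp_on {0<..} (tilt b \<nu>) = {h}"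
    using supp_nu supp_nu_pos by auto
qed (rule h_pos)

lemma measure_tilt:
  assumes "b \<ge> 0" and [measurable]: "A \<in> sets borel"
  shows "measure (tilt b \<nu>) A = (LINT x|\<nu>. indicator A x * exp (b * x))"
proof -
  have "emeasure (tilt b \<nu>) A = (\<integral>\<^sup>+x. ennreal (indicator A x * exp (b * x)) \<partial>\<nu>)"
    unfolding tilt_def by (subst emeasure_density) (auto intro!: nn_integral_cong simp: indicator_def)
  also have "\<dots> = ennreal (LINT x|\<nu>. indicator A x * exp (b * x))"
    by (rule nn_integral_eq_integral)
       (use integrable_real_mult_indicator[OF _ integrable_exp_nu[OF assms(1)], of A]
        in \<open>auto simp: mult.commute\<close>)
  finally show ?thesis
    by (simp add: measure_def)
qed

lemma measure_tilt_singleton: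
  assumes "b \<ge> 0" shows "measure (tilt b \<nu>) {x} = measure \<nu> {x} * exp (b * x)"
proof -
  have "(LINT y|\<nu>. indicator {x} y * exp (b * y)) = (LINT y|\<nu>. indicator {x} y * exp (b * x))"
    by (rule Bochner_Integration.integral_cong) (auto simp: indicator_def)
  then show ?thesis using assms by (simp add: measure_tilt)
qed

context
  fixes b :: real assumes b: "b \<ge> 0"
begin

interpretation T: skipfree_measure h "tilt b \<nu>" by (rule skipfree_measure_tilt[OF b])

lemma mass_tilt: "T.mass = mass + psi \<nu> b"
proof -
  have "T.mass = (LINT x|\<nu>. exp (b * x))"
    using b by (simp add: T.mass_def measure_tilt)
  then show ?thesis using integrable_exp_nu[OF b] by (simp add: psi_def mass_def)
qed

lemma coef_tilt: "T.coef j = coef j * exp (b * h * (1 - real j))"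
  using b by (simp add: T.coef_def coef_def measure_tilt_singleton mult.assoc)

lemma psi_tilt:
  assumes "\<gamma> \<ge> 0" shows "psi (tilt b \<nu>) \<gamma> = psi \<nu> (\<gamma> + b) - psi \<nu> b"
proof -
  have "(\<lambda>j. coef j * exp ((\<gamma> + b) * h * (1 - real j))) sums (psi (tilt b \<nu>) \<gamma> + T.mass)"
    using T.psi_sums[OF assms] by (simp add: coef_tilt exp_add[symmetric] algebra_simps)
  moreover have "(\<lambda>j. coef j * exp ((\<gamma> + b) * h * (1 - real j))) sums (psi \<nu> (\<gamma> + b) + mass)"
    using psi_sums assms b by simp
  ultimately show ?thesis using sums_unique2 mass_tilt by fastforce
qed

lemma marginal_tilt:
  assumes "t \<ge> 0"
  shows "T.marginal t = density (marginal t) (\<lambda>x. ennreal (exp (b * x - t * psi \<nu> b)))"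
proof -
  \<comment> \<open>The factor by which tilting changes the total jump rate is also the normalising
    constant of the tilted jump law.\<close>
  define m where "m = T.mass / mass"
  have m: "m > 0" unfolding m_def using T.mass_pos mass_pos by simp
  have "pmf T.jump_pmf k = pmf jump_pmf k * (exp (b * h * of_int k) / m)" for k
    using b mass_pos T.mass_pos by (simp add: measure_tilt_singleton m_def mult.assoc)
  note pmf = pmf_cpoisson_tilt[OF this m, of "mass * t"]
  have m1: "mass * t * m = T.mass * t" using mass_pos by (simp add: m_def)
  have m2: "mass * t * (m - 1) = t * psi \<nu> b" using mass_pos by (simp add: m_def mass_tilt field_simps)
  have "pmf (cpoisson_pmf (T.mass * t) T.jump_pmf) k =
      pmf (cpoisson_pmf (mass * t) jump_pmf) k * exp (b * h * of_int k - t * psi \<nu> b)" for k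
    using pmf[of k] assms mass_pos unfolding m1 m2 by simp
  then   have "measure_pmf (cpoisson_pmf (T.mass * t) T.jump_pmf) =
    density (cpoisson_pmf (mass * t) jump_pmf) (\<lambda>k. ennreal (exp (b * h * of_int k - t * psi \<nu> b)))"
    by (intro measure_pmf_eq_density_of) auto
  then show ?thesis
    unfolding T.marginal_def marginal_def
    by (subst density_distr) (simp_all add: mult.assoc)
qed

end

text \<open>The tilted exponent is \<open>psi \<nu> (\<gamma> + Phi \<nu> q) - q\<close>, which is
  positive for all \<open>\<gamma> > 0\<close>; so 0 is its largest root.\<close>

lemma Phi_tilt_Phi:
  assumes q: "q \<ge> 0"
  shows "Phi (tilt (Phi \<nu> q) \<nu>) 0 = 0"
proof -
  let ?b = "Phi \<nu> q"
  have b: "?b \<ge> 0" by (rule Phi_nonneg[OF q])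
  interpret T: skipfree_measure h "tilt ?b \<nu>" by (rule skipfree_measure_tilt[OF b])
  have pos: "psi (tilt ?b \<nu>) \<gamma> > 0" if "\<gamma> > 0" for \<gamma>
    using psi_gt[OF q, of "\<gamma> + ?b"] that b psi_Phi[OF q] by (simp add: psi_tilt)
  have "Phi0 (tilt ?b \<nu>) = 0"
    using T.Phi0_root pos[of "Phi0 (tilt ?b \<nu>)"] by fastforce
  moreover have "Phi (tilt ?b \<nu>) 0 \<le> 0"
    using pos[of "Phi (tilt ?b \<nu>) 0"] T.psi_Phi[of 0] by force
  ultimately show ?thesis using T.Phi_nonneg[of 0] by simp
qed

section \<open>The scale sequence\<close>

text \<open>This is \<open>L w = 0\<close>, with \<open>w\<close> extended by 0 to negative indices,
  solved for the value that the upward jump reaches. The start is forced by the required transform,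
  whose behaviour as \<open>\<beta>\<close> tends to infinity determines
  \<open>W(0)\<close>.\<close>

fun scale_seq :: "nat \<Rightarrow> real" where
  "scale_seq 0 = 1 / (h * coef 0)"
| "scale_seq (Suc n) = (mass * scale_seq n - (\<Sum>k\<le>n. coef (Suc k) * scale_seq (n - k))) / coef 0"

declare scale_seq.simps [simp del]

section \<open>Monotonicity, linear growth and generating function of the scale sequence\<close>

lemma coef_sums: "coef sums mass"
  using psi_sums[of 0] by simp

lemma coef_Suc_sums: "(\<lambda>k. coef (Suc k)) sums (mass - coef 0)"
  using coef_sums by (subst sums_Suc_iff) simp

lemma scale_seq_diff:
  "coef 0 * (scale_seq (Suc n) - scale_seq n) =
     (mass - coef 0) * scale_seq n - (\<Sum>k\<le>n. coef (Suc k) * scale_seq (n - k))"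
  using coef_0_pos by (simp add: scale_seq.simps(2) field_simps)

text \<open>Positivity and monotonicity need each other in the induction. The rates
  \<open>coef (Suc k)\<close> sum to \<open>mass - coef 0\<close> and multiply values not exceeding
  \<open>scale_seq n\<close>, so the right-hand side of \<open>scale_seq_diff\<close> is
  nonnegative.\<close>

lemma scale_seq_mono_aux: "0 < scale_seq n \<and> (\<forall>k\<le>n. scale_seq (n - k) \<le> scale_seq n)"
proof (induction n)
  case 0
  then show ?case using h_pos coef_0_pos by (simp add: scale_seq.simps(1))
next
  case (Suc n)
  have "(\<Sum>k\<le>n. coef (Suc k) * scale_seq (n - k)) \<le> (\<Sum>k\<le>n. coef (Suc k)) * scale_seq n"
    unfolding sum_distrib_right by (intro sum_mono mult_left_mono) (use Suc in auto)
  also have "\<dots> \<le> (mass - coef 0) * scale_seq n"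
    using sum_le_suminf[OF sums_summable[OF coef_Suc_sums], of "{..n}"] sums_unique[OF coef_Suc_sums] Suc
    by (intro mult_right_mono) auto
  finally have "coef 0 * (scale_seq (Suc n) - scale_seq n) \<ge> 0"
    by (simp add: scale_seq_diff)
  then have le: "scale_seq n \<le> scale_seq (Suc n)"
    using coef_0_pos by (simp add: zero_le_mult_iff)
  have "scale_seq (Suc n - k) \<le> scale_seq (Suc n)" if "k \<le> Suc n" for k
  proof (cases k)
    case (Suc j)
    then have "scale_seq (n - j) \<le> scale_seq n" using Suc.IH that by simp
    with le Suc show ?thesis by simp
  qed simp
  with le Suc show ?case by force
qed

lemma scale_seq_pos: "0 < scale_seq n"
  and scale_seq_mono: "k \<le> n \<Longrightarrow> scale_seq (n - k) \<le> scale_seq n"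
  using scale_seq_mono_aux by auto

lemma psi_sums_powr:
  assumes "s > 1"
  shows "(\<lambda>j. coef j * (s powr (1 - real j) - 1)) sums psi \<nu> (ln s / h)"
proof -
  have "(\<lambda>j. coef j * exp (ln s / h * h * (1 - real j)) - coef j) sums (psi \<nu> (ln s / h) + mass - mass)"
    by (intro sums_diff psi_sums coef_sums) (use assms h_pos in auto)
  then show ?thesis using assms h_pos by (simp add: powr_def algebra_simps)
qed

text \<open>The drift condition \<open>\<psi>'(0) \<ge> 0\<close>, obtained from \<open>\<psi> \<ge> 0\<close> without differentiating the series.\<close>

lemma mean_down_le:
  assumes psi: "\<And>\<gamma>. \<gamma> > 0 \<Longrightarrow> psi \<nu> \<gamma> \<ge> 0"
  shows "(\<Sum>k\<le>n. real k * coef (Suc k)) \<le> coef 0"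
proof -
  have bound: "(\<Sum>k\<le>n. real k * coef (Suc k)) \<le> coef 0 * s ^ n" if s: "s > 1" for s :: real
  proof -
    have "0 \<le> psi \<nu> (ln s / h)" using psi s h_pos by simp
    have sm: "(\<lambda>k. coef (Suc k) * (s powr (1 - real (Suc k)) - 1)) sums (psi \<nu> (ln s / h) - coef 0 * (s - 1))"
      using psi_sums_powr[OF s] s by (subst sums_Suc_iff) simp
    have sm': "(\<lambda>k. coef (Suc k) * (1 - s powr - real k)) sums (coef 0 * (s - 1) - psi \<nu> (ln s / h))"
      using sums_minus[OF sm] by (simp add: algebra_simps)
    \<comment> \<open>Bernoulli's inequality bounds \<open>k * (s - 1)\<close> by
      \<open>s ^ k - 1\<close>, that is by \<open>s ^ k\<close> times \<open>1 - s powr - k\<close>;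
      the common factor \<open>s ^ n\<close> makes all terms comparable with the series of
      \<open>psi\<close>.\<close>
    have term_le: "real k * coef (Suc k) * (s - 1) \<le> s ^ n * (coef (Suc k) * (1 - s powr - real k))" if "k \<le> n" for k
    proof -
      have "real k * (s - 1) \<le> s ^ k - 1"
        using Bernoulli_inequality[of "s - 1" k] s by simp
      also have "\<dots> = s ^ k * (1 - s powr - real k)"
        using s by (simp add: powr_minus powr_realpow field_simps)
      also have "\<dots> \<le> s ^ n * (1 - s powr - real k)"
        using s that by (intro mult_right_mono power_increasing) (auto simp: powr_minus powr_realpow field_simps)
      finally have "coef (Suc k) * (real k * (s - 1)) \<le> coef (Suc k) * (s ^ n * (1 - s powr - real k))"
        by (intro mult_left_mono) auto
      then show ?thesis by (simp add: mult_ac)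
    qed
    have "(\<Sum>k\<le>n. real k * coef (Suc k)) * (s - 1) \<le> s ^ n * (\<Sum>k\<le>n. coef (Suc k) * (1 - s powr - real k))"
      unfolding sum_distrib_left sum_distrib_right by (intro sum_mono term_le) auto
    also have "\<dots> \<le> s ^ n * (coef 0 * (s - 1) - psi \<nu> (ln s / h))"
    proof (intro mult_left_mono)
      have nn: "0 \<le> coef (Suc k) * (1 - s powr - real k)" for k
        using s by (intro mult_nonneg_nonneg) (auto simp: powr_minus powr_realpow field_simps)
      show "(\<Sum>k\<le>n. coef (Suc k) * (1 - s powr - real k)) \<le> coef 0 * (s - 1) - psi \<nu> (ln s / h)"
        using sum_le_suminf[OF sums_summable[OF sm'], of "{..n}"] sums_unique[OF sm'] nn by simp
    qed (use s in auto)
    also have "\<dots> \<le> s ^ n * (coef 0 * (s - 1))"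
      using s \<open>0 \<le> psi \<nu> (ln s / h)\<close> by (intro mult_left_mono) auto
    finally have "(\<Sum>k\<le>n. real k * coef (Suc k)) * (s - 1) \<le> (coef 0 * s ^ n) * (s - 1)"
      by (simp add: mult_ac)
    then show ?thesis using s by simp
  qed
  \<comment> \<open>The truncation at \<open>n\<close> is fixed, so \<open>s\<close> may decrease to
    1, where the factor \<open>s ^ n\<close> disappears.\<close>
  have "((\<lambda>s. coef 0 * s ^ n) \<longlongrightarrow> coef 0 * 1 ^ n) (at_right (1::real))"
    by (intro tendsto_intros)
  moreover have "eventually (\<lambda>s. (\<Sum>k\<le>n. real k * coef (Suc k)) \<le> coef 0 * s ^ n) (at_right (1::real))"
    using bound by (auto simp: eventually_at_right_field intro!: exI[of _ 2])
  ultimately show ?thesis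
    using tendsto_lowerbound[where F="at_right (1::real)"] by fastforce
qed

text \<open>If all earlier increments are at most \<open>scale_seq 0\<close>, going back
  \<open>k\<close> steps loses at most \<open>k * scale_seq 0\<close>. Weighted with the downward
  rates, whose mean is at most \<open>coef 0\<close>, this bounds the next increment.\<close>

lemma scale_seq_increment_le:
  assumes psi: "\<And>\<gamma>. \<gamma> > 0 \<Longrightarrow> psi \<nu> \<gamma> \<ge> 0"
  shows "scale_seq (Suc n) - scale_seq n \<le> scale_seq 0"
proof (induction n rule: less_induct)
  case (less n)
  have inc: "scale_seq n - scale_seq (n - k) \<le> real k * scale_seq 0" if "k \<le> n" for k
    using that
  proof (induction k)
    case (Suc k)
    have "scale_seq (Suc (n - Suc k)) - scale_seq (n - Suc k) \<le> scale_seq 0"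
      using Suc.prems by (intro less) simp
    moreover have "Suc (n - Suc k) = n - k" using Suc.prems by simp
    ultimately show ?case using Suc by (simp add: algebra_simps)
  qed simp
  \<comment> \<open>\<open>v\<close> continues the sequence by 0 to negative indices. There
    \<open>k > n\<close>, and \<open>scale_seq n\<close> itself is at most
    \<open>(n + 1) * scale_seq 0\<close>.\<close>
  define v where "v k = (if k \<le> n then scale_seq (n - k) else 0)" for k
  have v: "scale_seq n - v k \<le> real k * scale_seq 0" for k
  proof (cases "k \<le> n")
    case False
    have "scale_seq n \<le> real (Suc n) * scale_seq 0"
      using inc[of n] by (simp add: algebra_simps)
    also have "\<dots> \<le> real k * scale_seq 0"
      using False scale_seq_pos[of 0] by (intro mult_right_mono) auto
    finally show ?thesis using False by (simp add: v_def)
  qed (use inc v_def in auto)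
  have sv: "(\<lambda>k. coef (Suc k) * v k) sums (\<Sum>k\<le>n. coef (Suc k) * scale_seq (n - k))"
    using sums_finite[of "{..n}" "\<lambda>k. coef (Suc k) * v k"] by (simp add: v_def)
  have "(\<lambda>k. coef (Suc k) * scale_seq n - coef (Suc k) * v k) sums (coef 0 * (scale_seq (Suc n) - scale_seq n))"
    unfolding scale_seq_diff by (intro sums_diff sums_mult2 coef_Suc_sums sv)
  then have diff: "(\<lambda>k. coef (Suc k) * (scale_seq n - v k)) sums (coef 0 * (scale_seq (Suc n) - scale_seq n))"
    by (simp add: algebra_simps)
  have partial: "(\<Sum>k\<le>N. coef (Suc k) * (scale_seq n - v k)) \<le> coef 0 * scale_seq 0" for N
  proof -
    have "(\<Sum>k\<le>N. coef (Suc k) * (scale_seq n - v k)) \<le> (\<Sum>k\<le>N. coef (Suc k) * (real k * scale_seq 0))"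
      by (intro sum_mono mult_left_mono v) auto
    also have "\<dots> = (\<Sum>k\<le>N. real k * coef (Suc k)) * scale_seq 0"
      unfolding sum_distrib_right by (simp add: mult_ac)
    also have "\<dots> \<le> coef 0 * scale_seq 0"
      using mean_down_le[OF psi] scale_seq_pos[of 0] by (intro mult_right_mono) auto
    finally show ?thesis .
  qed
  have "coef 0 * (scale_seq (Suc n) - scale_seq n) \<le> coef 0 * scale_seq 0"
    using diff[unfolded sums_def_le] partial by (intro LIMSEQ_le_const2) auto
  then show ?case using coef_0_pos by simp
qed

lemma scale_seq_le:
  assumes psi: "\<And>\<gamma>. \<gamma> > 0 \<Longrightarrow> psi \<nu> \<gamma> \<ge> 0"
  shows "scale_seq n \<le> real (Suc n) * scale_seq 0"
proof (induction n)
  case (Suc n)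
  then show ?case using scale_seq_increment_le[OF psi, of n] by (simp add: algebra_simps)
qed simp

text \<open>Multiplied by \<open>z ^ n\<close> and summed, the recursion contains a Cauchy product
  and becomes a linear equation for the generating function. Convergence comes from the linear
  growth of the sequence.\<close>

lemma scale_seq_gf:
  assumes psi: "\<And>\<gamma>. \<gamma> > 0 \<Longrightarrow> psi \<nu> \<gamma> > 0" and \<gamma>: "\<gamma> > 0"
  shows "(\<lambda>n. scale_seq n * exp (- \<gamma> * h) ^ n) sums (exp (\<gamma> * h) / (h * psi \<nu> \<gamma>))"
proof -
  define z where "z = exp (- \<gamma> * h)"
  have z: "0 < z" "z < 1" using \<gamma> h_pos by (auto simp: z_def)
  have summ: "summable (\<lambda>n. scale_seq n * z ^ n)"
  proof (rule summable_comparison_test')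
    show "summable (\<lambda>n. scale_seq 0 * (of_nat (Suc n) * z ^ n))"
      using z geometric_deriv_sums[of z] by (intro summable_mult) (auto simp: sums_iff)
    show "norm (scale_seq n * z ^ n) \<le> scale_seq 0 * (of_nat (Suc n) * z ^ n)" for n
    proof -
      have "scale_seq n * z ^ n \<le> (real (Suc n) * scale_seq 0) * z ^ n"
        using z psi by (intro mult_right_mono scale_seq_le) (auto intro: less_imp_le)
      then show ?thesis using scale_seq_pos[of n] z by (simp add: abs_mult mult_ac)
    qed
  qed
  define A where "A = (\<Sum>n. scale_seq n * z ^ n)"
  have A: "(\<lambda>n. scale_seq n * z ^ n) sums A" using summ by (simp add: A_def summable_sums)
  have "(\<lambda>n. coef (Suc n) * exp (\<gamma> * h * (1 - real (Suc n)))) sums (psi \<nu> \<gamma> + mass - coef 0 * exp (\<gamma> * h))"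
    using psi_sums[of \<gamma>] \<gamma> by (subst sums_Suc_iff) simp
  moreover have "exp (\<gamma> * h * (1 - real (Suc n))) = z ^ n" for n
    by (simp add: z_def exp_of_nat_mult[symmetric] algebra_simps)
  ultimately have "(\<lambda>n. coef (Suc n) * z ^ n) sums (psi \<nu> \<gamma> + mass - coef 0 * exp (\<gamma> * h))"
    by simp
  \<comment> \<open>The upward jump contributes \<open>coef 0 / z\<close> to the series of
    \<open>psi\<close>; splitting it off leaves a power series in \<open>z\<close>.\<close>
  then have P: "(\<lambda>n. coef (Suc n) * z ^ n) sums (psi \<nu> \<gamma> + mass - coef 0 / z)"
    by (simp add: z_def exp_minus field_simps)
  have "(\<lambda>n. \<Sum>k\<le>n. (coef (Suc k) * z ^ k) * (scale_seq (n - k) * z ^ (n - k))) sums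
      ((\<Sum>n. coef (Suc n) * z ^ n) * (\<Sum>n. scale_seq n * z ^ n))"
    using P summ z scale_seq_pos
    by (intro Cauchy_product_sums) (auto simp: abs_mult sums_iff less_imp_le)
  also have "(\<lambda>n. \<Sum>k\<le>n. (coef (Suc k) * z ^ k) * (scale_seq (n - k) * z ^ (n - k))) =
     (\<lambda>n. (mass * scale_seq n - coef 0 * scale_seq (Suc n)) * z ^ n)"
  proof
    fix n
    have "(\<Sum>k\<le>n. (coef (Suc k) * z ^ k) * (scale_seq (n - k) * z ^ (n - k))) =
        (\<Sum>k\<le>n. coef (Suc k) * scale_seq (n - k)) * z ^ n"
      unfolding sum_distrib_right
      by (intro sum.cong) (auto simp: power_add[symmetric])
    then show "(\<Sum>k\<le>n. (coef (Suc k) * z ^ k) * (scale_seq (n - k) * z ^ (n - k))) =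
       (mass * scale_seq n - coef 0 * scale_seq (Suc n)) * z ^ n"
      using coef_0_pos by (simp add: scale_seq.simps(2))
  qed
  also have "(\<Sum>n. coef (Suc n) * z ^ n) * (\<Sum>n. scale_seq n * z ^ n) = (psi \<nu> \<gamma> + mass - coef 0 / z) * A"
    using P by (simp add: A_def sums_iff)
  finally have 1: "(\<lambda>n. (mass * scale_seq n - coef 0 * scale_seq (Suc n)) * z ^ n) sums ((psi \<nu> \<gamma> + mass - coef 0 / z) * A)" .
  have "(\<lambda>n. scale_seq (Suc n) * z ^ Suc n) sums (A - scale_seq 0)"
    using A by (subst sums_Suc_iff) simp
  from sums_mult[OF this, of "coef 0 / z"]
  have "(\<lambda>n. coef 0 * scale_seq (Suc n) * z ^ n) sums (coef 0 / z * (A - scale_seq 0))"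
    using z by (simp add: mult_ac)
  from sums_diff[OF sums_mult[OF A, of mass] this]
  have 2: "(\<lambda>n. (mass * scale_seq n - coef 0 * scale_seq (Suc n)) * z ^ n) sums
      (mass * A - coef 0 / z * (A - scale_seq 0))"
    by (simp add: algebra_simps)
  from sums_unique2[OF 1 2] have "psi \<nu> \<gamma> * A = coef 0 / z * scale_seq 0"
    by (simp add: algebra_simps diff_divide_distrib)
  also have "\<dots> = exp (\<gamma> * h) / h"
    using coef_0_pos by (simp add: z_def exp_minus field_simps scale_seq.simps(1))
  finally have "A = exp (\<gamma> * h) / (h * psi \<nu> \<gamma>)"
    using psi[OF \<gamma>] h_pos by (simp add: field_simps)
  with A show ?thesis by (simp add: z_def)
qed

end

section \<open>Laplace transforms of step functions and uniqueness\<close>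

lemma nn_integral_exp_interval:
  fixes \<beta> a b :: real
  assumes "\<beta> > 0" "a \<le> b"
  shows "(\<integral>\<^sup>+x. ennreal (indicator {a..<b} x * exp (- \<beta> * x)) \<partial>lborel) =
    ennreal ((exp (- \<beta> * a) - exp (- \<beta> * b)) / \<beta>)"
proof -
  have "(\<integral>\<^sup>+x. ennreal (indicator {a..<b} x * exp (- \<beta> * x)) \<partial>lborel) =
      (\<integral>\<^sup>+x. ennreal (exp (- \<beta> * x)) * indicator {a..b} x \<partial>lborel)"
  proof (rule nn_integral_cong_AE)
    have "AE x in lborel. x \<noteq> b" by (rule AE_lborel_singleton)
    then show "AE x in lborel. ennreal (indicator {a..<b} x * exp (- \<beta> * x)) = ennreal (exp (- \<beta> * x)) * indicator {a..b} x"
      by eventually_elim (auto simp: indicator_def)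
  qed
  also have "\<dots> = ennreal (- exp (- \<beta> * b) / \<beta> - - exp (- \<beta> * a) / \<beta>)"
    by (rule nn_integral_FTC_Icc[where F="\<lambda>x. - exp (- \<beta> * x) / \<beta>"])
       (use assms in \<open>auto intro!: derivative_eq_intros\<close>)
  also have "- exp (- \<beta> * b) / \<beta> - - exp (- \<beta> * a) / \<beta> = (exp (- \<beta> * a) - exp (- \<beta> * b)) / \<beta>"
    by (simp add: diff_divide_distrib)
  finally show ?thesis .
qed

text \<open>Over the \<open>n\<close>-th cell \<open>exp (- \<beta> * x)\<close> integrates to
  \<open>(1 - exp (- \<beta> * h)) / \<beta>\<close> times \<open>exp (- \<beta> * h) ^ n\<close>;
  as all terms are nonnegative, integral and series may be interchanged.\<close>

lemma has_laplace_step: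
  fixes u :: "nat \<Rightarrow> real" and h \<beta> S :: real
  assumes h: "h > 0" and \<beta>: "\<beta> > 0" and u: "\<And>n. u n \<ge> 0"
    and sums: "(\<lambda>n. u n * exp (- \<beta> * h) ^ n) sums S"
  shows "has_laplace (\<lambda>x. u (nat \<lfloor>x / h\<rfloor>)) \<beta> ((1 - exp (- \<beta> * h)) / \<beta> * S)"
proof -
  let ?f = "\<lambda>x. indicator {0..} x *\<^sub>R (exp (- \<beta> * x) * u (nat \<lfloor>x / h\<rfloor>))"
  let ?I = "\<lambda>n::nat. {h * real n..<h * real (Suc n)}"
  have floor: "nat \<lfloor>x / h\<rfloor> = n \<longleftrightarrow> x \<in> ?I n" if "x \<ge> 0" for x n
  proof -
    have "nat \<lfloor>x / h\<rfloor> = n \<longleftrightarrow> \<lfloor>x / h\<rfloor> = int n" using that h by auto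
    also have "\<dots> \<longleftrightarrow> x \<in> ?I n" using h by (simp add: floor_eq_iff field_simps)
    finally show ?thesis .
  qed
  have meas: "(\<lambda>x. u (nat \<lfloor>x / h\<rfloor>)) \<in> borel_measurable borel"
    by measurable
  have sep: "ennreal (?f x) = (\<Sum>n. ennreal (u n) * ennreal (indicator (?I n) x * exp (- \<beta> * x)))" for x
  proof (cases "x \<ge> 0")
    case True
    have ind: "indicator (?I n) x = (if n = nat \<lfloor>x / h\<rfloor> then 1 else 0 :: real)" for n
      using floor[OF True, of n] by (metis indicator_simps(1) indicator_simps(2))
    have "(\<Sum>n. ennreal (u n) * ennreal (indicator (?I n) x * exp (- \<beta> * x))) =
        (\<Sum>n\<in>{nat \<lfloor>x / h\<rfloor>}. ennreal (u n) * ennreal (indicator (?I n) x * exp (- \<beta> * x)))"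
      unfolding ind by (intro suminf_finite) auto
    also have "\<dots> = ennreal (?f x)"
      unfolding ind using True u by (simp add: ennreal_mult[symmetric] mult.commute)
    finally show ?thesis by simp
  next
    case False
    have "x \<notin> ?I n" for n
    proof -
      have "0 \<le> h * real n" using h by simp
      with False show ?thesis by auto
    qed
    then have "indicator (?I n) x = (0 :: real)" for n by (rule indicator_simps(2))
    with False show ?thesis by simp
  qed
  have "(\<integral>\<^sup>+x. ennreal (?f x) \<partial>lborel) =
      (\<integral>\<^sup>+x. (\<Sum>n. ennreal (u n) * ennreal (indicator (?I n) x * exp (- \<beta> * x))) \<partial>lborel)"
    by (simp only: sep)
  also have "\<dots> = (\<Sum>n. \<integral>\<^sup>+x. ennreal (u n) * ennreal (indicator (?I n) x * exp (- \<beta> * x)) \<partial>lborel)"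
    by (rule nn_integral_suminf) measurable
  also have "\<dots> = (\<Sum>n. ennreal ((1 - exp (- \<beta> * h)) / \<beta> * (u n * exp (- \<beta> * h) ^ n)))"
  proof (rule suminf_cong)
    fix n
    have ex: "exp (- \<beta> * (h * real n)) = exp (- \<beta> * h) ^ n"
         "exp (- \<beta> * (h * real (Suc n))) = exp (- \<beta> * h) * exp (- \<beta> * h) ^ n"
      by (simp_all add: exp_of_nat_mult[symmetric] exp_add[symmetric] algebra_simps)
    have "(\<integral>\<^sup>+x. ennreal (u n) * ennreal (indicator (?I n) x * exp (- \<beta> * x)) \<partial>lborel) =
        ennreal (u n) * ennreal ((exp (- \<beta> * (h * real n)) - exp (- \<beta> * (h * real (Suc n)))) / \<beta>)"
      using nn_integral_exp_interval[OF \<beta>, of "h * real n" "h * real (Suc n)"] h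
      by (subst nn_integral_cmult) (auto simp: algebra_simps)
    also have "\<dots> = ennreal (u n * ((exp (- \<beta> * (h * real n)) - exp (- \<beta> * (h * real (Suc n)))) / \<beta>))"
      by (rule ennreal_mult[symmetric]) (use u \<beta> h in \<open>auto intro!: divide_nonneg_pos\<close>)
    also have "u n * ((exp (- \<beta> * (h * real n)) - exp (- \<beta> * (h * real (Suc n)))) / \<beta>) =
        (1 - exp (- \<beta> * h)) / \<beta> * (u n * exp (- \<beta> * h) ^ n)"
      unfolding ex by (simp add: algebra_simps diff_divide_distrib)
    finally show "(\<integral>\<^sup>+x. ennreal (u n) * ennreal (indicator (?I n) x * exp (- \<beta> * x)) \<partial>lborel) =
      ennreal ((1 - exp (- \<beta> * h)) / \<beta> * (u n * exp (- \<beta> * h) ^ n))" .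
  qed
  also have "\<dots> = ennreal ((1 - exp (- \<beta> * h)) / \<beta> * S)"
    using sums_mult[OF sums, of "(1 - exp (- \<beta> * h)) / \<beta>"] u \<beta> h
    by (intro suminf_ennreal_eq) auto
  finally have nn: "(\<integral>\<^sup>+x. ennreal (?f x) \<partial>lborel) = ennreal ((1 - exp (- \<beta> * h)) / \<beta> * S)" .
  have "S \<ge> 0" using sums_le[OF _ sums_zero sums] u by simp
  then have S: "(1 - exp (- \<beta> * h)) / \<beta> * S \<ge> 0" using \<beta> h by simp
  have "has_bochner_integral lborel ?f ((1 - exp (- \<beta> * h)) / \<beta> * S)"
    by (rule has_bochner_integral_nn_integral[OF _ _ S nn]) (use meas u in auto)
  then show ?thesis
    unfolding has_laplace_def set_integrable_def set_lebesgue_integral_def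
    by (simp add: has_bochner_integral_iff)
qed

text \<open>After the substitution \<open>u = e\<^bsup>-x\<^esup>\<close> the transform at the integers is a moment sequence,
  so that \<open>f - g\<close> integrates to zero against every continuous function of \<open>u\<close>, in particular
  against a bump located where \<open>f\<close> and \<open>g\<close> differ.\<close>

lemma laplace_moments_zero:
  fixes d :: "real \<Rightarrow> real"
  assumes int: "set_integrable lborel {0..} d"
    and mom: "\<And>n::nat. (LINT x:{0..}|lborel. d x * exp (- x) ^ n) = 0"
    and cont: "continuous_on {0..1} \<phi>"
  shows "(LINT x:{0..}|lborel. d x * \<phi> (exp (- x))) = 0"
    and "set_integrable lborel {0..} (\<lambda>x. d x * \<phi> (exp (- x)))"
proof -
  have intd: "integrable lborel (\<lambda>x. indicator {0..} x * d x)"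
    using int by (simp add: set_integrable_def)
  have meas_phi: "(\<lambda>x. indicator {0..} x *\<^sub>R \<phi> (exp (- x))) \<in> borel_measurable borel"
    if "continuous_on {0..1} \<phi>" for \<phi> :: "real \<Rightarrow> real"
  proof (rule borel_measurable_continuous_on_indicator)
    show "continuous_on {0..} (\<lambda>x. \<phi> (exp (- x)))"
      by (rule continuous_on_compose2[OF that]) (auto intro!: continuous_intros)
  qed simp
  have intphi: "set_integrable lborel {0..} (\<lambda>x. d x * \<phi> (exp (- x)))"
    if c: "continuous_on {0..1} \<phi>" for \<phi> :: "real \<Rightarrow> real"
  proof -
    obtain B where B: "\<And>u. u \<in> {0..1} \<Longrightarrow> norm (\<phi> u) \<le> B"
      using compact_imp_bounded[OF compact_continuous_image[OF c compact_Icc]] unfolding bounded_iff by blast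
    have "integrable lborel (\<lambda>x. (indicator {0..} x * \<phi> (exp (- x))) * (indicator {0..} x * d x))"
    proof (rule Bochner_Integration.integrable_bound)
      show "integrable lborel (\<lambda>x. B * (indicator {0..} x * d x))" using intd by simp
      show "(\<lambda>x. indicator {0..} x * \<phi> (exp (- x)) * (indicator {0..} x * d x)) \<in> borel_measurable lborel"
        using meas_phi[OF c] borel_measurable_integrable[OF intd] by (intro borel_measurable_times[where f="\<lambda>x. indicator {0..} x * \<phi> (exp (- x))"]) simp_all
      show "AE x in lborel. norm (indicator {0..} x * \<phi> (exp (- x)) * (indicator {0..} x * d x))
              \<le> norm (B * (indicator {0..} x * d x))"
      proof (intro AE_I2)
        fix x :: real
        show "norm (indicator {0..} x * \<phi> (exp (- x)) * (indicator {0..} x * d x))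
              \<le> norm (B * (indicator {0..} x * d x))"
        proof (cases "x \<ge> 0")
          case True
          then have "\<bar>\<phi> (exp (- x))\<bar> \<le> B" using B[of "exp (- x)"] by simp
          then have "\<bar>\<phi> (exp (- x))\<bar> * \<bar>d x\<bar> \<le> \<bar>B\<bar> * \<bar>d x\<bar>"
            by (intro mult_right_mono) auto
          then show ?thesis using True by (simp add: abs_mult)
        qed simp
      qed
    qed
    moreover have "(\<lambda>x. (indicator {0..} x * \<phi> (exp (- x))) * (indicator {0..} x * d x)) =
        (\<lambda>x. indicator {0..} x *\<^sub>R (d x * \<phi> (exp (- x))))"
      by (auto simp: fun_eq_iff indicator_def)
    ultimately show ?thesis by (simp add: set_integrable_def)
  qed
  show "set_integrable lborel {0..} (\<lambda>x. d x * \<phi> (exp (- x)))" by (rule intphi[OF cont])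
  define D where "D = (LINT x|lborel. \<bar>indicator {0..} x * d x\<bar>)"
  have D: "D \<ge> 0" unfolding D_def by simp
  have small: "\<bar>LINT x:{0..}|lborel. d x * \<phi> (exp (- x))\<bar> \<le> e * D" if e: "e > 0" for e
  proof -
    \<comment> \<open>Polynomials in \<open>exp (- x)\<close> integrate to 0 against
      \<open>d\<close>, and a uniform approximation within \<open>e\<close> changes the integral by
      at most \<open>e\<close> times the integral \<open>D\<close> of the absolute value of
      \<open>d\<close>.\<close>
    obtain p where p: "real_polynomial_function p" "\<And>u. u \<in> {0..1} \<Longrightarrow> \<bar>\<phi> u - p u\<bar> < e"
      using Stone_Weierstrass_real_polynomial_function[of "{0..1}" \<phi> e] cont e by auto
    then obtain a n where p_sum: "p = (\<lambda>u. \<Sum>i\<le>n. a i * u ^ i)"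
      using real_polynomial_function_iff_sum by auto
    have contp: "continuous_on {0..1} p" unfolding p_sum by (intro continuous_intros)
    have ipow: "set_integrable lborel {0..} (\<lambda>x. d x * exp (- x) ^ i)" for i
      by (rule intphi) (intro continuous_intros)
    have "(LINT x:{0..}|lborel. d x * p (exp (- x))) = (LINT x:{0..}|lborel. (\<Sum>i\<le>n. a i * (d x * exp (- x) ^ i)))"
      unfolding p_sum by (simp add: sum_distrib_left mult_ac)
    also have "\<dots> = (\<Sum>i\<le>n. a i * (LINT x:{0..}|lborel. d x * exp (- x) ^ i))"
    proof -
      have "(LINT x|lborel. (\<Sum>i\<le>n. a i * (indicator {0..} x *\<^sub>R (d x * exp (- x) ^ i)))) =
          (\<Sum>i\<le>n. a i * (LINT x|lborel. indicator {0..} x *\<^sub>R (d x * exp (- x) ^ i)))"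
        using ipow by (subst Bochner_Integration.integral_sum) (auto simp: set_integrable_def)
      then show ?thesis
        by (simp add: set_lebesgue_integral_def sum_distrib_left mult_ac)
    qed
    also have "\<dots> = 0" using mom by simp
    finally have p0: "(LINT x:{0..}|lborel. d x * p (exp (- x))) = 0" .
    have "(LINT x:{0..}|lborel. d x * \<phi> (exp (- x))) =
        (LINT x:{0..}|lborel. d x * \<phi> (exp (- x))) - (LINT x:{0..}|lborel. d x * p (exp (- x)))"
      using p0 by simp
    also have "\<dots> = (LINT x:{0..}|lborel. d x * \<phi> (exp (- x)) - d x * p (exp (- x)))"
      by (rule set_integral_diff(2)[OF intphi[OF cont] intphi[OF contp], symmetric])
    finally have eq: "(LINT x:{0..}|lborel. d x * \<phi> (exp (- x))) =
        (LINT x:{0..}|lborel. d x * \<phi> (exp (- x)) - d x * p (exp (- x)))" .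
    have "\<bar>LINT x:{0..}|lborel. d x * \<phi> (exp (- x))\<bar> \<le>
        (LINT x|lborel. \<bar>indicator {0..} x *\<^sub>R (d x * \<phi> (exp (- x)) - d x * p (exp (- x)))\<bar>)"
      unfolding eq unfolding set_lebesgue_integral_def by (rule integral_abs_bound)
    also have "\<dots> \<le> (LINT x|lborel. e * \<bar>indicator {0..} x * d x\<bar>)"
    proof (rule integral_mono)
      show "integrable lborel (\<lambda>x. \<bar>indicator {0..} x *\<^sub>R (d x * \<phi> (exp (- x)) - d x * p (exp (- x)))\<bar>)"
        using set_integral_diff(1)[OF intphi[OF cont] intphi[OF contp]]
        by (intro integrable_abs) (simp add: set_integrable_def)
      show "integrable lborel (\<lambda>x. e * \<bar>indicator {0..} x * d x\<bar>)"
        by (intro integrable_mult_right integrable_abs intd)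
      fix x :: real
      show "\<bar>indicator {0..} x *\<^sub>R (d x * \<phi> (exp (- x)) - d x * p (exp (- x)))\<bar> \<le> e * \<bar>indicator {0..} x * d x\<bar>"
      proof (cases "x \<ge> 0")
        case True
        then have "\<bar>\<phi> (exp (- x)) - p (exp (- x))\<bar> \<le> e" using p(2)[of "exp (- x)"] by simp
        then have "\<bar>d x\<bar> * \<bar>\<phi> (exp (- x)) - p (exp (- x))\<bar> \<le> \<bar>d x\<bar> * e"
          by (intro mult_left_mono) auto
        then show ?thesis using True by (simp add: abs_mult[symmetric] algebra_simps)
      qed simp
    qed
    also have "\<dots> = e * D" unfolding D_def by simp
    finally show ?thesis .
  qed
  have "\<bar>LINT x:{0..}|lborel. d x * \<phi> (exp (- x))\<bar> \<le> 0"
  proof (rule field_le_epsilon)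
    fix e :: real assume e: "e > 0"
    have "\<bar>LINT x:{0..}|lborel. d x * \<phi> (exp (- x))\<bar> \<le> e / (D + 1) * D"
      by (rule small) (use e D in auto)
    also have "\<dots> \<le> e" using e D by (simp add: field_simps)
    finally show "\<bar>LINT x:{0..}|lborel. d x * \<phi> (exp (- x))\<bar> \<le> 0 + e" by simp
  qed
  then show "(LINT x:{0..}|lborel. d x * \<phi> (exp (- x))) = 0" by simp
qed

lemma laplace_moments_nonpos:
  fixes d :: "real \<Rightarrow> real"
  assumes int: "set_integrable lborel {0..} d"
    and mom: "\<And>n::nat. (LINT x:{0..}|lborel. d x * exp (- x) ^ n) = 0"
    and rc: "continuous (at_right x0) d" and x0: "x0 \<ge> 0"
  shows "d x0 \<le> 0"
proof (rule ccontr)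
  assume "\<not> d x0 \<le> 0"
  then have "d x0 > 0" by simp
  then have "eventually (\<lambda>x. d x > 0) (at_right x0)"
    using order_tendstoD(1)[of d "d x0" "at_right x0" 0] rc by (simp add: continuous_within)
  then obtain b where b: "b > x0" "\<And>x. x0 < x \<Longrightarrow> x < b \<Longrightarrow> d x > 0"
    by (auto simp: eventually_at_right_field)
  \<comment> \<open>In the variable \<open>u = exp (- x)\<close> this bump is positive exactly for
    \<open>x0 < x < b\<close>. It lies to the right of \<open>x0\<close> because right continuity
    controls the sign of \<open>d\<close> only there.\<close>
  define \<phi> :: "real \<Rightarrow> real" where "\<phi> u = max 0 ((u - exp (- b)) * (exp (- x0) - u))" for u
  have cont: "continuous_on {0..1} \<phi>" unfolding \<phi>_def by (intro continuous_intros)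
  let ?g = "\<lambda>x. indicator {0..} x *\<^sub>R (d x * \<phi> (exp (- x)))"
  have pos: "\<phi> (exp (- x)) > 0 \<longleftrightarrow> x0 < x \<and> x < b" for x
    using b(1) by (auto simp: \<phi>_def less_max_iff_disj zero_less_mult_iff)
  have "\<phi> u \<ge> 0" for u by (simp add: \<phi>_def)
  then have zero: "\<phi> (exp (- x)) = 0" if "\<not> (x0 < x \<and> x < b)" for x
    using pos[of x] that by (metis order_le_less)
  have g_nonneg: "?g x \<ge> 0" for x
    using zero[of x] b(2)[of x] pos[of x] by (cases "x0 < x \<and> x < b") auto
  have "integral\<^sup>L lborel ?g = 0" "integrable lborel ?g"
    using laplace_moments_zero[OF int mom cont] by (simp_all add: set_lebesgue_integral_def set_integrable_def)
  then have "AE x in lborel. ?g x = 0"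
    using integral_nonneg_eq_0_iff_AE[of lborel ?g] g_nonneg by auto
  moreover have "?g x \<noteq> 0" if "x \<in> {x0<..<b}" for x
    using that b(2)[of x] pos[of x] x0 by auto
  ultimately have "AE x in lborel. x \<notin> {x0<..<b}" by (auto elim: eventually_mono)
  then have "emeasure lborel {x0<..<b} = 0"
    by (subst (asm) AE_iff_measurable[of "{x0<..<b}"]) auto
  then show False using b(1) by simp
qed

lemma laplace_unique:
  assumes f: "right_continuous f" and g: "right_continuous g"
    and lap: "\<And>\<beta>. \<beta> > \<beta>0 \<Longrightarrow> has_laplace f \<beta> (L \<beta>) \<and> has_laplace g \<beta> (L \<beta>)"
    and x: "x \<ge> 0"
  shows "f x = g x"
proof -
  have le: "f x \<le> g x" if f: "right_continuous f" and g: "right_continuous g"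
    and lap: "\<And>\<beta>. \<beta> > \<beta>0 \<Longrightarrow> has_laplace f \<beta> (L \<beta>) \<and> has_laplace g \<beta> (L \<beta>)" for f g
  proof -
    \<comment> \<open>The weight \<open>exp (- \<beta> * y)\<close> makes the difference integrable,
      and its moments are differences of the two transforms at \<open>\<beta> + n\<close>, hence
      0.\<close>
    define \<beta> where "\<beta> = \<beta>0 + 1"
    define d where "d y = exp (- \<beta> * y) * f y - exp (- \<beta> * y) * g y" for y
    have "set_integrable lborel {0..} d"
      unfolding d_def using lap[of \<beta>] by (intro set_integral_diff) (auto simp: has_laplace_def \<beta>_def)
    moreover have "(LINT y:{0..}|lborel. d y * exp (- y) ^ n) = 0" for n
    proof -
      have "(LINT y:{0..}|lborel. d y * exp (- y) ^ n) =
          (LINT y:{0..}|lborel. exp (- (\<beta> + real n) * y) * f y - exp (- (\<beta> + real n) * y) * g y)"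
        by (intro set_lebesgue_integral_cong)
           (auto simp: d_def exp_of_nat_mult[symmetric] exp_diff exp_add exp_minus field_simps)
      also have "\<dots> = 0"
        using lap[of "\<beta> + real n"] by (subst set_integral_diff) (auto simp: has_laplace_def \<beta>_def)
      finally show ?thesis .
    qed
    moreover have "continuous (at_right x) d"
      unfolding d_def using f g x by (intro continuous_intros) (auto simp: right_continuous_def)
    ultimately have "d x \<le> 0" using x by (rule laplace_moments_nonpos)
    then show "f x \<le> g x" by (simp add: d_def)
  qed
  show ?thesis
    by (rule antisym; rule le) (use f g lap in auto)
qed

section \<open>The two-sided exit problem\<close>

text \<open>The floor extends the lattice strip to all real values, so that the condition is Borel
  also for paths that leave the lattice on a null set.\<close>

definition alive :: "real \<Rightarrow> nat \<Rightarrow> nat \<Rightarrow> real \<Rightarrow> bool" where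
  "alive h m n v \<longleftrightarrow> - int m \<le> \<lfloor>v / h\<rfloor> \<and> \<lfloor>v / h\<rfloor> < int n"

text \<open>The discounted increments before the exit time sum up to the discounted payoff at the exit time;
  \<open>r\<close> is the discount factor of one time step.\<close>

primrec stopped_payoff ::
    "(real \<Rightarrow> bool) \<Rightarrow> (real \<Rightarrow> real) \<Rightarrow> real \<Rightarrow> nat \<Rightarrow> (nat \<Rightarrow> real) \<Rightarrow> real" where
  "stopped_payoff al G r 0 y = G (y 0)"
| "stopped_payoff al G r (Suc J) y = stopped_payoff al G r J y +
     (if \<forall>i\<le>J. al (y i) then r ^ J * (r * G (y (Suc J)) - G (y J)) else 0)"

lemma stopped_payoff_alive:
  "(\<And>i. i < J \<Longrightarrow> al (y i)) \<Longrightarrow> stopped_payoff al G r J y = r ^ J * G (y J)"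
  by (induction J) (auto simp: less_Suc_eq_le algebra_simps)

lemma stopped_payoff_exit:
  assumes "\<And>i. i < j \<Longrightarrow> al (y i)" "\<not> al (y j)" "j \<le> J"
  shows "stopped_payoff al G r J y = r ^ j * G (y j)"
  using assms(3)
proof (induction J rule: dec_induct)
  case base
  then show ?case using assms(1) by (rule stopped_payoff_alive)
next
  case (step J)
  then show ?case using assms(2) by auto
qed

lemma stopped_payoff_bound:
  assumes G: "\<And>v. \<bar>G v\<bar> \<le> B" and r: "0 \<le> r" "r \<le> 1"
  shows "\<bar>stopped_payoff al G r J y\<bar> \<le> B"
proof -
  have B: "r ^ j * \<bar>G v\<bar> \<le> B" for j v
  proof -
    have "r ^ j * \<bar>G v\<bar> \<le> 1 * \<bar>G v\<bar>" using r by (intro mult_right_mono power_le_one) auto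
    then show ?thesis using G[of v] by simp
  qed
  show ?thesis
  proof (cases "\<forall>i<J. al (y i)")
    case True
    then show ?thesis using B[of J] r by (simp add: stopped_payoff_alive abs_mult)
  next
    case False
    define j where "j = (LEAST i. \<not> al (y i))"
    have ex: "\<exists>i. \<not> al (y i)" using False by blast
    have "\<not> al (y j)" unfolding j_def by (rule LeastI_ex[OF ex])
    moreover have "al (y i)" if "i < j" for i using not_less_Least that unfolding j_def by blast
    moreover have "j \<le> J" using False unfolding j_def by (meson Least_le less_imp_le order_trans)
    ultimately show ?thesis using B[of j] r by (simp add: stopped_payoff_exit[of j] abs_mult)
  qed
qed

text \<open>This takes the place of conditioning on the past: by Fubini's theorem for the joint law,
  a bound on the integral over the last increment that is uniform in the earlier ones passes to the
  expectation.\<close>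

lemma (in prob_space) expectation_indep_bound:
  fixes D :: "nat \<Rightarrow> 'a \<Rightarrow> real"
  assumes ind: "indep_vars (\<lambda>_. borel) D {..<Suc J}"
    and F[measurable]: "F \<in> borel_measurable ((\<Pi>\<^sub>M i\<in>{..<J}. borel) \<Otimes>\<^sub>M borel)"
    and B: "\<And>p. \<bar>F p\<bar> \<le> B"
    and \<epsilon>: "\<And>z. \<bar>LINT v|distr M borel (D J). F (z, v)\<bar> \<le> \<epsilon>"
  shows "\<bar>expectation (\<lambda>\<omega>. F (\<lambda>i\<in>{..<J}. D i \<omega>, D J \<omega>))\<bar> \<le> (\<epsilon> :: real)"
proof -
  let ?P = "\<Pi>\<^sub>M i\<in>{..<J}. (borel :: real measure)"
  let ?Z = "\<lambda>\<omega>. \<lambda>i\<in>{..<J}. D i \<omega>"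
  have D[measurable]: "D i \<in> borel_measurable M" if "i < Suc J" for i
    using ind that by (auto simp: indep_vars_def)
  have Z: "?Z \<in> measurable M ?P" by (intro measurable_restrict) (auto intro: D)
  have DJ: "D J \<in> borel_measurable M" by (rule D) simp
  \<comment> \<open>The last increment is presented as a block over the index set
    \<open>{J}\<close>, so that independence of disjoint blocks applies.\<close>
  let ?Q = "\<Pi>\<^sub>M i\<in>{J}. (borel :: real measure)"
  let ?W = "\<lambda>\<omega>. \<lambda>i\<in>{J}. D i \<omega>"
  have W: "?W \<in> measurable M ?Q" by (intro measurable_restrict) (auto intro: D)
  have "indep_var ?P ?Z ?Q ?W"
    by (rule indep_var_restrict[OF ind]) auto
  then have eq: "distr M (?P \<Otimes>\<^sub>M ?Q) (\<lambda>\<omega>. (?Z \<omega>, ?W \<omega>)) = distr M ?P ?Z \<Otimes>\<^sub>M distr M ?Q ?W"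
    using indep_var_distribution_eq[of ?P ?Z ?Q ?W] by simp
  interpret P1: prob_space "distr M ?P ?Z" by (rule prob_space_distr[OF Z])
  interpret P2: prob_space "distr M ?Q ?W" by (rule prob_space_distr[OF W])
  interpret PP: pair_prob_space "distr M ?P ?Z" "distr M ?Q ?W" ..
  define F' where "F' = (\<lambda>p. F (fst p, snd p J))"
  have F'[measurable]: "F' \<in> borel_measurable (?P \<Otimes>\<^sub>M ?Q)" unfolding F'_def by measurable
  then have Fm: "F' \<in> borel_measurable (distr M ?P ?Z \<Otimes>\<^sub>M distr M ?Q ?W)"
    by (simp cong: measurable_cong_sets)
  have int: "integrable (distr M ?P ?Z \<Otimes>\<^sub>M distr M ?Q ?W) F'"
    by (rule PP.P.integrable_const_bound[where B=B]) (use B Fm in \<open>auto simp: F'_def\<close>)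
  have inner: "(LINT f|distr M ?Q ?W. F' (z, f)) = (LINT v|distr M borel (D J). F (z, v))"
    if z: "z \<in> space ?P" for z
  proof -
    have "(\<lambda>v. F (z, v)) \<in> borel_measurable borel"
      using F by (rule measurable_compose_Pair1[OF z])
    moreover have "(\<lambda>f. F' (z, f)) \<in> borel_measurable ?Q"
      using F' by (rule measurable_compose_Pair1[OF z])
    ultimately show ?thesis
      using W DJ by (simp add: integral_distr F'_def)
  qed
  have "expectation (\<lambda>\<omega>. F (?Z \<omega>, D J \<omega>)) = (LINT p|distr M (?P \<Otimes>\<^sub>M ?Q) (\<lambda>\<omega>. (?Z \<omega>, ?W \<omega>)). F' p)"
    using Z W F' by (subst integral_distr) (auto simp: F'_def)
  also have "\<dots> = (LINT z|distr M ?P ?Z. LINT f|distr M ?Q ?W. F' (z, f))"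
    unfolding eq by (rule PP.integral_fst'[symmetric, OF int])
  also have "\<bar>\<dots>\<bar> \<le> (LINT z|distr M ?P ?Z. \<bar>LINT f|distr M ?Q ?W. F' (z, f)\<bar>)"
    by (rule integral_abs_bound)
  also have "\<dots> \<le> (LINT z|distr M ?P ?Z. \<epsilon>)"
    by (intro integral_mono integrable_abs PP.integrable_fst'[OF int]) (auto simp: inner \<epsilon>)
  also have "\<dots> = \<epsilon>" using P1.prob_space by simp
  finally show ?thesis .
qed

section \<open>The payoff function and its one-step error\<close>

context skipfree_measure
begin

text \<open>Dividing by \<open>w (m + n)\<close> makes the value at level \<open>n\<close> equal to
  1, so the boundary values fit the recursion. The value 1 above level \<open>n\<close> covers a
  path that has moved beyond \<open>n\<close> between two grid times.\<close>

definition exit_payoff :: "(nat \<Rightarrow> real) \<Rightarrow> nat \<Rightarrow> nat \<Rightarrow> int \<Rightarrow> real" where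
  "exit_payoff w m n k =
     (if k < - int m then 0 else if k \<ge> int n then 1 else w (nat (k + int m)) / w (m + n))"

lemma exit_payoff_bounded: obtains B where "\<And>k. \<bar>exit_payoff w m n k\<bar> \<le> B"
proof
  fix k
  show "\<bar>exit_payoff w m n k\<bar> \<le> 1 + (\<Sum>i\<le>m + n. \<bar>w i / w (m + n)\<bar>)"
  proof (cases "k < - int m \<or> k \<ge> int n")
    case True
    then show ?thesis by (auto simp: exit_payoff_def intro!: add_increasing2 sum_nonneg)
  next
    case False
    then have "nat (k + int m) \<le> m + n" by auto
    then have "\<bar>w (nat (k + int m)) / w (m + n)\<bar> \<le> (\<Sum>i\<le>m + n. \<bar>w i / w (m + n)\<bar>)"
      by (intro member_le_sum) auto
    then show ?thesis using False by (auto simp: exit_payoff_def)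
  qed
qed

text \<open>This is \<open>L g = q g\<close> on \<open>[-m, n)\<close> for the generator \<open>L\<close> of the chain.\<close>

lemma exit_payoff_harmonic:
  assumes rec: "\<And>i. coef 0 * w (Suc i) = (mass + q) * w i - (\<Sum>k\<le>i. coef (Suc k) * w (i - k))"
    and w: "w (m + n) \<noteq> 0" and k: "- int m \<le> k" "k < int n"
  shows "mass * (LINT j|jump_pmf. exit_payoff w m n (k + j)) = (mass + q) * exit_payoff w m n k"
proof -
  let ?g = "exit_payoff w m n"
  obtain B where B: "\<And>k. \<bar>?g k\<bar> \<le> B" using exit_payoff_bounded by blast
  have "integrable jump_pmf (\<lambda>j. ?g (k + j))"
    by (rule measure_pmf.integrable_const_bound[where B=B]) (use B in auto)
  from sums_integral_jump[OF this]
  have s1: "(\<lambda>j. coef j * ?g (k + (1 - int j))) sums (mass * (LINT j|jump_pmf. ?g (k + j)))" .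
  define i where "i = nat (k + int m)"
  have i: "int i = k + int m" using k by (simp add: i_def)
  \<comment> \<open>At the top of the strip the upward jump meets the constant 1, which is again
    \<open>w (Suc i) / w (m + n)\<close> because \<open>Suc i = m + n\<close> there.\<close>
  have g0: "?g (k + 1) = w (Suc i) / w (m + n)"
  proof (cases "k + 1 = int n")
    case True
    then have "Suc i = m + n" using i by linarith
    then show ?thesis using True w by (simp add: exit_payoff_def)
  next
    case False
    moreover have "nat (k + 1 + int m) = Suc i" using i by linarith
    ultimately show ?thesis using k by (simp add: exit_payoff_def)
  qed
  have g1: "?g (k - int l) = (if l \<le> i then w (i - l) / w (m + n) else 0)" for l
  proof (cases "l \<le> i")
    case True
    then have "nat (k - int l + int m) = i - l" using i by linarith
    then show ?thesis using True i k by (auto simp: exit_payoff_def)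
  next
    case False
    then have "k - int l < - int m" using i by linarith
    then show ?thesis using False by (simp add: exit_payoff_def)
  qed
  have z: "?g (k + (1 - int j)) = 0" if "j \<notin> {..Suc i}" for j
    using g1[of "j - 1"] that by (cases j) auto
  have "(\<lambda>j. coef j * ?g (k + (1 - int j))) sums (\<Sum>j\<le>Suc i. coef j * ?g (k + (1 - int j)))"
    by (rule sums_finite) (use z in auto)
  with s1 have "mass * (LINT j|jump_pmf. ?g (k + j)) = (\<Sum>j\<le>Suc i. coef j * ?g (k + (1 - int j)))"
    by (rule sums_unique2)
  also have "\<dots> = coef 0 * ?g (k + 1) + (\<Sum>l\<le>i. coef (Suc l) * ?g (k - int l))"
    by (subst sum.atMost_Suc_shift) simp
  also have "\<dots> = (coef 0 * w (Suc i) + (\<Sum>l\<le>i. coef (Suc l) * w (i - l))) / w (m + n)"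
    by (simp add: g0 g1 add_divide_distrib sum_divide_distrib)
  also have "\<dots> = (mass + q) * (w i / w (m + n))" by (simp add: rec)
  also have "w i / w (m + n) = ?g k" using g1[of 0] by simp
  finally show ?thesis .
qed

text \<open>By harmonicity zero or one jump contributes \<open>exp (- a) * (1 + c)\<close> times the
  present value. The discount completes this to \<open>exp (- c) * (1 + c)\<close>, which is 1 up to
  \<open>c\<^sup>2\<close>; two or more jumps cost another \<open>B * c\<^sup>2\<close>.\<close>

lemma exit_payoff_one_step:
  assumes rec: "\<And>i. coef 0 * w (Suc i) = (mass + q) * w i - (\<Sum>k\<le>i. coef (Suc k) * w (i - k))"
    and w: "w (m + n) \<noteq> 0" and v: "alive h m n v" and q: "q \<ge> 0" and \<delta>: "\<delta> > 0"
    and B: "\<And>k. \<bar>exit_payoff w m n k\<bar> \<le> B"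
  shows "\<bar>exp (- q * \<delta>) * (LINT d|marginal \<delta>. exit_payoff w m n \<lfloor>(v + d) / h\<rfloor>) - exit_payoff w m n \<lfloor>v / h\<rfloor>\<bar>
    \<le> 2 * B * (mass + q)\<^sup>2 * \<delta>\<^sup>2"
proof -
  let ?g = "exit_payoff w m n"
  define k where "k = \<lfloor>v / h\<rfloor>"
  have k: "- int m \<le> k" "k < int n" using v by (auto simp: alive_def k_def)
  define a where "a = mass * \<delta>"
  define c where "c = (mass + q) * \<delta>"
  have a: "a > 0" "a \<le> c" "c \<ge> 0" using mass_pos \<delta> q by (auto simp: a_def c_def mult_right_mono)
  have B0: "B \<ge> 0" using B[of 0] by linarith
  define E where "E = (LINT d|marginal \<delta>. ?g \<lfloor>(v + d) / h\<rfloor>)"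
  have "E = (LINT j|cpoisson_pmf a jump_pmf. ?g \<lfloor>(v + h * of_int j) / h\<rfloor>)"
    unfolding E_def marginal_def a_def by (subst integral_distr) auto
  also have "\<dots> = (LINT j|cpoisson_pmf a jump_pmf. ?g (k + j))"
    using h_pos by (simp add: k_def add_divide_distrib)
  finally have E: "E = (LINT j|cpoisson_pmf a jump_pmf. ?g (k + j))" .
  have "\<bar>E - exp (- a) * (?g (k + 0) + a * (LINT j|jump_pmf. ?g (k + j)))\<bar> \<le> B * a\<^sup>2"
    unfolding E by (rule cpoisson_pmf_first_order) (use B a in auto)
  also have "a * (LINT j|jump_pmf. ?g (k + j)) = c * ?g k"
    using exit_payoff_harmonic[OF rec w k] by (simp add: a_def c_def mult_ac)
  finally have 1: "\<bar>E - exp (- a) * ((1 + c) * ?g k)\<bar> \<le> B * a\<^sup>2" by (simp add: algebra_simps)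
  have "\<bar>exp (- q * \<delta>) * (E - exp (- a) * ((1 + c) * ?g k))\<bar> \<le> 1 * (B * a\<^sup>2)"
    unfolding abs_mult by (intro mult_mono 1) (use q \<delta> in auto)
  also have "\<dots> \<le> B * c\<^sup>2"
    using a B0 by (auto intro!: mult_left_mono power_mono)
  finally have 2: "\<bar>exp (- q * \<delta>) * (E - exp (- a) * ((1 + c) * ?g k))\<bar> \<le> B * c\<^sup>2" .
  have "\<bar>(exp (- c) * (1 + c) - 1) * ?g k\<bar> \<le> c\<^sup>2 * B"
    unfolding abs_mult by (intro mult_mono exp_quadratic_bound B) (use a in auto)
  moreover have "exp (- q * \<delta>) * E - ?g k =
     exp (- q * \<delta>) * (E - exp (- a) * ((1 + c) * ?g k)) + (exp (- c) * (1 + c) - 1) * ?g k"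
  proof -
    have "exp (- q * \<delta>) * exp (- a) = exp (- c)"
      by (simp add: exp_add[symmetric] a_def c_def algebra_simps)
    then have "exp (- q * \<delta>) * (exp (- a) * ((1 + c) * ?g k)) = exp (- c) * ((1 + c) * ?g k)"
      by (simp add: mult.assoc[symmetric])
    then show ?thesis by (simp add: algebra_simps)
  qed
  ultimately have "\<bar>exp (- q * \<delta>) * E - ?g k\<bar> \<le> B * c\<^sup>2 + c\<^sup>2 * B"
    using 2 by linarith
  also have "\<dots> = 2 * B * (mass + q)\<^sup>2 * \<delta>\<^sup>2" by (simp add: c_def power_mult_distrib)
  finally show ?thesis by (simp add: E_def k_def)
qed

end

section \<open>The process and its martingale along a time grid\<close>

locale skipfree_process = skipfree_measure h \<nu>
  for h :: real and \<nu> :: "real measure" +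
  fixes M :: "'a measure" and X :: "real \<Rightarrow> 'a \<Rightarrow> real"
  assumes chain: "skipfree_chain h \<nu> M X"
begin

lemma levy: "levy_process M X"
  using chain by (simp add: skipfree_chain_def compound_poisson_def)

sublocale P: prob_space M using levy by (simp add: levy_process_def)

lemma X_measurable [measurable]: "t \<ge> 0 \<Longrightarrow> X t \<in> borel_measurable M"
  using levy by (simp add: levy_process_def)

lemma X_right_continuous: "\<omega> \<in> space M \<Longrightarrow> t \<ge> 0 \<Longrightarrow> ((\<lambda>s. X s \<omega>) \<longlongrightarrow> X t \<omega>) (at_right t)"
  using levy unfolding levy_process_def cadlag_def continuous_within by blast

lemma X_zero: "AE \<omega> in M. X 0 \<omega> = 0"
  using levy by (simp add: levy_process_def)

lemma X_indep_increments:
  assumes "0 \<le> t 0" "\<And>i. i < n \<Longrightarrow> t i \<le> t (Suc i)"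
  shows "P.indep_vars (\<lambda>_. borel) (\<lambda>i \<omega>. X (t (Suc i)) \<omega> - X (t i) \<omega>) {..<n}"
  using levy assms unfolding levy_process_def by blast

lemma distr_X:
  assumes "t \<ge> 0" shows "distr M borel (X t) = marginal t"
proof (rule eq_marginalI[OF assms])
  show "real_distribution (distr M borel (X t))"
    using assms by (intro P.real_distribution_distr) simp
  show "char (distr M borel (X t)) \<theta> = exp (complex_of_real t * (CLINT x|\<nu>. iexp (\<theta> * x) - 1))" for \<theta>
    using chain assms unfolding skipfree_chain_def compound_poisson_def by blast
qed

lemma distr_increment:
  assumes "s \<ge> 0" "s \<le> t" shows "distr M borel (\<lambda>\<omega>. X t \<omega> - X s \<omega>) = marginal (t - s)"
proof -
  have "distr M borel (\<lambda>\<omega>. X (s + (t - s)) \<omega> - X s \<omega>) = distr M borel (X (t - s))"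
    using levy assms unfolding levy_process_def by (meson diff_ge_0_iff_ge)
  then show ?thesis using assms by (simp add: distr_X)
qed

lemma X_lattice:
  assumes "t \<ge> 0" shows "AE \<omega> in M. X t \<omega> \<in> Zh h"
proof -
  have Z: "Zh h \<in> sets borel"
  proof -
    have "countable (Zh h)" by (simp add: Zh_def)
    then show ?thesis by (rule sets.countable[rotated]) auto
  qed
  have "AE v in marginal t. v \<in> Zh h"
    unfolding marginal_def using Z by (subst AE_distr_iff) (auto simp: Zh_def)
  then have "AE v in distr M borel (X t). v \<in> Zh h" unfolding distr_X[OF assms] .
  then show ?thesis using Z assms by (subst (asm) AE_distr_iff) auto
qed

text \<open>The increments over unit intervals are independent, and each is at least
  \<open>h * (m + n)\<close> with the same positive probability, so almost surely one of them is.
  Such an increment cannot both start and end in a strip of that width.\<close>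

lemma AE_not_alive: "AE \<omega> in M. \<exists>k::nat. \<not> alive h m n (X (real k) \<omega>)"
proof -
  define D where "D k \<omega> = X (real (Suc k)) \<omega> - X (real k) \<omega>" for k :: nat and \<omega>
  define A where "A = {..< h * real (m + n)}"
  define p where "p = measure (marginal 1) A"
  have ind: "P.indep_vars (\<lambda>_. borel) D {..<K}" for K
    unfolding D_def by (rule X_indep_increments[of real]) auto
  have [measurable]: "D k \<in> borel_measurable M" for k unfolding D_def by simp
  have pk: "P.prob (D k -` A \<inter> space M) = p" for k
  proof -
    have "distr M borel (D k) = marginal 1" unfolding D_def by (subst distr_increment) auto
    then have "p = measure (distr M borel (D k)) A" by (simp add: p_def)
    then show ?thesis by (simp add: measure_distr A_def)
  qed
  have p1: "p < 1"
  proof -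
    have "int (m + n) \<in> set_pmf (cpoisson_pmf mass jump_pmf)"
      by (rule set_cpoisson_pmf[OF one_in_jump mass_pos])
    then have "0 < pmf (cpoisson_pmf mass jump_pmf) (int (m + n))"
      by (simp add: pmf_positive)
    moreover have "p + pmf (cpoisson_pmf mass jump_pmf) (int (m + n)) \<le> 1"
    proof -
      let ?Q = "cpoisson_pmf mass jump_pmf"
      have "p = measure ?Q {k. h * of_int k < h * real (m + n)}"
        unfolding p_def marginal_def A_def by (subst measure_distr) (auto simp: vimage_def)
      also have "\<dots> + pmf ?Q (int (m + n)) = measure ?Q ({k. h * of_int k < h * real (m + n)} \<union> {int (m + n)})"
        by (subst measure_pmf.finite_measure_Union) (auto simp: pmf.rep_eq)
      also have "\<dots> \<le> 1" by simp
      finally show ?thesis .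
    qed
    ultimately show ?thesis by simp
  qed
  have p0: "p \<ge> 0" by (simp add: p_def)
  define E where "E = {\<omega>\<in>space M. \<forall>k. D k \<omega> \<in> A}"
  have E[measurable]: "E \<in> sets M" unfolding E_def A_def by measurable
  have "P.prob E \<le> p ^ Suc K" for K
  proof -
    have "P.prob E \<le> P.prob (\<Inter>k\<in>{..<Suc K}. D k -` A \<inter> space M)"
      by (intro P.finite_measure_mono) (auto simp: E_def A_def)
    also have "\<dots> = (\<Prod>k<Suc K. P.prob (D k -` A \<inter> space M))"
      by (rule P.indep_varsD[OF ind]) (auto simp: A_def)
    also have "\<dots> = p ^ Suc K" by (simp only: pk prod_constant card_lessThan)
    finally show ?thesis .
  qed
  moreover have "(\<lambda>K. p ^ Suc K) \<longlonglongrightarrow> 0"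
    using p0 p1 by (intro LIMSEQ_Suc LIMSEQ_realpow_zero)
  ultimately have "P.prob E \<le> 0" by (intro LIMSEQ_le_const) auto
  then have "P.prob E = 0" using measure_nonneg[of M E] by linarith
  then have "AE \<omega> in M. \<omega> \<notin> E"
    by (intro AE_not_in) (auto simp: null_sets_def P.emeasure_eq_measure)
  then show ?thesis
  proof (rule AE_mp, intro AE_I2 impI)
    fix \<omega> assume \<omega>: "\<omega> \<in> space M" "\<omega> \<notin> E"
    then obtain k where k: "D k \<omega> \<ge> h * real (m + n)" by (auto simp: E_def A_def not_less)
    have "\<not> (alive h m n (X (real k) \<omega>) \<and> alive h m n (X (real (Suc k)) \<omega>))"
    proof
      assume "alive h m n (X (real k) \<omega>) \<and> alive h m n (X (real (Suc k)) \<omega>)"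
      then have "- real m \<le> X (real k) \<omega> / h" "X (real (Suc k)) \<omega> / h < real n"
        by (auto simp: alive_def le_floor_iff floor_less_iff)
      then have "- real m * h \<le> X (real k) \<omega>" "X (real (Suc k)) \<omega> < real n * h"
        using h_pos by (simp_all add: field_simps)
      with k show False by (simp add: D_def algebra_simps)
    qed
    then show "\<exists>k::nat. \<not> alive h m n (X (real k) \<omega>)" by blast
  qed
qed

text \<open>By the one-step estimate the discounted payoff along a grid of width \<open>\<delta>\<close> is a martingale up to
  an error \<open>O(\<delta>\<^sup>2)\<close> per step.\<close>

lemma grid_expectation:
  assumes rec: "\<And>i. coef 0 * w (Suc i) = (mass + q) * w i - (\<Sum>k\<le>i. coef (Suc k) * w (i - k))"
    and w: "w (m + n) \<noteq> 0" and q: "q \<ge> 0" and \<delta>: "\<delta> > 0"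
    and B: "\<And>k. \<bar>exit_payoff w m n k\<bar> \<le> B"
  defines "G \<equiv> \<lambda>v. exit_payoff w m n \<lfloor>v / h\<rfloor>"
  shows "(\<lambda>\<omega>. stopped_payoff (alive h m n) G (exp (- q * \<delta>)) J (\<lambda>i. X (real i * \<delta>) \<omega>)) \<in> borel_measurable M"
    and "\<bar>P.expectation (\<lambda>\<omega>. stopped_payoff (alive h m n) G (exp (- q * \<delta>)) J (\<lambda>i. X (real i * \<delta>) \<omega>)) - w m / w (m + n)\<bar>
      \<le> real J * (2 * B * (mass + q)\<^sup>2 * \<delta>\<^sup>2)"
proof -
  let ?r = "exp (- q * \<delta>)"
  let ?S = "\<lambda>J \<omega>. stopped_payoff (alive h m n) G ?r J (\<lambda>i. X (real i * \<delta>) \<omega>)"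
  define \<epsilon> where "\<epsilon> = 2 * B * (mass + q)\<^sup>2 * \<delta>\<^sup>2"
  have G[measurable]: "G \<in> borel_measurable borel" unfolding G_def by measurable
  have al[measurable]: "Measurable.pred borel (alive h m n)" unfolding alive_def[abs_def] by measurable
  have Xi[measurable]: "X (real i * \<delta>) \<in> borel_measurable M" for i using \<delta> by simp
  show meas: "?S J \<in> borel_measurable M" for J
  proof (induction J)
    case 0
    show ?case using Xi[of 0] by (simp del: Xi)
  next
    case (Suc J)
    have "Measurable.pred M (\<lambda>\<omega>. \<forall>i\<in>{..J}. alive h m n (X (real i * \<delta>) \<omega>))" by measurable
    moreover have "(\<lambda>\<omega>. ?r ^ J * (?r * G (X (real (Suc J) * \<delta>) \<omega>) - G (X (real J * \<delta>) \<omega>))) \<in> borel_measurable M"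
      by measurable
    ultimately show ?case using Suc
      by (simp only: stopped_payoff.simps) (intro borel_measurable_add measurable_If, auto simp: Ball_def)
  qed
  have bd: "\<bar>?S J \<omega>\<bar> \<le> B" for J \<omega>
    by (rule stopped_payoff_bound) (use q \<delta> B in \<open>auto simp: G_def\<close>)
  have int: "integrable M (?S J)" for J
    by (rule P.integrable_const_bound[where B=B]) (use bd meas in auto)
  define D where "D i \<omega> = X (real (Suc i) * \<delta>) \<omega> - X (real i * \<delta>) \<omega>" for i \<omega>
  have ind: "P.indep_vars (\<lambda>_. borel) D {..<K}" for K
    unfolding D_def by (rule X_indep_increments[of "\<lambda>i. real i * \<delta>"]) (use \<delta> in auto)
  have lawD: "distr M borel (D J) = marginal \<delta>" for J
    unfolding D_def using \<delta> by (subst distr_increment) (auto simp: algebra_simps)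
  have pos: "AE \<omega> in M. \<forall>i. X (real i * \<delta>) \<omega> = (\<Sum>l<i. D l \<omega>)"
    using X_zero
  proof eventually_elim
    case (elim \<omega>)
    have "X (real i * \<delta>) \<omega> = (\<Sum>l<i. D l \<omega>)" for i
      using elim by (induction i) (auto simp: D_def)
    then show ?case by blast
  qed
  have step: "\<bar>P.expectation (?S (Suc J)) - P.expectation (?S J)\<bar> \<le> \<epsilon>" for J
  proof -
    \<comment> \<open>Positions are written as partial sums of increments, so that being alive up to
      step \<open>J\<close> depends on the first \<open>J\<close> increments only, and the step
      itself on one further independent increment.\<close>
    define Y where "Y i z = (\<Sum>l<i. z l)" for i and z :: "nat \<Rightarrow> real"
    define F where "F p = (if \<forall>i\<in>{..J}. alive h m n (Y i (fst p))
        then ?r ^ J * (?r * G (Y J (fst p) + snd p) - G (Y J (fst p))) else 0)" for p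
    have Y[measurable]: "Y i \<in> borel_measurable (\<Pi>\<^sub>M i\<in>{..<J}. borel)" if "i \<le> J" for i
      unfolding Y_def using that by (intro borel_measurable_sum measurable_component_singleton) auto
    have YJ: "Y J \<in> borel_measurable (\<Pi>\<^sub>M i\<in>{..<J}. borel)" by (rule Y) simp
    have F: "F \<in> borel_measurable ((\<Pi>\<^sub>M i\<in>{..<J}. borel) \<Otimes>\<^sub>M borel)"
    proof -
      note YJ[measurable]
      have "Measurable.pred ((\<Pi>\<^sub>M i\<in>{..<J}. borel) \<Otimes>\<^sub>M (borel :: real measure)) (\<lambda>p. \<forall>i\<in>{..J}. alive h m n (Y i (fst p)))"
        by (intro pred_intros_finite) (auto intro!: measurable_compose[OF measurable_compose[OF measurable_fst Y] al])
      then show ?thesis unfolding F_def[abs_def] by measurable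
    qed
    have B0: "B \<ge> 0" using B[of 0] by linarith
    have r1: "?r ^ J \<le> 1" "?r \<le> 1" using q \<delta> by (auto intro!: power_le_one)
    have Fb: "\<bar>F p\<bar> \<le> 2 * B" for p
    proof -
      have "\<bar>?r * a - b\<bar> \<le> 2 * B" if "\<bar>a\<bar> \<le> B" "\<bar>b\<bar> \<le> B" for a b
      proof -
        have "\<bar>?r * a\<bar> \<le> 1 * B" unfolding abs_mult by (intro mult_mono) (use r1 that in auto)
        with that show ?thesis by linarith
      qed
      then have *: "\<bar>?r * G u - G v\<bar> \<le> 2 * B" for u v using B by (simp add: G_def)
      have "\<bar>?r ^ J * (?r * G u - G v)\<bar> \<le> 1 * (2 * B)" for u v
        unfolding abs_mult by (intro mult_mono *) (use r1 in auto)
      then show ?thesis using B0 by (auto simp: F_def)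
    qed
    have fib: "\<bar>LINT v|distr M borel (D J). F (z, v)\<bar> \<le> \<epsilon>" for z
    proof (cases "\<forall>i\<in>{..J}. alive h m n (Y i z)")
      case True
      interpret L: real_distribution "marginal \<delta>" by (rule real_distribution_marginal)
      have intG: "integrable (marginal \<delta>) (\<lambda>v. G (Y J z + v))"
        by (rule L.integrable_const_bound[where B=B]) (use B in \<open>auto simp: G_def marginal_def\<close>)
      have "(LINT v|marginal \<delta>. F (z, v)) = (LINT v|marginal \<delta>. ?r ^ J * (?r * G (Y J z + v) - G (Y J z)))"
        using True by (simp add: F_def)
      also have "\<dots> = ?r ^ J * (?r * (LINT v|marginal \<delta>. G (Y J z + v)) - G (Y J z))"
        using intG L.prob_space by simp
      finally have "(LINT v|marginal \<delta>. F (z, v)) = ?r ^ J * (?r * (LINT v|marginal \<delta>. G (Y J z + v)) - G (Y J z))" .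
      moreover have "\<bar>?r * (LINT v|marginal \<delta>. G (Y J z + v)) - G (Y J z)\<bar> \<le> \<epsilon>"
        unfolding G_def \<epsilon>_def using True by (intro exit_payoff_one_step rec w q \<delta> B) auto
      ultimately have "\<bar>LINT v|marginal \<delta>. F (z, v)\<bar> \<le> 1 * \<epsilon>"
        using r1 by (simp only: abs_mult) (intro mult_mono, auto)
      then show ?thesis by (simp add: lawD)
    next
      case False
      then have "F (z, v) = 0" for v by (auto simp: F_def)
      then show ?thesis using B0 by (simp add: \<epsilon>_def)
    qed
    have "P.expectation (?S (Suc J)) - P.expectation (?S J) = P.expectation (\<lambda>\<omega>. ?S (Suc J) \<omega> - ?S J \<omega>)"
      by (rule Bochner_Integration.integral_diff[symmetric, OF int int])
    also have "\<dots> = P.expectation (\<lambda>\<omega>. F (\<lambda>i\<in>{..<J}. D i \<omega>, D J \<omega>))"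
    proof (rule integral_cong_AE)
      have Dm: "D i \<in> borel_measurable M" for i
        unfolding D_def by measurable
      show "(\<lambda>\<omega>. ?S (Suc J) \<omega> - ?S J \<omega>) \<in> borel_measurable M" by (intro borel_measurable_diff meas)
      show "(\<lambda>\<omega>. F (\<lambda>i\<in>{..<J}. D i \<omega>, D J \<omega>)) \<in> borel_measurable M"
        by (rule measurable_compose[OF _ F]) (intro measurable_Pair measurable_restrict Dm)
      show "AE \<omega> in M. ?S (Suc J) \<omega> - ?S J \<omega> = F (\<lambda>i\<in>{..<J}. D i \<omega>, D J \<omega>)"
        using pos
      proof eventually_elim
        case (elim \<omega>)
        have Yi: "Y i (\<lambda>i\<in>{..<J}. D i \<omega>) = X (real i * \<delta>) \<omega>" if "i \<le> J" for i
        proof -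
          have "Y i (\<lambda>i\<in>{..<J}. D i \<omega>) = (\<Sum>l<i. D l \<omega>)"
            unfolding Y_def using that by (intro sum.cong) auto
          then show ?thesis using elim by simp
        qed
        have "X (real J * \<delta>) \<omega> + D J \<omega> = X (real (Suc J) * \<delta>) \<omega>" by (simp add: D_def)
        then show ?case by (auto simp: F_def Yi Ball_def simp del: of_nat_Suc)
      qed
    qed
    also have "\<bar>\<dots>\<bar> \<le> \<epsilon>"
      by (rule P.expectation_indep_bound[OF ind F Fb fib])
    finally show ?thesis .
  qed
  have base: "P.expectation (?S 0) = w m / w (m + n)"
  proof -
    have "P.expectation (?S 0) = P.expectation (\<lambda>\<omega>. w m / w (m + n))"
    proof (rule integral_cong_AE)
      show "AE \<omega> in M. ?S 0 \<omega> = w m / w (m + n)"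
        using X_zero
      proof eventually_elim
        case (elim \<omega>)
        then show ?case using w by (cases "n = 0") (auto simp: G_def exit_payoff_def)
      qed
    qed (use meas[of 0] in auto)
    then show ?thesis by (simp add: P.prob_space)
  qed
  have "\<bar>P.expectation (?S J) - w m / w (m + n)\<bar> \<le> real J * \<epsilon>"
  proof (induction J)
    case 0
    then show ?case using base by simp
  next
    case (Suc J)
    then show ?case using step[of J] by (simp add: algebra_simps)
  qed
  then show "\<bar>P.expectation (?S J) - w m / w (m + n)\<bar> \<le> real J * (2 * B * (mass + q)\<^sup>2 * \<delta>\<^sup>2)"
    by (simp add: \<epsilon>_def)
qed

end

section \<open>From the grid to continuous time\<close>

lemma borel_measurable_completion_AE:
  fixes f g :: "'a \<Rightarrow> real"
  assumes f: "f \<in> borel_measurable M" and eq: "AE x in M. f x = g x"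
  shows "g \<in> borel_measurable (completion M)"
proof (rule measurableI)
  fix A :: "real set" assume A: "A \<in> sets borel"
  show "g -` A \<inter> space (completion M) \<in> sets (completion M)"
  proof (rule complete_measure.in_sets_AE)
    show "complete_measure (completion M)" ..
    show "AE x in completion M. (x \<in> f -` A \<inter> space M) = (x \<in> g -` A \<inter> space (completion M))"
      using AE_completion[OF eq] by eventually_elim auto
    show "f -` A \<inter> space M \<in> sets (completion M)"
      using measurable_sets[OF f A] by auto
  qed auto
qed simp

text \<open>With \<open>m\<close> the integer part of \<open>x / h\<close>, no lattice point lies in
  the gap between \<open>-x\<close> and \<open>-m h\<close>; this reduces a real level
  \<open>x\<close> to a lattice level.\<close>

lemma alive_lattice:
  assumes h: "h > 0" and v: "v \<in> Zh h" and m: "int m = \<lfloor>x / h\<rfloor>"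
  shows "alive h m n v \<longleftrightarrow> - x \<le> v \<and> v < h * real n"
    and "\<lfloor>v / h\<rfloor> < - int m \<longleftrightarrow> v < - x"
proof -
  obtain k where k: "v = h * of_int k" using v by (auto simp: Zh_def)
  have "- int m \<le> k \<longleftrightarrow> - k \<le> \<lfloor>x / h\<rfloor>" using m by linarith
  also have "\<dots> \<longleftrightarrow> - x \<le> v" using h k by (auto simp: le_floor_iff field_simps)
  finally have 1: "- int m \<le> k \<longleftrightarrow> - x \<le> v" .
  have 2: "k < int n \<longleftrightarrow> v < h * real n" using h k
    by (metis mult_less_cancel_left_pos of_int_less_iff of_int_of_nat_eq)
  have 3: "\<lfloor>v / h\<rfloor> = k" using h k by simp
  show "alive h m n v \<longleftrightarrow> - x \<le> v \<and> v < h * real n" using 1 2 3 by (simp add: alive_def)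
  show "\<lfloor>v / h\<rfloor> < - int m \<longleftrightarrow> v < - x" using 1 3 by linarith
qed

text \<open>The index \<open>i\<close> is that of the first grid point at or after \<open>s\<close>;
  rounding up by less than one step keeps it within the horizon \<open>N\<close> when
  \<open>s + 1 \<le> N\<close>.\<close>

lemma grid_point:
  fixes s :: real assumes "s \<ge> 0"
  obtains i :: nat where "s \<le> real i / 2 ^ N" "real i / 2 ^ N < s + 1 / 2 ^ N"
    "\<And>j. j < i \<Longrightarrow> real j / 2 ^ N < s" "s + 1 \<le> real N \<Longrightarrow> i \<le> N * 2 ^ N"
proof
  define i where "i = nat \<lceil>s * 2 ^ N\<rceil>"
  have i: "real i = of_int \<lceil>s * 2 ^ N\<rceil>" using assms by (simp add: i_def)
  have ge: "s * 2 ^ N \<le> real i" unfolding i by simp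
  have lt: "real i < s * 2 ^ N + 1" unfolding i by linarith
  show "s \<le> real i / 2 ^ N" using ge by (simp add: field_simps)
  show "real i / 2 ^ N < s + 1 / 2 ^ N" using lt by (simp add: field_simps)
  show "real j / 2 ^ N < s" if "j < i" for j
  proof -
    have "real j + 1 \<le> real i" using that by simp
    then have "real j < s * 2 ^ N" using lt by linarith
    then show ?thesis by (simp add: field_simps)
  qed
  show "i \<le> N * 2 ^ N" if "s + 1 \<le> real N"
  proof -
    have "s * 2 ^ N + 1 \<le> (s + 1) * 2 ^ N" by (simp add: algebra_simps)
    also have "\<dots> \<le> real N * 2 ^ N" using that by (intro mult_right_mono) auto
    finally have "real i < real (N * 2 ^ N)" using lt by simp
    then show ?thesis by linarith
  qed
qed

lemma right_continuous_window:
  fixes f :: "real \<Rightarrow> real"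
  assumes "(f \<longlongrightarrow> f s) (at_right s)" "open U" "f s \<in> U"
  obtains \<epsilon> where "\<epsilon> > 0" "\<And>t. s \<le> t \<Longrightarrow> t < s + \<epsilon> \<Longrightarrow> f t \<in> U"
proof -
  have "eventually (\<lambda>t. f t \<in> U) (at_right s)" using assms by (rule topological_tendstoD)
  then obtain b where b: "b > s" "\<And>t. s < t \<Longrightarrow> t < b \<Longrightarrow> f t \<in> U"
    by (auto simp: eventually_at_right_field)
  show thesis
  proof (rule that[of "b - s"])
    show "f t \<in> U" if "s \<le> t" "t < s + (b - s)" for t
      using b(2)[of t] that assms(3) by (cases "t = s") auto
  qed (use b in simp)
qed

lemma eventually_dyadic_fine:
  assumes "\<epsilon> > 0"
  shows "eventually (\<lambda>N. 1 / 2 ^ N < (\<epsilon> :: real) \<and> s + 1 \<le> real N) sequentially"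
proof -
  have "(\<lambda>N. (1/2 :: real) ^ N) \<longlonglongrightarrow> 0" by (rule LIMSEQ_realpow_zero) auto
  then have "eventually (\<lambda>N. (1/2 :: real) ^ N < \<epsilon>) sequentially"
    using assms by (rule order_tendstoD(2))
  moreover have "eventually (\<lambda>N. s + 1 \<le> real N) sequentially"
    by (meson eventually_at_top_linorderI[of "nat \<lceil>s + 1\<rceil>"] order_trans real_nat_ceiling_ge of_nat_le_iff)
  ultimately show ?thesis by eventually_elim (simp add: power_divide)
qed

text \<open>Right continuity makes every value of the path visible on a fine enough dyadic grid, and the
  lattice property turns \<open>X > y - h\<close> into \<open>X \<ge> y\<close>.\<close>

lemma (in skipfree_measure) stopped_payoff_limit:
  fixes f :: "real \<Rightarrow> real" and x :: real and m n :: nat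
  assumes rc: "\<And>t. t \<ge> 0 \<Longrightarrow> (f \<longlongrightarrow> f t) (at_right t)"
    and lat: "\<And>(i::nat) (N::nat). f (real i / 2 ^ N) \<in> Zh h"
    and ex: "\<exists>k::nat. \<not> alive h m n (f (real k))"
    and x: "x \<ge> 0" "int m = \<lfloor>x / h\<rfloor>" and q: "q \<ge> 0"
  defines "T \<equiv> passage (\<lambda>t _. f t) (h * real n) ()"
  shows "(\<lambda>N. stopped_payoff (alive h m n) (\<lambda>v. exit_payoff w m n \<lfloor>v / h\<rfloor>) (exp (- q * (1 / 2 ^ N)))
        (N * 2 ^ N) (\<lambda>i. f (real i * (1 / 2 ^ N))))
     \<longlonglongrightarrow> discount q T * (if ereal (- x) \<le> run_inf (\<lambda>t _. f t) T () then 1 else 0)"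
proof -
  define y where "y = h * real n"
  have y: "y \<ge> 0" using h_pos by (simp add: y_def)
  let ?S = "\<lambda>N. stopped_payoff (alive h m n) (\<lambda>v. exit_payoff w m n \<lfloor>v / h\<rfloor>) (exp (- q * (1 / 2 ^ N)))
        (N * 2 ^ N) (\<lambda>i. f (real i * (1 / 2 ^ N)))"
  let ?al = "\<lambda>N i. alive h m n (f (real i * (1 / 2 ^ N)))"
  have lat': "f (real i * (1 / 2 ^ N)) \<in> Zh h" for i N :: nat using lat[of i N] by simp
  have al: "?al N i \<longleftrightarrow> - x \<le> f (real i / 2 ^ N) \<and> f (real i / 2 ^ N) < y" for N i
    using alive_lattice(1)[OF h_pos lat' x(2), of n i N] by (simp add: y_def)
  have up: "exit_payoff w m n \<lfloor>f (real i * (1 / 2 ^ N)) / h\<rfloor> = 1" if "y \<le> f (real i / 2 ^ N)" for i N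
  proof -
    have "real n \<le> f (real i * (1 / 2 ^ N)) / h"
      using that h_pos by (simp add: y_def field_simps)
    then have "int n \<le> \<lfloor>f (real i * (1 / 2 ^ N)) / h\<rfloor>" by (simp add: le_floor_iff)
    then show ?thesis by (simp add: exit_payoff_def)
  qed
  have down: "exit_payoff w m n \<lfloor>f (real i * (1 / 2 ^ N)) / h\<rfloor> = 0" if "f (real i / 2 ^ N) < - x" for i N
    using alive_lattice(2)[OF h_pos lat' x(2), of i N] that by (simp add: exit_payoff_def)
  define P where "P = {t. 0 \<le> t \<and> y \<le> f t}"
  have T: "T = Inf (ereal ` P)" by (simp add: T_def passage_def P_def y_def)
  have before: "f t < y" if "0 \<le> t" "ereal t < T" for t
  proof (rule ccontr)
    assume "\<not> f t < y"
    then have "t \<in> P" using that by (simp add: P_def)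
    then have "T \<le> ereal t" unfolding T by (intro Inf_lower) auto
    with that show False by simp
  qed
  \<comment> \<open>Right continuity makes the infimum a minimum: at a finite passage time the level
    is attained.\<close>
  have Tcase: "(\<exists>\<tau>. T = ereal \<tau> \<and> \<tau> \<ge> 0 \<and> y \<le> f \<tau>) \<or> T = \<infinity>"
  proof (cases "P = {}")
    case True
    then show ?thesis by (simp add: T top_ereal_def)
  next
    case False
    define \<tau> where "\<tau> = Inf P"
    have bdd: "bdd_below P" by (rule bdd_belowI[of _ 0]) (auto simp: P_def)
    have "T = ereal \<tau>" unfolding T \<tau>_def using bdd False by (intro ereal_Inf'[symmetric])
    moreover have \<tau>0: "\<tau> \<ge> 0" unfolding \<tau>_def using False by (intro cInf_greatest) (auto simp: P_def)
    moreover have "y \<le> f \<tau>"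
    proof (rule ccontr)
      assume "\<not> y \<le> f \<tau>"
      then obtain \<epsilon> where e: "\<epsilon> > 0" "\<And>t. \<tau> \<le> t \<Longrightarrow> t < \<tau> + \<epsilon> \<Longrightarrow> f t \<in> {..<y}"
        using right_continuous_window[OF rc[OF \<tau>0], of "{..<y}"] by auto
      have "Inf P < \<tau> + \<epsilon>" using e(1) by (simp add: \<tau>_def)
      then obtain t where "t \<in> P" "t < \<tau> + \<epsilon>" using cInf_lessD[OF False] by blast
      moreover have "\<tau> \<le> t" unfolding \<tau>_def using \<open>t \<in> P\<close> bdd by (rule cInf_lower)
      ultimately show False using e(2)[of t] by (simp add: P_def)
    qed
    ultimately show ?thesis by blast
  qed
  show ?thesis
  proof (cases "\<exists>s\<ge>0. ereal s \<le> T \<and> f s < - x")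
    case True
    then obtain s where s: "s \<ge> 0" "ereal s \<le> T" "f s < - x" by blast
    have "run_inf (\<lambda>t _. f t) T () \<le> ereal (f s)"
      unfolding run_inf_def using s by (intro Inf_lower) auto
    also have "\<dots> < ereal (- x)" using s by simp
    finally have lim0: "(if ereal (- x) \<le> run_inf (\<lambda>t _. f t) T () then 1 else 0) = (0 :: real)"
      by (simp add: not_le)
    \<comment> \<open>At a finite \<open>T\<close> the path is at least \<open>y \<ge> 0\<close>,
      hence not below \<open>-x\<close>. So \<open>s\<close> lies strictly before \<open>T\<close>,
      and the grid point just after \<open>s\<close> can be kept before \<open>T\<close>
      too.\<close>
    have "ereal s \<noteq> T" using Tcase s y x by (auto simp: )
    then have sT: "ereal s < T" using s by (simp add: order_less_le)
    obtain \<epsilon>1 where e1: "\<epsilon>1 > 0" "ereal (s + \<epsilon>1) \<le> T"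
    proof (cases T)
      case (real \<tau>)
      then show ?thesis using sT that[of "\<tau> - s"] by simp
    next
      case PInf
      then show ?thesis using that[of 1] by simp
    qed (use sT in simp)
    obtain \<epsilon>2 where e2: "\<epsilon>2 > 0" "\<And>t. s \<le> t \<Longrightarrow> t < s + \<epsilon>2 \<Longrightarrow> f t \<in> {..<- x}"
      using right_continuous_window[OF rc[OF s(1)], of "{..<- x}"] s(3) by auto
    have "eventually (\<lambda>N. ?S N = 0) sequentially"
      using eventually_dyadic_fine[of "min \<epsilon>1 \<epsilon>2" s]
    proof (rule eventually_mono)
      fix N assume N: "1 / 2 ^ N < min \<epsilon>1 \<epsilon>2 \<and> s + 1 \<le> real N"
      obtain i where i: "s \<le> real i / 2 ^ N" "real i / 2 ^ N < s + 1 / 2 ^ N" "i \<le> N * 2 ^ N"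
        using grid_point[OF s(1), of N] N by metis
      have "f (real i / 2 ^ N) < - x" using e2(2)[of "real i / 2 ^ N"] i N by simp
      then have nal: "\<not> ?al N i" unfolding al by simp
      \<comment> \<open>The first grid point outside the strip comes no later than the one found
        below \<open>-x\<close>, hence before \<open>T\<close>; it is an exit through the bottom,
        with payoff 0.\<close>
      define j where "j = (LEAST j. \<not> ?al N j)"
      have j: "\<not> ?al N j" "j \<le> i" unfolding j_def by (rule LeastI[of "\<lambda>j. \<not> ?al N j", OF nal], rule Least_le, rule nal)
      have jl: "?al N k" if "k < j" for k using not_less_Least that unfolding j_def by blast
      have "real j / 2 ^ N \<le> real i / 2 ^ N" using j(2) by (simp add: divide_right_mono)
      also have "\<dots> < s + \<epsilon>1" using i N by simp
      finally have "ereal (real j / 2 ^ N) < T" using e1(2) by (meson ereal_less(2) less_ereal.simps(1) order_less_le_trans)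
      then have "f (real j / 2 ^ N) < y" by (intro before) auto
      then have "f (real j / 2 ^ N) < - x" using j(1) unfolding al by simp
      then show "?S N = 0"
        using stopped_payoff_exit[of j "alive h m n" "\<lambda>i. f (real i * (1 / 2 ^ N))" "N * 2 ^ N", OF jl j(1)] j(2) i(3) down[of j N]
        by simp
    qed (use e1 e2 in simp)
    then show ?thesis unfolding lim0 by (simp add: tendsto_eventually)
  next
    case False
    then have above: "f s \<ge> - x" if "s \<ge> 0" "ereal s \<le> T" for s using that by force
    \<comment> \<open>Without passage the path would stay in the strip at all integer times, against
      \<open>ex\<close>. Hence the discounted value at an infinite \<open>T\<close> occurs only
      together with a vanishing indicator.\<close>
    have "T \<noteq> \<infinity>"
    proof
      assume TI: "T = \<infinity>"
      have "alive h m n (f (real k))" for k :: nat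
        using above[of "real k"] before[of "real k"] al[of k 0] TI by simp
      with ex show False by blast
    qed
    then obtain \<tau> where \<tau>: "T = ereal \<tau>" "\<tau> \<ge> 0" "y \<le> f \<tau>" using Tcase by blast
    have "ereal (- x) \<le> run_inf (\<lambda>t _. f t) T ()"
      unfolding run_inf_def using above by (intro Inf_greatest) auto
    then have lim1: "discount q T * (if ereal (- x) \<le> run_inf (\<lambda>t _. f t) T () then 1 else 0) = exp (- q * \<tau>)"
      by (simp add: discount_def \<tau>)
    obtain \<epsilon> where e: "\<epsilon> > 0" "\<And>t. \<tau> \<le> t \<Longrightarrow> t < \<tau> + \<epsilon> \<Longrightarrow> f t \<in> {y - h<..}"
      using right_continuous_window[OF rc[OF \<tau>(2)], of "{y - h<..}"] \<tau>(3) h_pos by auto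
    have bnds: "eventually (\<lambda>N. exp (- q * (\<tau> + 1 / 2 ^ N)) \<le> ?S N \<and> ?S N \<le> exp (- q * \<tau>)) sequentially"
      using eventually_dyadic_fine[OF e(1), of \<tau>]
    proof (rule eventually_mono)
      fix N assume N: "1 / 2 ^ N < \<epsilon> \<and> \<tau> + 1 \<le> real N"
      obtain i where i: "\<tau> \<le> real i / 2 ^ N" "real i / 2 ^ N < \<tau> + 1 / 2 ^ N"
          "\<And>j. j < i \<Longrightarrow> real j / 2 ^ N < \<tau>" "i \<le> N * 2 ^ N"
        using grid_point[OF \<tau>(2), of N] N by metis
      have jl: "?al N j" if "j < i" for j
        unfolding al using i(3)[OF that] above[of "real j / 2 ^ N"] before[of "real j / 2 ^ N"] by (simp add: \<tau>(1))
      have fi: "y \<le> f (real i / 2 ^ N)"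
      proof -
        obtain k where k: "f (real i / 2 ^ N) = h * of_int k" using lat[of i N] by (auto simp: Zh_def)
        have "h * (real n - 1) < h * of_int k" using e(2)[of "real i / 2 ^ N"] i N k by (simp add: y_def algebra_simps)
        then have "real n - 1 < of_int k" using h_pos by simp
        then have "int n - 1 < k" by linarith
        then have "real n \<le> of_int k" by linarith
        then show ?thesis using h_pos k by (simp add: y_def)
      qed
      then have "\<not> ?al N i" unfolding al by simp
      then have "?S N = exp (- q * (1 / 2 ^ N)) ^ i"
        using stopped_payoff_exit[of i "alive h m n" "\<lambda>i. f (real i * (1 / 2 ^ N))" "N * 2 ^ N", OF jl] i(4) up[OF fi]
        by simp
      also have "\<dots> = exp (- q * (real i / 2 ^ N))" by (simp add: exp_of_nat_mult[symmetric] algebra_simps)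
      finally have S: "?S N = exp (- q * (real i / 2 ^ N))" .
      have "q * \<tau> \<le> q * (real i / 2 ^ N)" "q * (real i / 2 ^ N) \<le> q * (\<tau> + 1 / 2 ^ N)"
        using i q by (auto intro!: mult_left_mono simp del: times_divide_eq_right)
      then show "exp (- q * (\<tau> + 1 / 2 ^ N)) \<le> ?S N \<and> ?S N \<le> exp (- q * \<tau>)"
        unfolding S by simp
    qed
    have "(\<lambda>N. (1/2 :: real) ^ N) \<longlonglongrightarrow> 0" by (rule LIMSEQ_realpow_zero) auto
    then have z: "(\<lambda>N. 1 / 2 ^ N :: real) \<longlonglongrightarrow> 0" by (simp add: power_divide)
    have "(\<lambda>N. exp (- q * (\<tau> + 1 / 2 ^ N))) \<longlonglongrightarrow> exp (- q * (\<tau> + 0))"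
      by (intro tendsto_intros z)
    then have lo: "(\<lambda>N. exp (- q * (\<tau> + 1 / 2 ^ N))) \<longlonglongrightarrow> exp (- q * \<tau>)" by simp
    show ?thesis unfolding lim1
      by (rule tendsto_sandwich[OF _ _ lo tendsto_const]) (use bnds in \<open>auto elim: eventually_mono\<close>)
  qed
qed

context skipfree_process
begin

theorem fluctuation_identity:
  assumes rec: "\<And>i. coef 0 * w (Suc i) = (mass + q) * w i - (\<Sum>k\<le>i. coef (Suc k) * w (i - k))"
    and w: "w (m + n) \<noteq> 0" and q: "q \<ge> 0" and x: "x \<ge> 0" "int m = \<lfloor>x / h\<rfloor>"
  defines "F \<equiv> \<lambda>\<omega>. discount q (passage X (h * real n) \<omega>) *
      indicator {\<omega>. ereal (- x) \<le> run_inf X (passage X (h * real n) \<omega>) \<omega>} \<omega>"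
  shows "F \<in> borel_measurable (completion M)" and "(LINT \<omega>|completion M. F \<omega>) = w m / w (m + n)"
proof -
  obtain B where B: "\<And>k. \<bar>exit_payoff w m n k\<bar> \<le> B" using exit_payoff_bounded by blast
  let ?S = "\<lambda>N \<omega>. stopped_payoff (alive h m n) (\<lambda>v. exit_payoff w m n \<lfloor>v / h\<rfloor>) (exp (- q * (1 / 2 ^ N)))
        (N * 2 ^ N) (\<lambda>i. X (real i * (1 / 2 ^ N)) \<omega>)"
  have meas: "?S N \<in> borel_measurable M" for N
    by (rule grid_expectation(1)[OF rec w q _ B]) simp
  have bd: "\<bar>?S N \<omega>\<bar> \<le> B" for N \<omega>
    by (rule stopped_payoff_bound) (use q B in auto)
  have lat: "AE \<omega> in M. \<forall>(i::nat) (N::nat). X (real i / 2 ^ N) \<omega> \<in> Zh h"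
    unfolding AE_all_countable by (intro allI X_lattice) simp
  have lim: "AE \<omega> in M. (\<lambda>N. ?S N \<omega>) \<longlonglongrightarrow> F \<omega>"
    using lat AE_not_alive[of m n] AE_space
  proof eventually_elim
    case (elim \<omega>)
    have "passage (\<lambda>t _. X t \<omega>) (h * real n) () = passage X (h * real n) \<omega>"
      by (simp add: passage_def)
    moreover have "run_inf (\<lambda>t _. X t \<omega>) T u = run_inf X T \<omega>" for T and u :: unit
      by (simp add: run_inf_def)
    ultimately show ?case
      using stopped_payoff_limit[of "\<lambda>t. X t \<omega>" m n x q w] elim X_right_continuous[OF elim(3)] x q
      by (auto simp: F_def indicator_def split: if_splits)
  qed
  \<comment> \<open>The limit of the grid payoffs is measurable for \<open>M\<close> itself;
    \<open>F\<close> agrees with it only almost everywhere and is therefore measurable for the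
    completion.\<close>
  define L where "L \<omega> = lim (\<lambda>N. ?S N \<omega>)" for \<omega>
  have L: "L \<in> borel_measurable M" unfolding L_def using meas by (rule borel_measurable_lim_metric)
  have "AE \<omega> in M. L \<omega> = F \<omega>"
    using lim by eventually_elim (simp add: L_def limI)
  then show F: "F \<in> borel_measurable (completion M)" by (rule borel_measurable_completion_AE[OF L])
  interpret C: prob_space "completion M" by (rule P.prob_space_completion)
  have meas': "?S N \<in> borel_measurable (completion M)" for N
    by (rule measurable_completion[OF meas])
  have "(\<lambda>N. LINT \<omega>|completion M. ?S N \<omega>) \<longlonglongrightarrow> (LINT \<omega>|completion M. F \<omega>)"
    by (rule integral_dominated_convergence[where w="\<lambda>_. B"])
       (use F meas' AE_completion[OF lim] bd in auto)
  then have 1: "(\<lambda>N. P.expectation (?S N)) \<longlonglongrightarrow> (LINT \<omega>|completion M. F \<omega>)"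
    by (simp only: integral_completion[OF meas])
  define C where "C = 2 * B * (mass + q)\<^sup>2"
  have err: "\<bar>P.expectation (?S N) - w m / w (m + n)\<bar> \<le> C * (real N * (1/2) ^ N)" for N
  proof -
    have "\<bar>P.expectation (?S N) - w m / w (m + n)\<bar> \<le> real (N * 2 ^ N) * (C * (1 / 2 ^ N)\<^sup>2)"
      unfolding C_def by (rule grid_expectation(2)[OF rec w q _ B]) simp
    also have "\<dots> = C * (real N * (1/2) ^ N)"
      by (simp add: power2_eq_square power_divide)
    finally show ?thesis .
  qed
  have "(\<lambda>N. C * (real N * (1/2) ^ N)) \<longlonglongrightarrow> C * 0"
    by (intro tendsto_mult_left powser_times_n_limit_0) simp
  then have lim0: "(\<lambda>N. C * (real N * (1/2) ^ N)) \<longlonglongrightarrow> 0" by simp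
  have "(\<lambda>N. P.expectation (?S N) - w m / w (m + n)) \<longlonglongrightarrow> 0"
    by (rule Lim_null_comparison[OF _ lim0], intro always_eventually allI)
       (simp only: real_norm_def err)
  then have 2: "(\<lambda>N. P.expectation (?S N)) \<longlonglongrightarrow> w m / w (m + n)"
    by (rule LIM_zero_cancel)
  show "(LINT \<omega>|completion M. F \<omega>) = w m / w (m + n)"
    by (rule LIMSEQ_unique[OF 1 2])
qed

end

section \<open>Existence of the tilted chain\<close>

context skipfree_process
begin

text \<open>The density is the exponential martingale at time 1, so that the increments within
  \<open>[0, 1]\<close> acquire the tilted law.\<close>

definition tilted :: "real \<Rightarrow> 'a measure" where
  "tilted b = density M (\<lambda>\<omega>. ennreal (exp (b * X 1 \<omega> - psi \<nu> b)))"

lemma sets_tilted [measurable_cong, simp]: "sets (tilted b) = sets M" by (simp add: tilted_def)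
lemma space_tilted [simp]: "space (tilted b) = space M" by (simp add: tilted_def)

context
  fixes b :: real assumes b: "b \<ge> 0"
begin

interpretation T: skipfree_measure h "tilt b \<nu>" by (rule skipfree_measure_tilt[OF b])

lemma nn_integral_increment_tilt:
  assumes "0 \<le> s" "s \<le> t" and A[measurable]: "A \<in> sets borel"
  shows "(\<integral>\<^sup>+\<omega>. ennreal (exp (b * (X t \<omega> - X s \<omega>) - (t - s) * psi \<nu> b)) * indicator A (X t \<omega> - X s \<omega>) \<partial>M) =
    emeasure (T.marginal (t - s)) A"
proof -
  have [measurable]: "X s \<in> borel_measurable M" "X t \<in> borel_measurable M" using assms by auto
  have "(\<integral>\<^sup>+\<omega>. ennreal (exp (b * (X t \<omega> - X s \<omega>) - (t - s) * psi \<nu> b)) * indicator A (X t \<omega> - X s \<omega>) \<partial>M) =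
     (\<integral>\<^sup>+x. ennreal (exp (b * x - (t - s) * psi \<nu> b)) * indicator A x \<partial>distr M borel (\<lambda>\<omega>. X t \<omega> - X s \<omega>))"
    by (subst nn_integral_distr) auto
  also have "\<dots> = emeasure (density (marginal (t - s)) (\<lambda>x. ennreal (exp (b * x - (t - s) * psi \<nu> b)))) A"
    unfolding distr_increment[OF assms(1,2)] by (subst emeasure_density) (auto simp: marginal_def)
  also have "\<dots> = emeasure (T.marginal (t - s)) A"
    using assms by (simp add: marginal_tilt[OF b])
  finally show ?thesis .
qed

text \<open>When the cells fill \<open>[0, 1]\<close>, their lengths add up to 1 and the increments
  telescope to \<open>X 1 - X 0\<close>, so the density at time 1 splits into one factor per
  cell.\<close>

lemma emeasure_tilted_full:
  assumes u: "u 0 = 0" "u n = 1" "\<And>i. i < n \<Longrightarrow> u i \<le> u (Suc i)" and A: "\<And>i. i < n \<Longrightarrow> A i \<in> sets borel"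
  shows "emeasure (tilted b) {\<omega>\<in>space M. \<forall>i<n. X (u (Suc i)) \<omega> - X (u i) \<omega> \<in> A i} =
    (\<Prod>i<n. emeasure (T.marginal (u (Suc i) - u i)) (A i))"
proof -
  have u_nonneg: "0 \<le> u i" if "i \<le> n" for i
    using that
  proof (induction i)
    case (Suc i)
    then show ?case using u(3)[of i] by simp
  qed (use u in simp)
  define D where "D i \<omega> = X (u (Suc i)) \<omega> - X (u i) \<omega>" for i \<omega>
  define f where "f i v = ennreal (exp (b * v - (u (Suc i) - u i) * psi \<nu> b)) * indicator (A i) v" for i v
  have ind: "P.indep_vars (\<lambda>_. borel) D {..<n}"
    unfolding D_def by (rule X_indep_increments) (use u in auto)
  have D[measurable]: "D i \<in> borel_measurable M" if "i < n" for i
    using ind that by (auto simp: P.indep_vars_def)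
  have f[measurable]: "f i \<in> borel_measurable borel" if "i < n" for i
    unfolding f_def using A[OF that] by measurable
  have ind': "P.indep_vars (\<lambda>_. borel) (\<lambda>i \<omega>. f i (D i \<omega>)) {..<n}"
    by (rule P.indep_vars_compose2[OF ind]) (use f in auto)
  have X1: "X 1 \<in> borel_measurable M" by simp
  have E: "{\<omega>\<in>space M. \<forall>i<n. D i \<omega> \<in> A i} \<in> sets M"
  proof -
    have "{\<omega>\<in>space M. D i \<omega> \<in> A i} \<in> sets M" if "i < n" for i
      using measurable_sets[OF D[OF that] A[OF that]] by (simp add: vimage_def Int_def conj_commute)
    then have "{\<omega>\<in>space M. \<forall>i\<in>{..<n}. D i \<omega> \<in> A i} \<in> sets M"
      by (intro sets.sets_Collect_finite_All) auto
    also have "{\<omega>\<in>space M. \<forall>i\<in>{..<n}. D i \<omega> \<in> A i} = {\<omega>\<in>space M. \<forall>i<n. D i \<omega> \<in> A i}" by auto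
    finally show ?thesis .
  qed
  have tele: "(\<Sum>i<n. D i \<omega>) = X (u n) \<omega> - X (u 0) \<omega>" for \<omega>
    unfolding D_def by (rule sum_lessThan_telescope)
  have tele_u: "(\<Sum>i<n. u (Suc i) - u i) = 1"
    unfolding sum_lessThan_telescope using u(1,2) by simp
  have "emeasure (tilted b) {\<omega>\<in>space M. \<forall>i<n. D i \<omega> \<in> A i} =
      (\<integral>\<^sup>+\<omega>. ennreal (exp (b * X 1 \<omega> - psi \<nu> b)) * indicator {\<omega>\<in>space M. \<forall>i<n. D i \<omega> \<in> A i} \<omega> \<partial>M)"
    unfolding tilted_def by (rule emeasure_density[OF _ E]) (use X1 in measurable)
  also have "\<dots> = (\<integral>\<^sup>+\<omega>. (\<Prod>i<n. f i (D i \<omega>)) \<partial>M)"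
  proof (rule nn_integral_cong_AE)
    show "AE \<omega> in M. ennreal (exp (b * X 1 \<omega> - psi \<nu> b)) * indicator {\<omega>\<in>space M. \<forall>i<n. D i \<omega> \<in> A i} \<omega> =
        (\<Prod>i<n. f i (D i \<omega>))"
      using X_zero AE_space
    proof eventually_elim
      case (elim \<omega>)
      have "(\<Prod>i<n. f i (D i \<omega>)) =
          (\<Prod>i<n. ennreal (exp (b * D i \<omega> - (u (Suc i) - u i) * psi \<nu> b))) * (\<Prod>i<n. indicator (A i) (D i \<omega>))"
        by (simp add: f_def prod.distrib)
      also have "(\<Prod>i<n. ennreal (exp (b * D i \<omega> - (u (Suc i) - u i) * psi \<nu> b))) =
          ennreal (exp (\<Sum>i<n. b * D i \<omega> - (u (Suc i) - u i) * psi \<nu> b))"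
        by (subst prod_ennreal) (auto simp: exp_sum)
      also have "(\<Sum>i<n. b * D i \<omega> - (u (Suc i) - u i) * psi \<nu> b) = b * X 1 \<omega> - psi \<nu> b"
        using tele[of \<omega>] tele_u elim u
        by (simp add: sum_subtractf sum_distrib_left[symmetric] sum_distrib_right[symmetric])
      also have "(\<Prod>i<n. indicator (A i) (D i \<omega>)) = (indicator {\<omega>\<in>space M. \<forall>i<n. D i \<omega> \<in> A i} \<omega> :: ennreal)"
        using elim by (auto simp: indicator_def prod_zero_iff)
      finally show ?case by simp
    qed
  qed
  also have "\<dots> = (\<Prod>i<n. \<integral>\<^sup>+\<omega>. f i (D i \<omega>) \<partial>M)"
    by (rule P.indep_vars_nn_integral) (use ind' in auto)
  also have "\<dots> = (\<Prod>i<n. emeasure (T.marginal (u (Suc i) - u i)) (A i))"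
  proof (rule prod.cong[OF refl])
    fix i assume "i \<in> {..<n}"
    then show "(\<integral>\<^sup>+\<omega>. f i (D i \<omega>) \<partial>M) = emeasure (T.marginal (u (Suc i) - u i)) (A i)"
      unfolding f_def D_def using u A u_nonneg by (intro nn_integral_increment_tilt) auto
  qed
  finally show ?thesis by (simp add: D_def)
qed

lemma emeasure_marginal_UNIV: "emeasure (T.marginal t) UNIV = 1"
proof -
  interpret L: real_distribution "T.marginal t" by (rule T.real_distribution_marginal)
  show ?thesis using L.emeasure_space_1 by simp
qed

text \<open>Added cells from 0 to \<open>u 0\<close> and from \<open>u n\<close> to 1, with the
  whole line as target set, complete the partition of \<open>[0, 1]\<close> and contribute factors
  1.\<close>

lemma emeasure_tilted:
  assumes u: "0 \<le> u 0" "u n \<le> 1" "\<And>i. i < n \<Longrightarrow> u i \<le> u (Suc i)" and A: "\<And>i. i < n \<Longrightarrow> A i \<in> sets borel"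
  shows "emeasure (tilted b) {\<omega>\<in>space M. \<forall>i<n. X (u (Suc i)) \<omega> - X (u i) \<omega> \<in> A i} =
    (\<Prod>i<n. emeasure (T.marginal (u (Suc i) - u i)) (A i))"
proof -
  define v where "v j = (case j of 0 \<Rightarrow> 0 | Suc i \<Rightarrow> if i \<le> n then u i else 1)" for j
  define A' where "A' j = (case j of 0 \<Rightarrow> UNIV | Suc i \<Rightarrow> if i < n then A i else UNIV)" for j
  have v: "v 0 = 0" "v (Suc i) = (if i \<le> n then u i else 1)" for i by (simp_all add: v_def)
  have A': "A' 0 = UNIV" "A' (Suc i) = (if i < n then A i else UNIV)" for i by (simp_all add: A'_def)
  have vm: "v i \<le> v (Suc i)" if "i < Suc (Suc n)" for i
  proof (cases i)
    case 0
    then show ?thesis using u by (simp add: v)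
  next
    case (Suc k)
    show ?thesis
    proof (cases "k = n")
      case True
      then show ?thesis using Suc u by (simp add: v)
    next
      case False
      then show ?thesis using Suc that u(3)[of k] by (simp add: v)
    qed
  qed
  have "emeasure (tilted b) {\<omega>\<in>space M. \<forall>i<Suc (Suc n). X (v (Suc i)) \<omega> - X (v i) \<omega> \<in> A' i} =
    (\<Prod>i<Suc (Suc n). emeasure (T.marginal (v (Suc i) - v i)) (A' i))"
    by (rule emeasure_tilted_full) (use vm A in \<open>auto simp: v A'_def split: nat.split\<close>)
  also have "{\<omega>\<in>space M. \<forall>i<Suc (Suc n). X (v (Suc i)) \<omega> - X (v i) \<omega> \<in> A' i} =
      {\<omega>\<in>space M. \<forall>i<n. X (u (Suc i)) \<omega> - X (u i) \<omega> \<in> A i}"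
  proof (intro Collect_cong conj_cong refl iffI allI impI)
    fix \<omega> i assume *: "\<forall>i<Suc (Suc n). X (v (Suc i)) \<omega> - X (v i) \<omega> \<in> A' i" and "i < n"
    then show "X (u (Suc i)) \<omega> - X (u i) \<omega> \<in> A i"
      using *[rule_format, of "Suc i"] by (simp add: v A')
  next
    fix \<omega> i assume *: "\<forall>i<n. X (u (Suc i)) \<omega> - X (u i) \<omega> \<in> A i" and i: "i < Suc (Suc n)"
    show "X (v (Suc i)) \<omega> - X (v i) \<omega> \<in> A' i"
    proof (cases i)
      case (Suc k)
      then show ?thesis using * i by (auto simp: v A')
    qed (simp add: A')
  qed
  also have "(\<Prod>i<Suc (Suc n). emeasure (T.marginal (v (Suc i) - v i)) (A' i)) =
     (\<Prod>i<Suc n. emeasure (T.marginal (v (Suc (Suc i)) - v (Suc i))) (A' (Suc i)))"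
    by (subst prod.lessThan_Suc_shift) (simp add: A' emeasure_marginal_UNIV)
  also have "\<dots> = (\<Prod>i<n. emeasure (T.marginal (v (Suc (Suc i)) - v (Suc i))) (A' (Suc i)))"
    by (simp add: A' emeasure_marginal_UNIV)
  also have "\<dots> = (\<Prod>i<n. emeasure (T.marginal (u (Suc i) - u i)) (A i))"
    by (intro prod.cong) (auto simp: A' v)
  finally show ?thesis .
qed

lemma prob_space_tilted: "prob_space (tilted b)"
proof
  \<comment> \<open>For \<open>n = 0\<close> the event is the whole space and the product is
    empty.\<close>
  have "emeasure (tilted b) {\<omega>\<in>space M. \<forall>i<0. X ((\<lambda>_. 0) (Suc i)) \<omega> - X ((\<lambda>_. 0) i) \<omega> \<in> UNIV} =
    (\<Prod>i<0. emeasure (T.marginal ((\<lambda>_. 0) (Suc i) - (\<lambda>_. 0) i)) UNIV)"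
    by (rule emeasure_tilted) auto
  then show "emeasure (tilted b) (space (tilted b)) = 1" by simp
qed

lemma distr_tilted_increment:
  assumes "0 \<le> s" "s \<le> t" "t \<le> 1"
  shows "distr (tilted b) borel (\<lambda>\<omega>. X t \<omega> - X s \<omega>) = T.marginal (t - s)"
proof (rule measure_eqI)
  fix A assume "A \<in> sets (distr (tilted b) borel (\<lambda>\<omega>. X t \<omega> - X s \<omega>))"
  then have A: "A \<in> sets borel" by simp
  have [measurable]: "X s \<in> borel_measurable M" "X t \<in> borel_measurable M" using assms by auto
  define u where "u i = (if i = 0 then s else t)" for i :: nat
  have "emeasure (tilted b) {\<omega>\<in>space M. \<forall>i<1. X (u (Suc i)) \<omega> - X (u i) \<omega> \<in> A} =
    (\<Prod>i<1. emeasure (T.marginal (u (Suc i) - u i)) A)"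
    by (rule emeasure_tilted) (use assms A in \<open>auto simp: u_def\<close>)
  then have "emeasure (tilted b) {\<omega>\<in>space M. X t \<omega> - X s \<omega> \<in> A} = emeasure (T.marginal (t - s)) A"
    by (simp add: u_def)
  moreover have "(\<lambda>\<omega>. X t \<omega> - X s \<omega>) -` A \<inter> space (tilted b) = {\<omega>\<in>space M. X t \<omega> - X s \<omega> \<in> A}" by auto
  ultimately show "emeasure (distr (tilted b) borel (\<lambda>\<omega>. X t \<omega> - X s \<omega>)) A = emeasure (T.marginal (t - s)) A"
    using A by (subst emeasure_distr) auto
qed (simp add: T.marginal_def)

end

end

section \<open>Paths cut into unit time intervals; the space of cadlag paths\<close>

definition clamp01 :: "real \<Rightarrow> real" where "clamp01 s = max 0 (min 1 s)"

lemma clamp01_simps [simp]: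
  "0 \<le> clamp01 s" "clamp01 s \<le> 1" "s \<le> 0 \<Longrightarrow> clamp01 s = 0" "1 \<le> s \<Longrightarrow> clamp01 s = 1"
  "0 \<le> s \<Longrightarrow> s \<le> 1 \<Longrightarrow> clamp01 s = s" "s \<le> t \<Longrightarrow> clamp01 s \<le> clamp01 t"
  by (auto simp: clamp01_def)

text \<open>For \<open>t \<ge> 0\<close> the number \<open>clamp01 (t - real k)\<close> is the
  length of the part of \<open>[k, k + 1]\<close> that lies before \<open>t\<close>.\<close>

lemma sum_clamp01: "t \<ge> 0 \<Longrightarrow> (\<Sum>k<N. clamp01 (t - real k)) = min t (real N)"
  by (induction N) (auto simp: clamp01_def min_def max_def)

lemma cadlag_cong_atMost:
  assumes "cadlag g" "t0 > 0" "\<And>s. s \<le> t0 \<Longrightarrow> f s = g s"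
  shows "t \<ge> 0 \<Longrightarrow> t < t0 \<Longrightarrow> continuous (at_right t) f"
    and "t > 0 \<Longrightarrow> t < t0 \<Longrightarrow> \<exists>l. (f \<longlongrightarrow> l) (at_left t)"
proof -
  assume t: "t \<ge> 0" "t < t0"
  have "(g \<longlongrightarrow> g t) (at_right t)" using assms(1) t by (simp add: cadlag_def continuous_within)
  moreover have "eventually (\<lambda>s. g s = f s) (at_right t)"
    using t assms(3) by (auto simp: eventually_at_right_field intro!: exI[of _ t0])
  ultimately have "(f \<longlongrightarrow> g t) (at_right t)" by (rule Lim_transform_eventually)
  then show "continuous (at_right t) f" using assms(3)[of t] t by (simp add: continuous_within)
next
  assume t: "t > 0" "t < t0"
  obtain l where "(g \<longlongrightarrow> l) (at_left t)" using assms(1) t by (auto simp: cadlag_def)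
  moreover have "eventually (\<lambda>s. g s = f s) (at_left t)"
    using t assms(3) by (auto simp: eventually_at_left_field intro!: exI[of _ 0])
  ultimately have "(f \<longlongrightarrow> l) (at_left t)" by (rule Lim_transform_eventually)
  then show "\<exists>l. (f \<longlongrightarrow> l) (at_left t)" by blast
qed

lemma cadlag_clamp01_shift:
  assumes f: "cadlag f" shows "cadlag (\<lambda>s. f (clamp01 (s - r)))"
  unfolding cadlag_def
proof (intro conjI allI impI)
  fix t :: real
  show "continuous (at_right t) (\<lambda>s. f (clamp01 (s - r)))"
  proof -
    consider "t < r" | "r \<le> t" "t < r + 1" | "r + 1 \<le> t" by linarith
    then have "((\<lambda>s. f (clamp01 (s - r))) \<longlongrightarrow> f (clamp01 (t - r))) (at_right t)"
    proof cases
      case 1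
      then have "eventually (\<lambda>s. f (clamp01 (s - r)) = f (clamp01 (t - r))) (at_right t)"
        by (auto simp: eventually_at_right_field intro!: exI[of _ r])
      then show ?thesis by (rule tendsto_eventually)
    next
      case 2
      have "(f \<longlongrightarrow> f (t - r)) (at_right (t - r))" using f 2 by (simp add: cadlag_def continuous_within)
      then have "((\<lambda>s. f (s - r)) \<longlongrightarrow> f (t - r)) (at_right t)"
        by (subst (asm) filterlim_at_right_to_0) (subst filterlim_at_right_to_0, simp add: algebra_simps)
      moreover have "eventually (\<lambda>s. f (s - r) = f (clamp01 (s - r))) (at_right t)"
        using 2 by (auto simp: eventually_at_right_field intro!: exI[of _ "r + 1"])
      ultimately have "((\<lambda>s. f (clamp01 (s - r))) \<longlongrightarrow> f (t - r)) (at_right t)"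
        by (rule Lim_transform_eventually)
      then show ?thesis using 2 by simp
    next
      case 3
      then have "eventually (\<lambda>s. f (clamp01 (s - r)) = f (clamp01 (t - r))) (at_right t)"
        by (auto simp: eventually_at_right_field intro!: exI[of _ "t + 1"])
      then show ?thesis by (rule tendsto_eventually)
    qed
    then show ?thesis by (simp add: continuous_within)
  qed
next
  fix t :: real
  \<comment> \<open>For left limits the cases are closed on the right, the reverse of the case split
    for right limits: just before \<open>r\<close> the clamped path is still constant.\<close>
  consider "t \<le> r" | "r < t" "t \<le> r + 1" | "r + 1 < t" by linarith
  then show "\<exists>l. ((\<lambda>s. f (clamp01 (s - r))) \<longlongrightarrow> l) (at_left t)"
  proof cases
    case 1
    then have "eventually (\<lambda>s. f (clamp01 (s - r)) = f 0) (at_left t)"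
      by (auto simp: eventually_at_left_field intro!: exI[of _ "t - 1"])
    then show ?thesis by (intro exI[of _ "f 0"] tendsto_eventually)
  next
    case 2
    then have "\<exists>l. (f \<longlongrightarrow> l) (at_left (t - r))" using f unfolding cadlag_def by simp
    then obtain l where "(f \<longlongrightarrow> l) (at_left (t - r))" by blast
    then have "((\<lambda>s. f (s - r)) \<longlongrightarrow> l) (at_left t)"
      by (subst (asm) filterlim_at_left_to_right, subst (asm) filterlim_at_right_to_0)
         (subst filterlim_at_left_to_right, subst filterlim_at_right_to_0, simp add: algebra_simps)
    moreover have "eventually (\<lambda>s. f (s - r) = f (clamp01 (s - r))) (at_left t)"
      using 2 by (auto simp: eventually_at_left_field intro!: exI[of _ r])
    ultimately have "((\<lambda>s. f (clamp01 (s - r))) \<longlongrightarrow> l) (at_left t)"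
      by (rule Lim_transform_eventually)
    then show ?thesis by blast
  next
    case 3
    then have "eventually (\<lambda>s. f (clamp01 (s - r)) = f 1) (at_left t)"
      by (auto simp: eventually_at_left_field intro!: exI[of _ "r + 1"])
    then show ?thesis by (intro exI[of _ "f 1"] tendsto_eventually)
  qed
qed

lemma cadlag_const: "cadlag (\<lambda>_. c)"
  by (auto simp: cadlag_def)

lemma cadlag_diff: "cadlag f \<Longrightarrow> cadlag g \<Longrightarrow> cadlag (\<lambda>s. f s - g s)"
  unfolding cadlag_def
proof (intro conjI allI impI; elim conjE)
  fix t :: real
  assume "\<forall>t>0. \<exists>l. (f \<longlongrightarrow> l) (at_left t)" "\<forall>t>0. \<exists>l. (g \<longlongrightarrow> l) (at_left t)" "0 < t"
  then obtain l l' where "(f \<longlongrightarrow> l) (at_left t)" "(g \<longlongrightarrow> l') (at_left t)" by blast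
  then have "((\<lambda>s. f s - g s) \<longlongrightarrow> l - l') (at_left t)" by (rule tendsto_diff)
  then show "\<exists>l. ((\<lambda>s. f s - g s) \<longlongrightarrow> l) (at_left t)" by blast
qed (auto intro: continuous_diff)

lemma cadlag_sum:
  assumes "\<And>k. k < N \<Longrightarrow> cadlag (f k)" shows "cadlag (\<lambda>s. \<Sum>k<(N::nat). f k s)"
  using assms
proof (induction N)
  case (Suc N)
  then have "cadlag (\<lambda>s. (\<Sum>k<N. f k s) - (0 - f N s))"
    by (intro cadlag_diff cadlag_const) auto
  then show ?case by simp
qed (simp add: cadlag_const)

text \<open>\<open>levy_process\<close> demands cadlag paths at every point of the space, so the
  product space is cut down to the cadlag functions.\<close>

definition path_space :: "(real \<Rightarrow> real) measure" where
  "path_space = restrict_space (\<Pi>\<^sub>M t\<in>UNIV. borel) {\<omega>. cadlag \<omega>}"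

lemma (in prob_space) indep_vars_distr:
  assumes f: "f \<in> measurable M N" and X: "\<And>i. i \<in> I \<Longrightarrow> X i \<in> measurable N (M' i)"
    and ind: "indep_vars M' (\<lambda>i x. X i (f x)) I"
  shows "prob_space.indep_vars (distr M N f) M' X I"
proof -
  interpret D: prob_space "distr M N f" by (rule prob_space_distr[OF f])
  show ?thesis
  proof (cases "I = {}")
    case True
    then show ?thesis by (simp add: D.indep_vars_def D.indep_sets_def)
  next
    case False
    have "distr (distr M N f) (\<Pi>\<^sub>M i\<in>I. M' i) (\<lambda>x. \<lambda>i\<in>I. X i x) = distr M (\<Pi>\<^sub>M i\<in>I. M' i) (\<lambda>x. \<lambda>i\<in>I. X i (f x))"
      using f X by (subst distr_distr) (auto intro!: measurable_restrict simp: o_def)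
    also have "\<dots> = (\<Pi>\<^sub>M i\<in>I. distr M (M' i) (\<lambda>x. X i (f x)))"
      using indep_vars_iff_distr_eq_PiM'[OF False, of "\<lambda>i x. X i (f x)" M'] ind f X
      by (auto intro: measurable_compose)
    also have "\<dots> = (\<Pi>\<^sub>M i\<in>I. distr (distr M N f) (M' i) (X i))"
      by (intro PiM_cong refl) (simp add: distr_distr[OF X f] o_def)
    finally show ?thesis
      using D.indep_vars_iff_distr_eq_PiM'[OF False, of X M'] X by simp
  qed
qed

text \<open>\<open>chain_law\<close> chooses among measures under which \<open>coord\<close> is the
  chain, so a chain on another space has to be transported. Measurability is required at all real
  times, since a path is a point of the product over the whole line.\<close>

lemma skipfree_chain_path_space:
  assumes ch: "skipfree_chain h \<nu> M X" and meas: "\<And>t. X t \<in> borel_measurable M"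
  shows "skipfree_chain h \<nu> (distr M path_space (\<lambda>\<omega> t. X t \<omega>)) coord"
proof -
  have levy: "levy_process M X" using ch by (simp add: skipfree_chain_def compound_poisson_def)
  interpret P: prob_space M using levy by (simp add: levy_process_def)
  let ?f = "\<lambda>\<omega> t. X t \<omega>"
  have f[measurable]: "?f \<in> measurable M path_space"
    unfolding path_space_def
  proof (rule measurable_restrict_space2)
    show "?f \<in> space M \<rightarrow> {\<omega>. cadlag \<omega>}" using levy by (auto simp: levy_process_def)
    show "?f \<in> measurable M (\<Pi>\<^sub>M t\<in>UNIV. borel)"
      by (rule measurable_PiM_single') (use meas in auto)
  qed
  have c[measurable]: "coord t \<in> borel_measurable path_space" for t
    unfolding path_space_def coord_def[abs_def]
    by (intro measurable_restrict_space1 measurable_component_singleton) auto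
  have coord_f: "coord t (?f \<omega>) = X t \<omega>" for t \<omega> by (simp add: coord_def)
  let ?P = "distr M path_space ?f"
  have distr_coord: "distr ?P borel (\<lambda>\<omega>. g (coord t \<omega>) (coord s \<omega>)) = distr M borel (\<lambda>\<omega>. g (X t \<omega>) (X s \<omega>))"
    if "case_prod g \<in> borel_measurable (borel \<Otimes>\<^sub>M borel)" for g t s
  proof -
    have "(\<lambda>\<omega>. case_prod g (coord t \<omega>, coord s \<omega>)) \<in> borel_measurable path_space"
      by (rule measurable_compose[OF _ that]) measurable
    then show ?thesis by (subst distr_distr) (auto simp: o_def coord_f)
  qed
  have d1: "distr ?P borel (coord t) = distr M borel (X t)" for t
    by (subst distr_distr) (auto simp: o_def coord_f)
  have d2: "distr ?P borel (\<lambda>\<omega>. coord t \<omega> - coord s \<omega>) = distr M borel (\<lambda>\<omega>. X t \<omega> - X s \<omega>)" for s t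
    by (rule distr_coord) measurable
  have "levy_process ?P coord"
    unfolding levy_process_def
  proof (intro conjI allI impI ballI)
    show "prob_space ?P" by (rule P.prob_space_distr[OF f])
    show "coord t \<in> borel_measurable ?P" for t by simp
    show "cadlag (\<lambda>t. coord t \<omega>)" if "\<omega> \<in> space ?P" for \<omega>
      using that by (simp add: path_space_def space_restrict_space coord_def)
    show "AE \<omega> in ?P. coord 0 \<omega> = 0"
      using levy by (subst AE_distr_iff) (auto simp: levy_process_def coord_f)
    show "prob_space.indep_vars ?P (\<lambda>_. borel) (\<lambda>i \<omega>. coord (t (Suc i)) \<omega> - coord (t i) \<omega>) {..<n}"
      if "0 \<le> t 0 \<and> (\<forall>i<n. t i \<le> t (Suc i))" for n and t :: "nat \<Rightarrow> real"
    proof (rule P.indep_vars_distr[OF f])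
      show "P.indep_vars (\<lambda>_. borel) (\<lambda>i x. coord (t (Suc i)) (?f x) - coord (t i) (?f x)) {..<n}"
        using levy that unfolding levy_process_def coord_f by blast
    qed measurable
    show "distr ?P borel (\<lambda>\<omega>. coord (s + t) \<omega> - coord s \<omega>) = distr ?P borel (coord t)"
      if "0 \<le> s" "0 \<le> t" for s t
      using levy that unfolding levy_process_def d1 d2 by blast
  qed
  then show ?thesis
    using ch unfolding skipfree_chain_def compound_poisson_def d1 by blast
qed

section \<open>Concatenation of independent copies\<close>

context skipfree_process
begin

text \<open>Independent copies of the chain on \<open>[0, 1]\<close>, tilted by \<open>exp (b X\<^sub>1 - \<psi> b)\<close>, are glued together.\<close>

definition glued :: "real \<Rightarrow> (nat \<Rightarrow> 'a) \<Rightarrow> real" where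
  "glued t \<omega> = (\<Sum>k<nat \<lceil>t\<rceil>. X (clamp01 (t - real k)) (\<omega> k) - X 0 (\<omega> k))"

text \<open>Blocks that have not begun by time \<open>t\<close> contribute
  \<open>X 0 - X 0 = 0\<close>. Hence the values at several times can be written with one common
  number of blocks.\<close>

lemma glued_eq:
  assumes "t \<le> real N"
  shows "glued t \<omega> = (\<Sum>k<N. X (clamp01 (t - real k)) (\<omega> k) - X 0 (\<omega> k))"
  unfolding glued_def
proof (rule sum.mono_neutral_left)
  show "{..<nat \<lceil>t\<rceil>} \<subseteq> {..<N}" using assms by (auto simp: ceiling_le_iff)
  show "\<forall>k\<in>{..<N} - {..<nat \<lceil>t\<rceil>}. X (clamp01 (t - real k)) (\<omega> k) - X 0 (\<omega> k) = 0"
  proof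
    fix k assume "k \<in> {..<N} - {..<nat \<lceil>t\<rceil>}"
    then have "t \<le> real k" by (simp add: ceiling_le_iff nat_le_iff)
    then show "X (clamp01 (t - real k)) (\<omega> k) - X 0 (\<omega> k) = 0" by simp
  qed
qed simp

lemma glued_increment:
  assumes "s \<le> t" "t \<le> real N"
  shows "glued t \<omega> - glued s \<omega> = (\<Sum>k<N. X (clamp01 (t - real k)) (\<omega> k) - X (clamp01 (s - real k)) (\<omega> k))"
  using assms by (simp add: glued_eq[of _ N] sum_subtractf)

lemma glued_cadlag:
  assumes "\<And>k. \<omega> k \<in> space M"
  shows "cadlag (\<lambda>t. glued t \<omega>)"
proof -
  have c: "cadlag (\<lambda>t. X t (\<omega> k))" for k using levy assms by (simp add: levy_process_def)
  let ?g = "\<lambda>N s. \<Sum>k<N. X (clamp01 (s - real k)) (\<omega> k) - X 0 (\<omega> k)"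
  have g: "cadlag (?g N)" for N
    by (intro cadlag_sum cadlag_diff cadlag_const) (rule cadlag_clamp01_shift[OF c])
  \<comment> \<open>The bound is strict, so one fixed number of blocks serves in a whole
    neighbourhood of \<open>t\<close>.\<close>
  have N: "t < real (Suc (nat \<lceil>t\<rceil>))" for t by linarith
  show ?thesis
    unfolding cadlag_def
  proof (intro conjI allI impI)
    fix t :: real assume t: "t \<ge> 0"
    show "continuous (at_right t) (\<lambda>t. glued t \<omega>)"
      by (rule cadlag_cong_atMost(1)[OF g[of "Suc (nat \<lceil>t\<rceil>)"] _ glued_eq t N]) auto
  next
    fix t :: real assume t: "t > 0"
    show "\<exists>l. ((\<lambda>t. glued t \<omega>) \<longlongrightarrow> l) (at_left t)"
      by (rule cadlag_cong_atMost(2)[OF g[of "Suc (nat \<lceil>t\<rceil>)"] _ glued_eq t N]) auto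
  qed
qed

context
  fixes b :: real assumes b: "b \<ge> 0"
begin

interpretation T: skipfree_measure h "tilt b \<nu>" by (rule skipfree_measure_tilt[OF b])
interpretation Q: prob_space "tilted b" by (rule prob_space_tilted[OF b])
interpretation PQ: product_prob_space "\<lambda>_::nat. tilted b" UNIV ..

abbreviation "\<Omega> \<equiv> PiM (UNIV :: nat set) (\<lambda>_. tilted b)"

text \<open>The part of the \<open>j\<close>-th increment that falls into the \<open>k\<close>-th
  unit interval, read off from the \<open>k\<close>-th copy.\<close>

abbreviation (input) "block t \<equiv> \<lambda>(k, j) \<omega>. X (clamp01 (t (Suc j) - real k)) (\<omega> k) - X (clamp01 (t j - real k)) (\<omega> k)"

lemma X_clamp_measurable: "(\<lambda>\<omega>. X (clamp01 s) (\<omega> k)) \<in> borel_measurable \<Omega>"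
proof -
  have "X (clamp01 s) \<in> borel_measurable (tilted b)"
    using X_measurable[of "clamp01 s"] by (simp cong: measurable_cong_sets)
  then show ?thesis by (intro measurable_compose[OF measurable_component_singleton]) auto
qed

lemma block_measurable: "block t p \<in> borel_measurable \<Omega>"
  by (cases p) (auto intro!: borel_measurable_diff X_clamp_measurable)

lemma distr_block:
  assumes "t j \<le> t (Suc j)"
  shows "distr \<Omega> borel (block t (k, j)) = T.marginal (clamp01 (t (Suc j) - real k) - clamp01 (t j - real k))"
proof -
  let ?D = "\<lambda>\<omega>. X (clamp01 (t (Suc j) - real k)) \<omega> - X (clamp01 (t j - real k)) \<omega>"
  have D: "?D \<in> borel_measurable (tilted b)"
    using X_measurable by (simp cong: measurable_cong_sets)
  have "distr \<Omega> borel (block t (k, j)) = distr (distr \<Omega> (tilted b) (\<lambda>\<omega>. \<omega> k)) borel ?D"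
    by (subst distr_distr[OF D]) (auto simp: o_def)
  also have "distr \<Omega> (tilted b) (\<lambda>\<omega>. \<omega> k) = tilted b"
    by (rule PQ.PiM_component) simp
  also have "distr (tilted b) borel ?D = T.marginal (clamp01 (t (Suc j) - real k) - clamp01 (t j - real k))"
    using assms by (intro distr_tilted_increment[OF b]) auto
  finally show ?thesis .
qed

text \<open>Different copies are independent by the product measure, and within one copy
  \<open>emeasure_tilted\<close> applies to the clamped times, which increase within
  \<open>[0, 1]\<close>. The two product formulas combine into one over all pairs.\<close>

lemma indep_blocks:
  fixes t :: "nat \<Rightarrow> real"
  assumes t: "\<And>i. i < n \<Longrightarrow> t i \<le> t (Suc i)"
  shows "PQ.indep_vars (\<lambda>_. borel) (block t) ({..<N} \<times> {..<n})"
proof (cases "{..<N} \<times> {..<n} = {}")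
  case True
  then show ?thesis by (simp only: True) (simp add: PQ.indep_vars_def PQ.indep_sets_def)
next
  case False
  let ?D = "\<lambda>k j \<omega>. X (clamp01 (t (Suc j) - real k)) \<omega> - X (clamp01 (t j - real k)) \<omega>"
  let ?l = "\<lambda>k j. clamp01 (t (Suc j) - real k) - clamp01 (t j - real k)"
  have "PQ.prob (\<Inter>p\<in>{..<N} \<times> {..<n}. block t p -` A p \<inter> space \<Omega>) =
      (\<Prod>p\<in>{..<N} \<times> {..<n}. PQ.prob (block t p -` A p \<inter> space \<Omega>))"
    if A: "A \<in> {..<N} \<times> {..<n} \<rightarrow> sets borel" for A
  proof -
    define B where "B k = {\<omega>\<in>space M. \<forall>j<n. ?D k j \<omega> \<in> A (k, j)}" for k
    have A': "A (k, j) \<in> sets borel" if "k < N" "j < n" for k j using A that by auto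
    have emB: "emeasure (tilted b) (B k) = (\<Prod>j<n. emeasure (T.marginal (?l k j)) (A (k, j)))" if "k < N" for k
      unfolding B_def using t A' that
      by (intro emeasure_tilted[OF b, where u="\<lambda>j. clamp01 (t j - real k)"]) auto
    have setsB: "B k \<in> sets (tilted b)" if "k < N" for k
    proof -
      have "(\<lambda>\<omega>. ?D k j \<omega>) -` A (k, j) \<inter> space M \<in> sets M" if "j < n" for j
        using A'[OF \<open>k < N\<close> that] X_measurable by (intro measurable_sets[of _ M borel]) auto
      then have "{\<omega>\<in>space M. ?D k j \<omega> \<in> A (k, j)} \<in> sets M" if "j < n" for j
        using that by (simp add: vimage_def Int_def conj_commute)
      then have "{\<omega>\<in>space M. \<forall>j\<in>{..<n}. ?D k j \<omega> \<in> A (k, j)} \<in> sets M"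
        by (intro sets.sets_Collect_finite_All) auto
      also have "{\<omega>\<in>space M. \<forall>j\<in>{..<n}. ?D k j \<omega> \<in> A (k, j)} = B k"
        by (auto simp: B_def)
      finally show ?thesis by simp
    qed
    have "(\<Inter>p\<in>{..<N} \<times> {..<n}. block t p -` A p \<inter> space \<Omega>) = {\<omega>\<in>space \<Omega>. \<forall>k\<in>{..<N}. \<omega> k \<in> B k}"
      using False by (auto simp: B_def space_PiM PiE_def Pi_def)
    then have "emeasure \<Omega> (\<Inter>p\<in>{..<N} \<times> {..<n}. block t p -` A p \<inter> space \<Omega>) = (\<Prod>k<N. emeasure (tilted b) (B k))"
      using PQ.emeasure_PiM_Collect[of "{..<N}" B] setsB by simp
    also have "\<dots> = (\<Prod>k<N. \<Prod>j<n. emeasure (T.marginal (?l k j)) (A (k, j)))"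
      by (intro prod.cong refl emB) auto
    also have "\<dots> = (\<Prod>p\<in>{..<N} \<times> {..<n}. emeasure (distr \<Omega> borel (block t p)) (A p))"
    proof -
      have "emeasure (T.marginal (?l k j)) (A (k, j)) = emeasure (distr \<Omega> borel (block t (k, j))) (A (k, j))" if "j < n" for k j
        using distr_block[of t j k] t[OF that] by simp
      then show ?thesis unfolding prod.cartesian_product by (intro prod.cong) auto
    qed
    also have "\<dots> = (\<Prod>p\<in>{..<N} \<times> {..<n}. emeasure \<Omega> (block t p -` A p \<inter> space \<Omega>))"
      using A by (intro prod.cong refl emeasure_distr block_measurable) auto
    also have "\<dots> = ennreal (\<Prod>p\<in>{..<N} \<times> {..<n}. PQ.prob (block t p -` A p \<inter> space \<Omega>))"
      by (simp add: PQ.emeasure_eq_measure prod_ennreal)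
    finally show ?thesis by (simp add: PQ.emeasure_eq_measure prod_nonneg)
  qed
  then show ?thesis
    using False block_measurable
    by (subst PQ.indep_vars_finite[where E="\<lambda>_. sets borel"])
       (auto simp: sets.sigma_sets_eq sets.Int_stable intro!: sets.sigma_sets_eq[symmetric, of borel, simplified])
qed

text \<open>The \<open>j\<close>-th increment of the glued path is a sum over the blocks with second
  index \<open>j\<close>; functions of disjoint families of independent variables are
  independent.\<close>

lemma glued_indep_increments:
  fixes t :: "nat \<Rightarrow> real"
  assumes t: "0 \<le> t 0" "\<And>i. i < n \<Longrightarrow> t i \<le> t (Suc i)"
  shows "PQ.indep_vars (\<lambda>_. borel) (\<lambda>i \<omega>. glued (t (Suc i)) \<omega> - glued (t i) \<omega>) {..<n}"
proof -
  define N where "N = nat \<lceil>t n\<rceil>"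
  have tN: "t (Suc i) \<le> real N" if "i < n" for i
  proof -
    have "t i \<le> t j" if "i \<le> j" "j \<le> n" for i j
      using that
    proof (induction j rule: dec_induct)
      case (step j)
      then show ?case using t(2)[of j] by simp
    qed simp
    then have "t (Suc i) \<le> t n" using that by simp
    also have "\<dots> \<le> real N" unfolding N_def by (rule real_nat_ceiling_ge)
    finally show ?thesis .
  qed
  have "PQ.indep_vars (\<lambda>j. PiM ({..<N} \<times> {j}) (\<lambda>_. borel)) (\<lambda>j \<omega>. restrict (\<lambda>p. block t p \<omega>) ({..<N} \<times> {j})) {..<n}"
    by (rule PQ.indep_vars_restrict[OF indep_blocks[of n t N]]) (use t in \<open>auto simp: disjoint_family_on_def\<close>)
  then have "PQ.indep_vars (\<lambda>_. borel) (\<lambda>j \<omega>. (\<lambda>f. \<Sum>k<N. f (k, j)) (restrict (\<lambda>p. block t p \<omega>) ({..<N} \<times> {j}))) {..<n}"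
    by (rule PQ.indep_vars_compose2) (auto intro!: borel_measurable_sum measurable_component_singleton)
  then show ?thesis
  proof (rule PQ.indep_vars_cong[THEN iffD1, rotated -1])
    fix j assume "j \<in> {..<n}"
    then show "(\<lambda>\<omega>. (\<lambda>f. \<Sum>k<N. f (k, j)) (restrict (\<lambda>p. block t p \<omega>) ({..<N} \<times> {j}))) =
        (\<lambda>\<omega>. glued (t (Suc j)) \<omega> - glued (t j) \<omega>)"
      using glued_increment[of "t j" "t (Suc j)" N] t tN by simp
  qed auto
qed

lemma glued_measurable: "glued t \<in> borel_measurable \<Omega>"
proof -
  have "X (clamp01 0) = X 0" by simp
  then show ?thesis
    unfolding glued_def using X_clamp_measurable X_clamp_measurable[of 0] by (intro borel_measurable_sum borel_measurable_diff) auto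
qed

text \<open>Each piece has a characteristic exponent proportional to the time spent in its unit
  interval, and these times add up to \<open>u - s\<close>.\<close>

lemma distr_glued_increment:
  assumes "0 \<le> s" "s \<le> u"
  shows "distr \<Omega> borel (\<lambda>\<omega>. glued u \<omega> - glued s \<omega>) = T.marginal (u - s)"
proof (rule T.eq_marginalI)
  show "u - s \<ge> 0" using assms by simp
  show "real_distribution (distr \<Omega> borel (\<lambda>\<omega>. glued u \<omega> - glued s \<omega>))"
    by (intro PQ.real_distribution_distr borel_measurable_diff glued_measurable)
  fix \<theta>
  let ?\<eta> = "CLINT x|tilt b \<nu>. iexp (\<theta> * x) - 1"
  define N where "N = nat \<lceil>u\<rceil>"
  have uN: "u \<le> real N" unfolding N_def by (rule real_nat_ceiling_ge)
  \<comment> \<open>A time sequence whose first step leads from \<open>s\<close> to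
    \<open>u\<close>, so that the pairs \<open>(k, 0)\<close> index the pieces of this one
    increment.\<close>
  define t where "t i = (if i = 0 then s else u)" for i :: nat
  have t: "t 0 = s" "t (Suc 0) = u" by (simp_all add: t_def)
  let ?l = "\<lambda>k. clamp01 (u - real k) - clamp01 (s - real k)"
  have "PQ.indep_vars (\<lambda>_. borel) (block t) ({..<N} \<times> {..<1})"
    by (rule indep_blocks) (use assms in \<open>auto simp: t_def\<close>)
  moreover have sets_eq: "{..<N} \<times> {..<1} = (\<lambda>k. (k, 0::nat)) ` {..<N}" by auto
  ultimately have ind: "PQ.indep_vars (\<lambda>_. borel) (block t) ((\<lambda>k. (k, 0)) ` {..<N})" by simp
  have "char (distr \<Omega> borel (\<lambda>\<omega>. glued u \<omega> - glued s \<omega>)) \<theta> =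
      char (distr \<Omega> borel (\<lambda>\<omega>. \<Sum>p\<in>(\<lambda>k. (k, 0)) ` {..<N}. block t p \<omega>)) \<theta>"
    using glued_increment[OF assms(2) uN] by (subst sum.reindex) (auto simp: inj_on_def t)
  also have "\<dots> = (\<Prod>p\<in>(\<lambda>k. (k, 0)) ` {..<N}. char (distr \<Omega> borel (block t p)) \<theta>)"
    by (rule PQ.char_distr_sum[OF ind])
  also have "\<dots> = (\<Prod>k<N. char (distr \<Omega> borel (block t (k, 0))) \<theta>)"
    by (subst prod.reindex) (auto simp: inj_on_def)
  also have "\<dots> = (\<Prod>k<N. exp (complex_of_real (?l k) * ?\<eta>))"
  proof (rule prod.cong[OF refl])
    fix k
    have "distr \<Omega> borel (block t (k, 0)) = T.marginal (?l k)"
      using distr_block[of t 0 k] assms by (simp add: t)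
    then show "char (distr \<Omega> borel (block t (k, 0))) \<theta> = exp (complex_of_real (?l k) * ?\<eta>)"
      using T.char_marginal[of "?l k" \<theta>] assms by simp
  qed
  also have "\<dots> = exp (complex_of_real (\<Sum>k<N. ?l k) * ?\<eta>)"
    by (simp add: exp_sum sum_distrib_right)
  also have "(\<Sum>k<N. ?l k) = u - s"
    using assms uN by (simp add: sum_subtractf sum_clamp01)
  finally show "char (distr \<Omega> borel (\<lambda>\<omega>. glued u \<omega> - glued s \<omega>)) \<theta> = exp (complex_of_real (u - s) * ?\<eta>)" .
qed

lemma glued_0 [simp]: "glued 0 \<omega> = 0"
  by (simp add: glued_def)

lemma skipfree_chain_glued: "skipfree_chain h (tilt b \<nu>) \<Omega> glued"
proof -
  have d: "distr \<Omega> borel (glued t) = T.marginal t" if "t \<ge> 0" for t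
    using distr_glued_increment[of 0 t] that by simp
  have "levy_process \<Omega> glued"
    unfolding levy_process_def
  proof (intro conjI allI impI ballI)
    show "prob_space \<Omega>" by (rule PQ.prob_space_axioms)
    show "glued t \<in> borel_measurable \<Omega>" for t by (rule glued_measurable)
    show "cadlag (\<lambda>t. glued t \<omega>)" if "\<omega> \<in> space \<Omega>" for \<omega>
      using that by (intro glued_cadlag) (auto simp: space_PiM)
    show "AE \<omega> in \<Omega>. glued 0 \<omega> = 0" by simp
    show "PQ.indep_vars (\<lambda>_. borel) (\<lambda>i \<omega>. glued (t (Suc i)) \<omega> - glued (t i) \<omega>) {..<n}"
      if "0 \<le> t 0 \<and> (\<forall>i<n. t i \<le> t (Suc i))" for n and t :: "nat \<Rightarrow> real"
      using that by (intro glued_indep_increments) auto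
    show "distr \<Omega> borel (\<lambda>\<omega>. glued (s + t) \<omega> - glued s \<omega>) = distr \<Omega> borel (glued t)"
      if "0 \<le> s" "0 \<le> t" for s t
      using distr_glued_increment[of s "s + t"] that by (simp add: d)
  qed
  then show ?thesis
    unfolding skipfree_chain_def compound_poisson_def
    using T.sets_nu T.finite_nu T.nu_zero T.supp_nu T.supp_nu_pos T.char_marginal
    by (simp add: d)
qed

lemma skipfree_chain_chain_law: "skipfree_chain h (tilt b \<nu>) (chain_law h (tilt b \<nu>)) coord"
  unfolding chain_law_def
  by (rule someI, rule skipfree_chain_path_space[OF skipfree_chain_glued glued_measurable])

end

end

section \<open>Scale functions\<close>

lemma skipfree_processI:
  assumes "h > 0" "skipfree_chain h \<nu> M X"
  shows "skipfree_process h \<nu> M X"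
  using assms
  by (auto intro!: skipfree_process.intro skipfree_measure.intro skipfree_process_axioms.intro
      simp: skipfree_chain_def compound_poisson_def)

lemma step_function_filters:
  fixes u :: "nat \<Rightarrow> real" and h :: real
  assumes h: "h > 0" and x: "x \<ge> 0"
  defines "f \<equiv> \<lambda>x. u (nat \<lfloor>x / h\<rfloor>)"
  shows "eventually (\<lambda>y. f y = f x) (at_right x)"
    and "x > 0 \<Longrightarrow> \<exists>c. eventually (\<lambda>y. f y = c) (at_left x)"
    and "x / h \<notin> \<int> \<Longrightarrow> eventually (\<lambda>y. f y = f x) (at x)"
proof -
  define k where "k = \<lfloor>x / h\<rfloor>"
  have k: "h * of_int k \<le> x" "x < h * (of_int k + 1)"
  proof -
    have "of_int k \<le> x / h" "x / h < of_int k + 1" unfolding k_def by linarith+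
    then show "h * of_int k \<le> x" "x < h * (of_int k + 1)"
      using h by (simp_all add: pos_le_divide_eq pos_divide_less_eq mult.commute)
  qed
  have const: "f y = u (nat j)" if "h * of_int j \<le> y" "y < h * (of_int j + 1)" for y j
  proof -
    have "\<lfloor>y / h\<rfloor> = j" using that h by (simp add: floor_eq_iff field_simps)
    then show ?thesis by (simp add: f_def)
  qed
  show "eventually (\<lambda>y. f y = f x) (at_right x)"
    using const[of k] k by (auto simp: eventually_at_right_field intro!: exI[of _ "h * (of_int k + 1)"])
  show "\<exists>c. eventually (\<lambda>y. f y = c) (at_left x)" if "x > 0"
  proof (cases "x = h * of_int k")
    case True
    then have "eventually (\<lambda>y. f y = u (nat (k - 1))) (at_left x)"
      using const[of "k - 1"] h
      by (auto simp: eventually_at_left_field algebra_simps intro!: exI[of _ "h * (of_int k - 1)"])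
    then show ?thesis by blast
  next
    case False
    then have "eventually (\<lambda>y. f y = u (nat k)) (at_left x)"
      using const[of k] k by (auto simp: eventually_at_left_field intro!: exI[of _ "h * of_int k"])
    then show ?thesis by blast
  qed
  show "eventually (\<lambda>y. f y = f x) (at x)" if "x / h \<notin> \<int>"
  proof -
    have "x \<noteq> h * of_int k"
    proof
      assume "x = h * of_int k"
      then have "x / h = of_int k" using h by simp
      with that show False by simp
    qed
    then have "x \<in> {h * of_int k<..<h * (of_int k + 1)}" using k by simp
    then have "eventually (\<lambda>y. y \<in> {h * of_int k<..<h * (of_int k + 1)}) (at x)"
      by (intro eventually_at_in_open') auto
    then show ?thesis
      by eventually_elim (use const[of k] k in auto)
  qed
qed

lemma admissible_step:
  fixes u :: "nat \<Rightarrow> real" and h :: real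
  assumes h: "h > 0" and u: "\<And>n. u n \<ge> 0" and A: "A \<ge> 0" "\<alpha> \<ge> 0" "\<And>n. u n \<le> A * exp (\<alpha> * (h * real n))"
  shows "admissible (\<lambda>x. u (nat \<lfloor>x / h\<rfloor>))"
proof -
  let ?f = "\<lambda>x. u (nat \<lfloor>x / h\<rfloor>)"
  have rc: "(?f \<longlongrightarrow> ?f x) (at_right x)" if "x \<ge> 0" for x
    by (rule tendsto_eventually[OF step_function_filters(1)[OF h that]])
  have "right_continuous ?f"
    using rc by (simp add: right_continuous_def continuous_within)
  moreover have "piecewise_continuous ?f"
    unfolding piecewise_continuous_def
  proof (intro conjI allI impI)
    fix b :: real assume "b \<ge> 0"
    have "{x \<in> {0..b}. \<not> continuous (at x within {0..}) ?f} \<subseteq> (\<lambda>k. h * of_int k) ` {0..\<lfloor>b / h\<rfloor>}"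
    proof
      fix x assume x: "x \<in> {x \<in> {0..b}. \<not> continuous (at x within {0..}) ?f}"
      have "x / h \<in> \<int>"
      proof (rule ccontr)
        assume "x / h \<notin> \<int>"
        then have "eventually (\<lambda>y. ?f y = ?f x) (at x)"
          using x by (intro step_function_filters(3)[OF h]) auto
        then have "(?f \<longlongrightarrow> ?f x) (at x)" by (rule tendsto_eventually)
        then have "(?f \<longlongrightarrow> ?f x) (at x within {0..})"
          by (rule tendsto_within_subset) simp
        then have "continuous (at x within {0..}) ?f"
          unfolding continuous_within .
        with x show False by simp
      qed
      then obtain k where k: "x / h = of_int k" by (auto elim: Ints_cases)
      then have xk: "x = h * of_int k" using h by (simp add: field_simps)
      have "of_int k \<le> b / h" "0 \<le> (of_int k :: real)"
        using x h unfolding k[symmetric] by (auto simp: divide_right_mono)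
      then have "k \<in> {0..\<lfloor>b / h\<rfloor>}" by (auto simp: le_floor_iff)
      with xk show "x \<in> (\<lambda>k. h * of_int k) ` {0..\<lfloor>b / h\<rfloor>}" by blast
    qed
    then show "finite {x \<in> {0..b}. \<not> continuous (at x within {0..}) ?f}"
      by (rule finite_subset) simp
  next
    fix x :: real assume "x \<ge> 0"
    then show "\<exists>l. (?f \<longlongrightarrow> l) (at_right x)" using rc by blast
  next
    fix x :: real assume x: "x > 0"
    then obtain c where "eventually (\<lambda>y. ?f y = c) (at_left x)"
      using step_function_filters(2)[OF h, of x u] by auto
    then show "\<exists>l. (?f \<longlongrightarrow> l) (at_left x)" by (intro exI[of _ c] tendsto_eventually)
  qed
  moreover have "exponential_order ?f"
    unfolding exponential_order_def
  proof (intro exI conjI allI impI)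
    fix x :: real assume x: "x \<ge> 0"
    have "real (nat \<lfloor>x / h\<rfloor>) \<le> x / h" using x h by simp
    then have "h * real (nat \<lfloor>x / h\<rfloor>) \<le> x"
      using h by (simp only: pos_le_divide_eq mult.commute)
    then have "A * exp (\<alpha> * (h * real (nat \<lfloor>x / h\<rfloor>))) \<le> A * exp (\<alpha> * x)"
      using A by (intro mult_left_mono) (auto intro: mult_left_mono)
    with A(3)[of "nat \<lfloor>x / h\<rfloor>"] show "?f x \<le> A * exp (\<alpha> * x)" by linarith
  qed (use A in auto)
  ultimately show ?thesis using u by (simp add: admissible_def)
qed

section \<open>Evaluation of the defining products and of the normalising constant\<close>

context skipfree_process
begin

text \<open>Each factor is a quotient of consecutive values of the scale sequence, so the product
  telescopes.\<close>

lemma scale_denom_eq: "scale_denom h M X x = scale_seq 0 / scale_seq (nat \<lfloor>x / h\<rfloor>)"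
proof -
  have step: "measure (completion M) {\<omega> \<in> space M. D1 h X \<omega> \<le> ereal ((real (Suc r) - 1) * h)} = scale_seq r / scale_seq (Suc r)" for r
  proof -
    let ?F = "\<lambda>\<omega>. discount 0 (passage X (h * real 1) \<omega>) *
        indicator {\<omega>. ereal (- (h * real r)) \<le> run_inf X (passage X (h * real 1) \<omega>) \<omega>} \<omega>"
    have rec: "coef 0 * scale_seq (Suc i) = (mass + 0) * scale_seq i - (\<Sum>k\<le>i. coef (Suc k) * scale_seq (i - k))" for i
      using coef_0_pos by (simp add: scale_seq.simps(2))
    have 1: "?F \<in> borel_measurable (completion M)" "(LINT \<omega>|completion M. ?F \<omega>) = scale_seq r / scale_seq (r + 1)"
      using h_pos scale_seq_pos[of "r + 1"]
      by (intro fluctuation_identity[OF rec]; simp)+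
    let ?E = "{\<omega> \<in> space M. D1 h X \<omega> \<le> ereal ((real (Suc r) - 1) * h)}"
    \<comment> \<open>For \<open>q = 0\<close> the convention in \<open>discount\<close> gives 1
      also at an infinite passage time. So \<open>?F\<close> is an indicator everywhere, and the
      measurability of the event follows from that of \<open>?F\<close>.\<close>
    have F: "?F \<omega> = indicator ?E \<omega>" if "\<omega> \<in> space M" for \<omega>
    proof -
      have "D1 h X \<omega> \<le> ereal ((real (Suc r) - 1) * h) \<longleftrightarrow> ereal (- (h * real r)) \<le> run_inf X (passage X h \<omega>) \<omega>"
        unfolding D1_def by (subst ereal_uminus_le_reorder) (simp add: mult.commute)
      then show ?thesis using that by (simp add: indicator_def discount_def)
    qed
    have "?F -` {1} \<inter> space (completion M) \<in> sets (completion M)"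
      using 1(1) by (rule measurable_sets) simp
    also have "?F -` {1} \<inter> space (completion M) = ?E"
      using F by (auto simp: indicator_def split: if_splits)
    finally have "?E \<in> sets (completion M)" .
    then have "(LINT \<omega>|completion M. indicator ?E \<omega>) = measure (completion M) ?E"
      by (simp add: Int_def conj_commute)
    moreover have "(LINT \<omega>|completion M. ?F \<omega>) = (LINT \<omega>|completion M. indicator ?E \<omega>)"
    proof (rule Bochner_Integration.integral_cong[OF refl])
      fix \<omega> assume "\<omega> \<in> space (completion M)"
      then have "\<omega> \<in> space M" by simp
      then show "?F \<omega> = indicator ?E \<omega>" by (rule F)
    qed
    ultimately show ?thesis using 1(2) by simp
  qed
  have "scale_denom h M X x = (\<Prod>r=1..nat \<lfloor>x / h\<rfloor>. scale_seq (r - 1) / scale_seq r)"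
    unfolding scale_denom_def
  proof (rule prod.cong[OF refl])
    fix r assume "r \<in> {1..nat \<lfloor>x / h\<rfloor>}"
    then obtain s where "r = Suc s" by (cases r) auto
    then show "measure (completion M) {\<omega> \<in> space M. D1 h X \<omega> \<le> ereal ((real r - 1) * h)} = scale_seq (r - 1) / scale_seq r"
      using step[of s] by simp
  qed
  also have "(\<Prod>r=1..n. scale_seq (r - 1) / scale_seq r) = scale_seq 0 / scale_seq n" for n
  proof (induction n)
    case 0
    then show ?case using scale_seq_pos[of 0] by simp
  next
    case (Suc n)
    then show ?case using scale_seq_pos[of n] by simp
  qed
  finally show ?thesis .
qed

text \<open>Under \<open>Phi \<nu> 0 = 0\<close> the exponent is positive on the positive half-line,
  so the generating function of the scale sequence yields the transform that fixes the constant.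
  Tilting by \<open>Phi \<nu> q\<close> leads to this situation.\<close>

lemma scale_fun_eq:
  assumes Phi: "Phi \<nu> 0 = 0"
  shows "scale_fun h \<nu> M X x = scale_seq (nat \<lfloor>x / h\<rfloor>)"
proof -
  let ?L = "\<lambda>\<beta>. (exp (\<beta> * h) - 1) / (\<beta> * h * psi \<nu> \<beta>)"
  have pos: "psi \<nu> \<gamma> > 0" if "\<gamma> > 0" for \<gamma>
    using psi_gt[of 0 \<gamma>] Phi that by simp
  have s0: "scale_seq 0 > 0" by (rule scale_seq_pos)
  have f: "c / scale_denom h M X x = c / scale_seq 0 * scale_seq (nat \<lfloor>x / h\<rfloor>)" for c x
    by (simp add: scale_denom_eq)
  have lap: "has_laplace (\<lambda>x. c / scale_denom h M X x) \<beta> (c / scale_seq 0 * ?L \<beta>)" if "\<beta> > 0" "c \<ge> 0" for \<beta> c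
  proof -
    have "(\<lambda>n. (c / scale_seq 0 * scale_seq n) * exp (- \<beta> * h) ^ n) sums (c / scale_seq 0 * (exp (\<beta> * h) / (h * psi \<nu> \<beta>)))"
      using sums_mult[OF scale_seq_gf[OF pos that(1)], of "c / scale_seq 0"] by (simp add: mult.assoc)
    then have "has_laplace (\<lambda>x. c / scale_seq 0 * scale_seq (nat \<lfloor>x / h\<rfloor>)) \<beta>
        ((1 - exp (- \<beta> * h)) / \<beta> * (c / scale_seq 0 * (exp (\<beta> * h) / (h * psi \<nu> \<beta>))))"
      using scale_seq_pos that s0
      by (intro has_laplace_step[OF h_pos, where u="\<lambda>n. c / scale_seq 0 * scale_seq n"]) (auto intro!: divide_nonneg_pos mult_nonneg_nonneg less_imp_le[OF scale_seq_pos])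
    also have "(1 - exp (- \<beta> * h)) / \<beta> * (c / scale_seq 0 * (exp (\<beta> * h) / (h * psi \<nu> \<beta>))) = c / scale_seq 0 * ?L \<beta>"
    proof -
      have "(1 - exp (- \<beta> * h)) * exp (\<beta> * h) = exp (\<beta> * h) - 1"
        by (simp add: left_diff_distrib exp_add[symmetric])
      then show ?thesis by (simp add: mult_ac)
    qed
    finally show ?thesis by (simp add: f)
  qed
  have "scale_const h \<nu> M X = scale_seq 0"
    unfolding scale_const_def Phi
  proof (rule the_equality)
    show "0 < scale_seq 0 \<and> (\<forall>\<beta>>0. has_laplace (\<lambda>x. scale_seq 0 / scale_denom h M X x) \<beta> (?L \<beta>))"
    proof (intro conjI allI impI s0)
      fix \<beta> :: real assume "\<beta> > 0"
      from lap[OF this, of "scale_seq 0"] s0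
      show "has_laplace (\<lambda>x. scale_seq 0 / scale_denom h M X x) \<beta> (?L \<beta>)" by simp
    qed
    fix c assume c: "0 < c \<and> (\<forall>\<beta>>0. has_laplace (\<lambda>x. c / scale_denom h M X x) \<beta> (?L \<beta>))"
    \<comment> \<open>Uniqueness of the constant: the transform is linear in \<open>c\<close>, and
      its value at \<open>\<beta> = 1\<close> is not 0.\<close>
    have "has_laplace (\<lambda>x. c / scale_denom h M X x) 1 (c / scale_seq 0 * ?L 1)"
      by (rule lap) (use c in simp_all)
    moreover have "has_laplace (\<lambda>x. c / scale_denom h M X x) 1 (?L 1)"
      using c zero_less_one by blast
    ultimately have "c / scale_seq 0 * ?L 1 = ?L 1" by (simp add: has_laplace_def)
    moreover have "?L 1 \<noteq> 0" using pos[of 1] h_pos by simp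
    ultimately have "c / scale_seq 0 = 1"
      by (metis mult_cancel_right1)
    then show "c = scale_seq 0" using s0 by simp
  qed
  then show ?thesis using s0 by (simp add: scale_fun_def f)
qed

end

context skipfree_measure
begin

text \<open>\<open>W\<^sup>(\<^sup>q\<^sup>)\<close> on the lattice: the scale sequence of the measure tilted by \<open>\<Phi>(q)\<close>, tilted back.\<close>

definition q_scale_seq :: "real \<Rightarrow> nat \<Rightarrow> real" where
  "q_scale_seq q n = exp (Phi \<nu> q * h * real (Suc n)) * skipfree_measure.scale_seq h (tilt (Phi \<nu> q) \<nu>) n"

context
  fixes q :: real assumes q: "q \<ge> 0"
begin

interpretation T: skipfree_measure h "tilt (Phi \<nu> q) \<nu>"
  by (rule skipfree_measure_tilt[OF Phi_nonneg[OF q]])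

lemma psi_tilt_Phi: "\<gamma> \<ge> 0 \<Longrightarrow> psi (tilt (Phi \<nu> q) \<nu>) \<gamma> = psi \<nu> (\<gamma> + Phi \<nu> q) - q"
  using psi_tilt[OF Phi_nonneg[OF q]] psi_Phi[OF q] by simp

lemma psi_tilt_Phi_pos: "\<gamma> > 0 \<Longrightarrow> psi (tilt (Phi \<nu> q) \<nu>) \<gamma> > 0"
  using psi_gt[OF q, of "\<gamma> + Phi \<nu> q"] by (simp add: psi_tilt_Phi)

lemma q_scale_seq_pos: "q_scale_seq q n > 0"
  using T.scale_seq_pos by (simp add: q_scale_seq_def)

text \<open>Multiplication by \<open>exp (Phi \<nu> q * h * n)\<close> removes the exponential
  factors from the tilted rates, while the tilted total rate is \<open>mass + q\<close>; this turns
  \<open>L w = 0\<close> for the tilted chain into \<open>L w = q w\<close>. The extra constant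
  factor in \<open>q_scale_seq\<close> comes from the floor of \<open>1 + x / h\<close> in
  \<open>Wq\<close>.\<close>

lemma q_scale_seq_rec:
  "coef 0 * q_scale_seq q (Suc i) = (mass + q) * q_scale_seq q i - (\<Sum>k\<le>i. coef (Suc k) * q_scale_seq q (i - k))"
proof -
  let ?b = "Phi \<nu> q"
  note b = Phi_nonneg[OF q]
  let ?e = "exp (?b * h * real (Suc i))"
  have coef: "T.coef j = coef j * exp (?b * h * (1 - real j))" for j by (rule coef_tilt[OF b])
  have mass: "T.mass = mass + q" using mass_tilt[OF b] psi_Phi[OF q] by simp
  have term_eq: "?e * (T.coef (Suc k) * T.scale_seq (i - k)) = coef (Suc k) * q_scale_seq q (i - k)" if "k \<le> i" for k
  proof -
    have "?e * exp (?b * h * (1 - real (Suc k))) = exp (?b * h * real (Suc (i - k)))"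
      using that by (simp add: exp_add[symmetric] of_nat_diff algebra_simps)
    then show ?thesis unfolding coef q_scale_seq_def by (simp only: mult_ac)
  qed
  have "coef 0 * q_scale_seq q (Suc i) = ?e * (T.coef 0 * T.scale_seq (Suc i))"
    by (simp add: coef q_scale_seq_def exp_add[symmetric] algebra_simps)
  also have "T.coef 0 * T.scale_seq (Suc i) = T.mass * T.scale_seq i - (\<Sum>k\<le>i. T.coef (Suc k) * T.scale_seq (i - k))"
    using T.coef_0_pos by (simp add: T.scale_seq.simps(2))
  also have "?e * \<dots> = (mass + q) * q_scale_seq q i - (\<Sum>k\<le>i. ?e * (T.coef (Suc k) * T.scale_seq (i - k)))"
    by (simp add: mass q_scale_seq_def right_diff_distrib sum_distrib_left mult_ac)
  also have "(\<Sum>k\<le>i. ?e * (T.coef (Suc k) * T.scale_seq (i - k))) = (\<Sum>k\<le>i. coef (Suc k) * q_scale_seq q (i - k))"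
    by (intro sum.cong refl term_eq) simp
  finally show ?thesis .
qed

lemma q_scale_seq_admissible: "admissible (\<lambda>x. q_scale_seq q (nat \<lfloor>x / h\<rfloor>))"
proof (rule admissible_step[OF h_pos])
  let ?b = "Phi \<nu> q"
  note b = Phi_nonneg[OF q]
  show "q_scale_seq q n \<ge> 0" for n using q_scale_seq_pos[of n] by simp
  show "exp (?b * h) * T.scale_seq 0 \<ge> 0" using T.scale_seq_pos[of 0] by simp
  \<comment> \<open>The exponential rate is \<open>Phi \<nu> q\<close> from tilting back, plus
    \<open>1 / h\<close> to absorb the linear growth: \<open>n + 1 \<le> exp n\<close>, and
    \<open>n = (1 / h) * (h * n)\<close>.\<close>
  show "?b + 1 / h \<ge> 0" using b h_pos by simp
  fix n
  have "T.scale_seq n \<le> real (Suc n) * T.scale_seq 0"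
    using psi_tilt_Phi_pos by (intro T.scale_seq_le) (auto intro: less_imp_le)
  also have "real (Suc n) \<le> exp (real n)" using exp_ge_add_one_self[of "real n"] by simp
  finally have "T.scale_seq n \<le> exp (real n) * T.scale_seq 0"
    using T.scale_seq_pos[of 0] by (simp add: mult_right_mono)
  then have "q_scale_seq q n \<le> exp (?b * h * real (Suc n)) * (exp (real n) * T.scale_seq 0)"
    unfolding q_scale_seq_def by (intro mult_left_mono) auto
  also have "\<dots> = exp (?b * h) * T.scale_seq 0 * exp ((?b + 1 / h) * (h * real n))"
    using h_pos by (simp add: exp_add[symmetric] algebra_simps)
  finally show "q_scale_seq q n \<le> exp (?b * h) * T.scale_seq 0 * exp ((?b + 1 / h) * (h * real n))" .
qed

lemma q_scale_seq_transform: "scale_transform h \<nu> q (\<lambda>x. q_scale_seq q (nat \<lfloor>x / h\<rfloor>))"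
  unfolding scale_transform_def
proof (intro allI impI)
  let ?b = "Phi \<nu> q"
  fix \<beta> assume \<beta>: "\<beta> > ?b"
  define \<gamma> where "\<gamma> = \<beta> - ?b"
  have \<gamma>: "\<gamma> > 0" using \<beta> by (simp add: \<gamma>_def)
  have \<beta>0: "\<beta> > 0" using \<beta> Phi_nonneg[OF q] by simp
  have psi: "psi (tilt ?b \<nu>) \<gamma> = psi \<nu> \<beta> - q" using \<gamma> psi_tilt_Phi[of \<gamma>] by (simp add: \<gamma>_def)
  have "(\<lambda>n. exp (?b * h) * (T.scale_seq n * exp (- \<gamma> * h) ^ n)) sums
      (exp (?b * h) * (exp (\<gamma> * h) / (h * psi (tilt ?b \<nu>) \<gamma>)))"
    by (intro sums_mult T.scale_seq_gf[OF _ \<gamma>] psi_tilt_Phi_pos)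
  also have "(\<lambda>n. exp (?b * h) * (T.scale_seq n * exp (- \<gamma> * h) ^ n)) = (\<lambda>n. q_scale_seq q n * exp (- \<beta> * h) ^ n)"
  proof
    fix n
    have "exp (?b * h) * exp (- \<gamma> * h) ^ n = exp (?b * h * real (Suc n)) * exp (- \<beta> * h) ^ n"
      by (simp add: exp_of_nat_mult[symmetric] exp_add[symmetric] \<gamma>_def algebra_simps)
    then show "exp (?b * h) * (T.scale_seq n * exp (- \<gamma> * h) ^ n) = q_scale_seq q n * exp (- \<beta> * h) ^ n"
      unfolding q_scale_seq_def by (metis mult.assoc mult.commute)
  qed
  also have "exp (?b * h) * (exp (\<gamma> * h) / (h * psi (tilt ?b \<nu>) \<gamma>)) = exp (\<beta> * h) / (h * (psi \<nu> \<beta> - q))"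
    unfolding psi by (simp add: exp_add[symmetric] \<gamma>_def algebra_simps)
  finally have "has_laplace (\<lambda>x. q_scale_seq q (nat \<lfloor>x / h\<rfloor>)) \<beta>
      ((1 - exp (- \<beta> * h)) / \<beta> * (exp (\<beta> * h) / (h * (psi \<nu> \<beta> - q))))"
    using q_scale_seq_pos by (intro has_laplace_step[OF h_pos \<beta>0]) (auto intro: less_imp_le)
  also have "(1 - exp (- \<beta> * h)) / \<beta> * (exp (\<beta> * h) / (h * (psi \<nu> \<beta> - q))) =
      (exp (\<beta> * h) - 1) / (\<beta> * h * (psi \<nu> \<beta> - q))"
  proof -
    have "(1 - exp (- \<beta> * h)) * exp (\<beta> * h) = exp (\<beta> * h) - 1"
      by (simp add: left_diff_distrib exp_add[symmetric])
    then show ?thesis by (simp add: mult_ac)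
  qed
  finally show "has_laplace (\<lambda>x. q_scale_seq q (nat \<lfloor>x / h\<rfloor>)) \<beta> ((exp (\<beta> * h) - 1) / (\<beta> * h * (psi \<nu> \<beta> - q)))" .
qed

end

end

text \<open>\<open>Wq\<close> is known to be the step function on the nonnegative half-line only,
  and there the properties have to be transferred.\<close>

lemma admissible_cong:
  assumes eq: "\<And>x. x \<ge> 0 \<Longrightarrow> f x = g x" and f: "admissible f"
  shows "admissible g"
proof -
  have right: "eventually (\<lambda>y. f y = g y) (at_right x)" if "x \<ge> 0" for x
    using that eq by (auto simp: eventually_at_right_field intro!: exI[of _ "x + 1"])
  have left: "eventually (\<lambda>y. f y = g y) (at_left x)" if "x > 0" for x
    using that eq by (auto simp: eventually_at_left_field intro!: exI[of _ 0])
  have within: "continuous (at x within {0..}) f \<longleftrightarrow> continuous (at x within {0..}) g" if "x \<ge> 0" for x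
    unfolding continuous_within eq[OF that] using eq by (intro Lim_cong_within) auto
  have "right_continuous g"
    unfolding right_continuous_def continuous_within
  proof (intro allI impI)
    fix x :: real assume x: "x \<ge> 0"
    then have "(f \<longlongrightarrow> g x) (at_right x)"
      using f x unfolding eq[OF x, symmetric]
      by (simp add: admissible_def right_continuous_def continuous_within)
    then show "(g \<longlongrightarrow> g x) (at_right x)" using right[OF x] by (rule Lim_transform_eventually)
  qed
  moreover have "piecewise_continuous g"
    unfolding piecewise_continuous_def
  proof (intro conjI allI impI)
    fix b :: real assume "b \<ge> 0"
    then have "finite {x \<in> {0..b}. \<not> continuous (at x within {0..}) f}"
      using f by (simp add: admissible_def piecewise_continuous_def)
    also have "{x \<in> {0..b}. \<not> continuous (at x within {0..}) f} = {x \<in> {0..b}. \<not> continuous (at x within {0..}) g}"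
      using within by auto
    finally show "finite {x \<in> {0..b}. \<not> continuous (at x within {0..}) g}" .
  next
    fix x :: real assume x: "x \<ge> 0"
    then obtain l where "(f \<longlongrightarrow> l) (at_right x)"
      using f unfolding admissible_def piecewise_continuous_def by blast
    then have "(g \<longlongrightarrow> l) (at_right x)" using right[OF x] by (rule Lim_transform_eventually)
    then show "\<exists>l. (g \<longlongrightarrow> l) (at_right x)" by blast
  next
    fix x :: real assume x: "x > 0"
    then obtain l where "(f \<longlongrightarrow> l) (at_left x)"
      using f unfolding admissible_def piecewise_continuous_def by blast
    then have "(g \<longlongrightarrow> l) (at_left x)" using left[OF x] by (rule Lim_transform_eventually)
    then show "\<exists>l. (g \<longlongrightarrow> l) (at_left x)" by blast
  qed
  moreover have "exponential_order g"
    using f eq by (auto simp: admissible_def exponential_order_def)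
  ultimately show ?thesis using f eq by (simp add: admissible_def)
qed

lemma has_laplace_cong:
  assumes "\<And>x. x \<ge> 0 \<Longrightarrow> f x = g x"
  shows "has_laplace f \<beta> v \<longleftrightarrow> has_laplace g \<beta> v"
proof -
  have "(\<lambda>x. indicator {0..} x *\<^sub>R (exp (- \<beta> * x) * f x)) = (\<lambda>x. indicator {0..} x *\<^sub>R (exp (- \<beta> * x) * g x))"
    using assms by (auto simp: fun_eq_iff indicator_def)
  then show ?thesis by (simp add: has_laplace_def set_integrable_def set_lebesgue_integral_def)
qed

text \<open>\<open>scale_fun_eq\<close> holds for every chain with the tilted Levy measure, in
  particular for the one selected by \<open>chain_law\<close>, so the choice leaves no trace in the
  value.\<close>

lemma (in skipfree_process) Wq_eq:
  assumes q: "q \<ge> 0" and x: "x \<ge> 0"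
  shows "Wq h \<nu> q x = q_scale_seq q (nat \<lfloor>x / h\<rfloor>)"
proof -
  let ?b = "Phi \<nu> q"
  interpret T: skipfree_process h "tilt ?b \<nu>" "chain_law h (tilt ?b \<nu>)" coord
    by (rule skipfree_processI[OF h_pos skipfree_chain_chain_law[OF Phi_nonneg[OF q]]])
  have "W_tilt h \<nu> ?b x = T.scale_seq (nat \<lfloor>x / h\<rfloor>)"
    unfolding W_tilt_def by (rule T.scale_fun_eq[OF Phi_tilt_Phi[OF q]])
  moreover have "real_of_int \<lfloor>1 + x / h\<rfloor> = real (Suc (nat \<lfloor>x / h\<rfloor>))"
    using x h_pos by simp
  ultimately show ?thesis unfolding Wq_def q_scale_seq_def by (simp add: mult_ac)
qed

theorem theorem4p6:
  fixes h :: real and \<nu> :: "real measure"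
    and M :: "'a measure" and X :: "real \<Rightarrow> 'a \<Rightarrow> real"
  assumes "h > 0" and "skipfree_chain h \<nu> M X"
  shows "\<forall>q\<ge>0.
      admissible (Wq h \<nu> q) \<and> scale_transform h \<nu> q (Wq h \<nu> q) \<and>
      (\<forall>f. admissible f \<and> scale_transform h \<nu> q f \<longrightarrow> (\<forall>x\<ge>0. f x = Wq h \<nu> q x)) \<and>
      (\<forall>y\<in>Zh h \<inter> {0..}. \<forall>x\<ge>0.
         (LINT \<omega>|completion M. discount q (passage X y \<omega>) *
            indicator {\<omega>. ereal (- x) \<le> run_inf X (passage X y \<omega>) \<omega>} \<omega>) =
         Wq h \<nu> q x / Wq h \<nu> q (x + y))"
proof (intro allI impI)
  fix q :: real assume q: "0 \<le> q"
  interpret skipfree_process h \<nu> M X by (rule skipfree_processI[OF assms])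
  let ?u = "\<lambda>x. q_scale_seq q (nat \<lfloor>x / h\<rfloor>)"
  have W: "?u x = Wq h \<nu> q x" if "x \<ge> 0" for x by (rule Wq_eq[OF q that, symmetric])
  have adm: "admissible (Wq h \<nu> q)"
    using W q_scale_seq_admissible[OF q] by (rule admissible_cong)
  have trans: "scale_transform h \<nu> q (Wq h \<nu> q)"
    using q_scale_seq_transform[OF q] has_laplace_cong[of ?u "Wq h \<nu> q", OF W]
    by (simp add: scale_transform_def)
  have uniq: "f x = Wq h \<nu> q x" if f: "admissible f" "scale_transform h \<nu> q f" and x: "x \<ge> 0" for f x
  proof (rule laplace_unique[OF _ _ _ x])
    show "right_continuous f" "right_continuous (Wq h \<nu> q)" using f adm by (auto simp: admissible_def)
    show "has_laplace f \<beta> ((exp (\<beta> * h) - 1) / (\<beta> * h * (psi \<nu> \<beta> - q))) \<and>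
        has_laplace (Wq h \<nu> q) \<beta> ((exp (\<beta> * h) - 1) / (\<beta> * h * (psi \<nu> \<beta> - q)))" if "\<beta> > Phi \<nu> q" for \<beta>
      using f trans that by (simp add: scale_transform_def)
  qed
  have fluct: "(LINT \<omega>|completion M. discount q (passage X y \<omega>) *
            indicator {\<omega>. ereal (- x) \<le> run_inf X (passage X y \<omega>) \<omega>} \<omega>) =
         Wq h \<nu> q x / Wq h \<nu> q (x + y)" if y: "y \<in> Zh h \<inter> {0..}" and x: "x \<ge> 0" for x y
  proof -
    obtain k where k: "y = h * of_int k" using y by (auto simp: Zh_def)
    then have "k \<ge> 0" using y h_pos by (simp add: zero_le_mult_iff)
    then obtain n where "k = int n" using nonneg_int_cases by blast
    then have yn: "y = h * real n" using k by simp
    define m where "m = nat \<lfloor>x / h\<rfloor>"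
    have m: "int m = \<lfloor>x / h\<rfloor>" using x h_pos by (simp add: m_def)
    \<comment> \<open>As \<open>y\<close> is a whole number of lattice steps, the integer part of
      the sum splits without a carry.\<close>
    have "(x + y) / h = x / h + real n" using h_pos yn by (simp add: add_divide_distrib)
    then have "\<lfloor>(x + y) / h\<rfloor> = int (m + n)" using m by simp
    then have mn: "nat \<lfloor>(x + y) / h\<rfloor> = m + n" by simp
    have "q_scale_seq q (m + n) \<noteq> 0" using q_scale_seq_pos[OF q, of "m + n"] by simp
    from fluctuation_identity(2)[OF q_scale_seq_rec[OF q] this q x m]
    show ?thesis using W[OF x] W[of "x + y"] x y by (simp add: yn[symmetric] mn m_def[symmetric])
  qed
  show "admissible (Wq h \<nu> q) \<and> scale_transform h \<nu> q (Wq h \<nu> q) \<and>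
      (\<forall>f. admissible f \<and> scale_transform h \<nu> q f \<longrightarrow> (\<forall>x\<ge>0. f x = Wq h \<nu> q x)) \<and>
      (\<forall>y\<in>Zh h \<inter> {0..}. \<forall>x\<ge>0.
         (LINT \<omega>|completion M. discount q (passage X y \<omega>) *
            indicator {\<omega>. ereal (- x) \<le> run_inf X (passage X y \<omega>) \<omega>} \<omega>) =
         Wq h \<nu> q x / Wq h \<nu> q (x + y))"
    using adm trans uniq fluct by blast
qed

end
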